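(* Assume ZFC together with Martin's axiom. Then there are two subgroups $H_1, H_2$ of the Baer-Specker group $P = \mathbb{Z}^\omega$ with the following properties. (i) For $i = 1,2$: $S \subseteq H_i \subseteq \mathbb{D}$, where these inclusions are pure. (ii) For $i=1,2$: $H_i$ is $\aleph_1$-free and slender. (iii) The scalar product $\Phi(\mathbf{a},\mathbf{b}) = \sum_{i\in\omega} a_i b_i$ restricts to a bilinear form $\Phi : H_1 \times H_2 \longrightarrow \mathbb{Z}$ (i.e. takes values in $\mathbb{Z}$ on $H_1 \times H_2$) which induces $H_1^* \cong H_2$ and $H_2^* \cong H_1$, i.e. the maps $H_2 \to H_1^*$, $h \mapsto \Phi(\ \cdot\ , h)$ and $H_1 \to H_2^*$, $h \mapsto \Phi(h, \ \cdot\ )$ are isomorphisms, such that $H_1$ and $H_2$ are reflexive. (iv) $H_i \oplus \mathbb{Z} \not\cong H_i$ for $i = 1,2$. (v) $\operatorname{End} H_i = \mathbb{Z} \oplus \operatorname{Fin} H_i$ for $i=1,2$, where $\mathbb{Z}$ is identified with the integer multiples of the identity; that is, every endomorphism of $H_i$ can be written uniquely as $s\cdot \mathrm{id} + \varphi$ with $s \in \mathbb{Z}$ and $\varphi \in \operatorname{Fin} H_i$.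
   Context: All groups are abelian. $P = \mathbb{Z}^\omega$ is the Baer-Specker group of all $\mathbf{x} = \sum_{i\in\omega} x_i \mathbf{e}_i$ with $x_i\in\mathbb{Z}$ (arbitrary integer sequences with componentwise addition; $\mathbf{e}_i$ is the $i$-th unit vector). $S = \bigoplus_{i\in\omega} \mathbf{e}_i\mathbb{Z}$ is the subgroup of elements of finite support, and $\mathbb{D}$ is the $\mathbb{Z}$-adic closure of $S$ in $P$, i.e. $\mathbb{D}/S$ is the maximal divisible subgroup of $P/S$ (equivalently, $\mathbf{x}\in\mathbb{D}$ iff for every $n\in\mathbb{N}$, $n$ divides $x_i$ for all but finitely many $i$). $\widehat{\mathbb{Z}}$ is the $\mathbb{Z}$-adic completion of $\mathbb{Z}$. For $\mathbf{a} = \sum a_i\mathbf{e}_i, \mathbf{b} = \sum b_i \mathbf{e}_i \in \mathbb{D}$, the sum $\Phi(\mathbf{a},\mathbf{b}) = \sum_{i\in\omega} a_i b_i$ converges in $\widehat{\mathbb{Z}}$, giving a symmetric bilinear form $\Phi:\mathbb{D}\times\mathbb{D}\to\widehat{\mathbb{Z}}$. For an abelian group $G$, $G^* = \operatorname{Hom}(G,\mathbb{Z})$, and $G$ is reflexive if the evaluation map $\sigma: G \to G^{**}$, $\sigma(g)(\varphi) = \varphi(g)$, is an isomorphism. A group is $\aleph_1$-free if all its countable subgroups are free. A torsion-free group $G$ is slender if every homomorphism $\mathbb{Z}^\omega\to G$ sends $\mathbf{e}_n$ to $0$ for almost all $n$. $\operatorname{Fin} H$ is the ideal of $\operatorname{End}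 H$ consisting of all endomorphisms whose image has finite rank. Martin's axiom is the usual statement that for every c.c.c. poset and every family of fewer than $2^{\aleph_0}$ dense subsets there is a directed generic subset meeting all of them (CH is not excluded). *)

theory Defs
  imports
    "HOL-Algebra.Free_Abelian_Groups"
    "HOL-Analysis.Abstract_Limits"
    "HOL-Analysis.Function_Topology"
    "HOL-Library.Equipollence"
begin

section \<open>Martin's axiom\<close>

definition compatible_in :: "'a set \<Rightarrow> 'a rel \<Rightarrow> 'a \<Rightarrow> 'a \<Rightarrow> bool" where
  "compatible_in P R p q \<longleftrightarrow> (\<exists>r\<in>P. (r, p) \<in> R \<and> (r, q) \<in> R)"

definition ccc :: "'a set \<Rightarrow> 'a rel \<Rightarrow> bool" where
  "ccc P R \<longleftrightarrow>
     (\<forall>A\<subseteq>P. (\<forall>p\<in>A. \<forall>q\<in>A. p \<noteq> q \<longrightarrow> \<not> compatible_in P R p q) \<longrightarrow> countable A)"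

definition dense_subset :: "'a set \<Rightarrow> 'a rel \<Rightarrow> 'a set \<Rightarrow> bool" where
  "dense_subset P R D \<longleftrightarrow> D \<subseteq> P \<and> (\<forall>p\<in>P. \<exists>d\<in>D. (d, p) \<in> R)"

definition down_directed :: "'a rel \<Rightarrow> 'a set \<Rightarrow> bool" where
  "down_directed R G \<longleftrightarrow> G \<noteq> {} \<and> (\<forall>p\<in>G. \<forall>q\<in>G. \<exists>r\<in>G. (r, p) \<in> R \<and> (r, q) \<in> R)"

text \<open>
  The axiom for the posets whose carrier is a set of elements of type \<^typ>\<open>'a\<close>; smaller means stronger.
  A formula cannot quantify over types. The lemma \<open>martins_axiom_transfer\<close> below shows that the
  instance \<^typ>\<open>'a\<close> = \<^typ>\<open>nat set\<close> yields all other ones.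
\<close>
definition martins_axiom :: "'a itself \<Rightarrow> bool" where
  "martins_axiom (_ :: 'a itself) \<longleftrightarrow>
     (\<forall>(P :: 'a set) R (\<D> :: 'a set set).
        P \<noteq> {} \<and> partial_order_on P R \<and> ccc P R \<and>
        \<D> \<prec> (UNIV :: nat set set) \<and> (\<forall>D\<in>\<D>. dense_subset P R D) \<longrightarrow>
        (\<exists>G\<subseteq>P. down_directed R G \<and> (\<forall>D\<in>\<D>. G \<inter> D \<noteq> {})))"

lemma small_closure:
  fixes f :: "'a \<Rightarrow> 'a \<Rightarrow> 'a" and g :: "'d \<Rightarrow> 'a \<Rightarrow> 'a" and \<D> :: "'d set"
  assumes "\<D> \<lesssim> (UNIV :: nat set set)" and "p0 \<in> P"
    and f: "\<And>x y. x \<in> P \<Longrightarrow> y \<in> P \<Longrightarrow> f x y \<in> P"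
    and g: "\<And>d x. d \<in> \<D> \<Longrightarrow> x \<in> P \<Longrightarrow> g d x \<in> P"
  shows "\<exists>Q\<subseteq>P. p0 \<in> Q \<and> Q \<lesssim> (UNIV :: nat set set) \<and>
           (\<forall>x\<in>Q. \<forall>y\<in>Q. f x y \<in> Q) \<and> (\<forall>d\<in>\<D>. \<forall>x\<in>Q. g d x \<in> Q)"
proof -
  define C where "C = (UNIV :: nat set set)"
  define step where "step X = X \<union> ((\<lambda>(x, y). f x y) ` (X \<times> X) \<union> (\<lambda>(d, x). g d x) ` (\<D> \<times> X))" for X
  define Q where "Q n = (step ^^ n) {p0}" for n
  have inf: "infinite C" unfolding C_def by (simp add: Finite_Set.finite_set)
  have QS: "Q (Suc n) = step (Q n)" for n by (simp add: Q_def)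
  have mono: "Q m \<subseteq> Q n" if "m \<le> n" for m n
    using that by (rule lift_Suc_mono_le[rotated]) (auto simp: QS step_def)
  have D: "ordLeq3 (card_of \<D>) (card_of C)"
    using assms(1) by (simp add: C_def lepoll_def flip: card_of_ordLeq)
  have size: "ordLeq3 (card_of (Q n)) (card_of C)" for n
  proof (induction n)
    case 0
    have "C \<noteq> {}" by (simp add: C_def)
    then show ?case by (simp add: Q_def card_of_singl_ordLeq)
  next
    case (Suc n)
    have im: "ordLeq3 (card_of (h ` (X \<times> Q n))) (card_of C)"
      if "ordLeq3 (card_of X) (card_of C)" for h :: "'e \<times> 'a \<Rightarrow> 'a" and X
    proof -
      have "ordLeq3 (card_of (X \<times> Q n)) (card_of C)"
        by (intro card_of_Times_ordLeq_infinite_Field[of "card_of C"])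
           (use inf that Suc in \<open>auto simp: card_of_Card_order\<close>)
      then show ?thesis using card_of_image ordLeq_transitive by blast
    qed
    show ?case unfolding QS step_def
      by (intro card_of_Un_ordLeq_infinite inf Suc im D)
  qed
  show ?thesis
  proof (intro exI[of _ "\<Union>n. Q n"] conjI ballI)
    have "Q n \<subseteq> P" for n
    proof (induction n)
      case 0
      show ?case using assms(2) by (simp add: Q_def)
    next
      case (Suc n)
      have "step (Q n) \<subseteq> P" using Suc f g by (fastforce simp: step_def)
      then show ?case by (simp add: QS)
    qed
    then show "(\<Union>n. Q n) \<subseteq> P" by auto
    show "p0 \<in> (\<Union>n. Q n)" by (auto simp: Q_def intro: exI[of _ 0])
    have "ordLeq3 (card_of (UNIV :: nat set)) (card_of C)"
      using inf infinite_iff_card_of_nat by blast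
    then have "ordLeq3 (card_of (\<Union>n. Q n)) (card_of C)"
      by (intro card_of_UNION_ordLeq_infinite inf) (auto intro: size)
    then show "(\<Union>n. Q n) \<lesssim> (UNIV :: nat set set)"
      by (simp add: C_def lepoll_def flip: card_of_ordLeq)
    show "f x y \<in> (\<Union>n. Q n)" if xy: "x \<in> (\<Union>n. Q n)" "y \<in> (\<Union>n. Q n)" for x y
    proof -
      from xy obtain m n where "x \<in> Q m" "y \<in> Q n" by auto
      then have "x \<in> Q (max m n)" "y \<in> Q (max m n)"
        using mono[of m "max m n"] mono[of n "max m n"] by auto
      then have "f x y \<in> Q (Suc (max m n))" by (auto simp: QS step_def)
      then show ?thesis by blast
    qed
    show "g d x \<in> (\<Union>n. Q n)" if "d \<in> \<D>" "x \<in> (\<Union>n. Q n)" for d x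
    proof -
      from that obtain n where "x \<in> Q n" by auto
      then have "g d x \<in> Q (Suc n)" using that by (auto simp: QS step_def)
      then show ?thesis by blast
    qed
  qed
qed

lemma martins_axiom_transfer:
  assumes MA: "martins_axiom TYPE(nat set)"
  shows "martins_axiom TYPE('a)"
  unfolding martins_axiom_def
proof (intro allI impI, elim conjE)
  fix P :: "'a set" and R \<D>
  assume ne: "P \<noteq> {}" and po: "partial_order_on P R" and ccc: "ccc P R"
    and small: "\<D> \<prec> (UNIV :: nat set set)" and dense: "\<forall>D\<in>\<D>. dense_subset P R D"
  define f where
    "f x y = (if compatible_in P R x y then SOME r. r \<in> P \<and> (r, x) \<in> R \<and> (r, y) \<in> R else x)" for x y
  define g where "g D x = (SOME d. d \<in> D \<and> (d, x) \<in> R)" for D x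
  have f: "f x y \<in> P \<and> (f x y, x) \<in> R \<and> (f x y, y) \<in> R" if "compatible_in P R x y" for x y
  proof -
    have "\<exists>r. r \<in> P \<and> (r, x) \<in> R \<and> (r, y) \<in> R" using that by (auto simp: compatible_in_def)
    from someI_ex[OF this] show ?thesis using that by (simp add: f_def)
  qed
  have g: "g D x \<in> D \<and> (g D x, x) \<in> R" if "D \<in> \<D>" "x \<in> P" for D x
  proof -
    have "\<exists>d. d \<in> D \<and> (d, x) \<in> R" using that dense unfolding dense_subset_def by blast
    from someI_ex[OF this] show ?thesis by (simp add: g_def)
  qed
  from ne obtain p0 where p0: "p0 \<in> P" by auto
  have D_small: "\<D> \<lesssim> (UNIV :: nat set set)" using small by (simp add: lesspoll_def)
  have fP: "f x y \<in> P" if "x \<in> P" "y \<in> P" for x y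
    using f[of x y] that by (cases "compatible_in P R x y") (auto simp: f_def)
  have gP: "g D x \<in> P" if "D \<in> \<D>" "x \<in> P" for D x
    using g[OF that] dense that by (auto simp: dense_subset_def)
  obtain Q where Q: "Q \<subseteq> P" "p0 \<in> Q" "Q \<lesssim> (UNIV :: nat set set)"
    and fQ': "\<forall>x\<in>Q. \<forall>y\<in>Q. f x y \<in> Q" and gQ': "\<forall>D\<in>\<D>. \<forall>x\<in>Q. g D x \<in> Q"
    using small_closure[OF D_small p0, of f g, OF fP gP] by metis
  have fQ: "f x y \<in> Q" if "x \<in> Q" "y \<in> Q" for x y using fQ' that by simp
  have gQ: "g D x \<in> Q" if "D \<in> \<D>" "x \<in> Q" for D x using gQ' that by simp
  from Q(3) obtain e :: "'a \<Rightarrow> nat set" where e: "inj_on e Q" by (auto simp: lepoll_def)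
  have e_eq: "e x = e y \<longleftrightarrow> x = y" if "x \<in> Q" "y \<in> Q" for x y using e that by (auto simp: inj_on_def)
  define R' where "R' = {(e x, e y) |x y. x \<in> Q \<and> y \<in> Q \<and> (x, y) \<in> R}"
  have R': "(e x, e y) \<in> R' \<longleftrightarrow> (x, y) \<in> R" if "x \<in> Q" "y \<in> Q" for x y
  proof
    assume "(e x, e y) \<in> R'"
    then obtain x' y' where *: "e x = e x'" "e y = e y'" "x' \<in> Q" "y' \<in> Q" "(x', y') \<in> R"
      unfolding R'_def by auto
    then have "x = x'" "y = y'" using e_eq that by auto
    then show "(x, y) \<in> R" using * by simp
  qed (use that in \<open>auto simp: R'_def\<close>)
  note po' = partial_order_onD[OF po]
  have "partial_order_on (e ` Q) R'"
    unfolding partial_order_on_def preorder_on_def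
  proof (intro conjI)
    show "R' \<subseteq> e ` Q \<times> e ` Q" by (auto simp: R'_def)
    show "refl_on (e ` Q) R'" using po'(1) Q(1) by (auto simp: refl_on_def R')
    show "trans R'"
    proof (rule transI)
      fix a b c assume "(a, b) \<in> R'" "(b, c) \<in> R'"
      then obtain x y y' z where *: "a = e x" "b = e y" "b = e y'" "c = e z" "x \<in> Q" "y \<in> Q" "y' \<in> Q" "z \<in> Q"
        "(x, y) \<in> R" "(y', z) \<in> R" unfolding R'_def by auto
      then have "y = y'" using e_eq[of y y'] by simp
      then have "(x, z) \<in> R" using * po'(2) by (auto dest: transD)
      then show "(a, c) \<in> R'" using * R'[of x z] by simp
    qed
    show "antisym R'"
    proof (rule antisymI)
      fix a b assume ab: "(a, b) \<in> R'" "(b, a) \<in> R'"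
      then obtain x y where *: "a = e x" "b = e y" "x \<in> Q" "y \<in> Q" unfolding R'_def by auto
      then have "(x, y) \<in> R" "(y, x) \<in> R" using ab R'[of x y] R'[of y x] by auto
      then show "a = b" using * po'(3) by (auto dest: antisymD)
    qed
  qed
  moreover have "ccc (e ` Q) R'"
    unfolding ccc_def
  proof (intro allI impI)
    fix A assume A: "A \<subseteq> e ` Q"
      and anti: "\<forall>p\<in>A. \<forall>q\<in>A. p \<noteq> q \<longrightarrow> \<not> compatible_in (e ` Q) R' p q"
    define B where "B = {x \<in> Q. e x \<in> A}"
    have "\<not> compatible_in P R x y" if "x \<in> B" "y \<in> B" "x \<noteq> y" for x y
    proof
      assume c: "compatible_in P R x y"
      have xy: "x \<in> Q" "y \<in> Q" "e x \<in> A" "e y \<in> A" using that by (auto simp: B_def)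
      have "compatible_in (e ` Q) R' (e x) (e y)"
        unfolding compatible_in_def using f[OF c] xy fQ[of x y] by (auto simp: R')
      then show False using anti xy that(3) e_eq[of x y] by auto
    qed
    moreover have "B \<subseteq> P" using Q(1) by (auto simp: B_def)
    ultimately have "countable B" using ccc by (auto simp: ccc_def)
    moreover have "A = e ` B" using A by (auto simp: B_def)
    ultimately show "countable A" by simp
  qed
  moreover have "(\<lambda>D. e ` (D \<inter> Q)) ` \<D> \<prec> (UNIV :: nat set set)"
    using small image_lepoll lesspoll_trans1 by blast
  moreover have "\<forall>D'\<in>(\<lambda>D. e ` (D \<inter> Q)) ` \<D>. dense_subset (e ` Q) R' D'"
  proof
    fix D' assume "D' \<in> (\<lambda>D. e ` (D \<inter> Q)) ` \<D>"
    then obtain D where D: "D \<in> \<D>" "D' = e ` (D \<inter> Q)" by auto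
    have "\<exists>d\<in>D'. (d, e x) \<in> R'" if "x \<in> Q" for x
    proof
      have "g D x \<in> D" "(g D x, x) \<in> R" using g[OF D(1), of x] Q(1) that by auto
      then show "(e (g D x), e x) \<in> R'" "e (g D x) \<in> D'"
        using gQ[OF D(1) that] that D(2) by (auto simp: R')
    qed
    then show "dense_subset (e ` Q) R' D'" using D(2) by (auto simp: dense_subset_def)
  qed
  moreover have "e ` Q \<noteq> {}" using Q(2) by auto
  ultimately have "\<exists>G'\<subseteq>e ` Q. down_directed R' G' \<and>
      (\<forall>D'\<in>(\<lambda>D. e ` (D \<inter> Q)) ` \<D>. G' \<inter> D' \<noteq> {})"
    using MA[unfolded martins_axiom_def, rule_format, of "e ` Q" R' "(\<lambda>D. e ` (D \<inter> Q)) ` \<D>"] by simp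
  then obtain G' where G': "G' \<subseteq> e ` Q" "down_directed R' G'"
    "\<forall>D'\<in>(\<lambda>D. e ` (D \<inter> Q)) ` \<D>. G' \<inter> D' \<noteq> {}"
    by blast
  define G where "G = {x \<in> Q. e x \<in> G'}"
  have "down_directed R G"
    unfolding down_directed_def
  proof (intro conjI ballI)
    show "G \<noteq> {}" using G'(1,2) by (auto simp: down_directed_def G_def)
    fix p q assume pq: "p \<in> G" "q \<in> G"
    then obtain r' where r': "r' \<in> G'" "(r', e p) \<in> R'" "(r', e q) \<in> R'"
      using G'(2) by (auto simp: down_directed_def G_def)
    then obtain r where "r \<in> Q" "r' = e r" using G'(1) by auto
    then show "\<exists>r\<in>G. (r, p) \<in> R \<and> (r, q) \<in> R" using r' pq R' by (auto simp: G_def)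
  qed
  moreover have "\<forall>D\<in>\<D>. G \<inter> D \<noteq> {}"
  proof
    fix D assume "D \<in> \<D>"
    then have "G' \<inter> e ` (D \<inter> Q) \<noteq> {}" using G'(3) by blast
    then show "G \<inter> D \<noteq> {}" by (auto simp: G_def)
  qed
  ultimately show "\<exists>G\<subseteq>P. down_directed R G \<and> (\<forall>D\<in>\<D>. G \<inter> D \<noteq> {})"
    using Q(1) by (intro exI[of _ G]) (auto simp: G_def)
qed


section \<open>Abelian groups\<close>

text \<open>
  The group records of HOL-Algebra are written multiplicatively: \<open>x [^] n\<close> is the multiple \<open>n x\<close>.
  A subgroup \<open>H\<close> of \<open>G\<close>, regarded as a group, is \<open>G\<lparr>carrier := H\<rparr>\<close>.
\<close>

definition torsion_free :: "('a, 'm) monoid_scheme \<Rightarrow> bool" where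
  "torsion_free G \<longleftrightarrow> (\<forall>x\<in>carrier G. \<forall>n::nat. 0 < n \<longrightarrow> x [^]\<^bsub>G\<^esub> n = \<one>\<^bsub>G\<^esub> \<longrightarrow> x = \<one>\<^bsub>G\<^esub>)"

definition pure_subgroup :: "'a set \<Rightarrow> ('a, 'm) monoid_scheme \<Rightarrow> bool" where
  "pure_subgroup H G \<longleftrightarrow> subgroup H G \<and>
     (\<forall>n::nat. \<forall>x\<in>carrier G. x [^]\<^bsub>G\<^esub> n \<in> H \<longrightarrow> (\<exists>y\<in>H. y [^]\<^bsub>G\<^esub> n = x [^]\<^bsub>G\<^esub> n))"

text \<open>Taking the basis inside the carrier type is no restriction: a basis is a subset of the group.\<close>
definition free_abelian :: "('a, 'm) monoid_scheme \<Rightarrow> bool" where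
  "free_abelian G \<longleftrightarrow> (\<exists>B :: 'a set. free_Abelian_group B \<cong> G)"

definition aleph1_free :: "('a, 'm) monoid_scheme \<Rightarrow> bool" where
  "aleph1_free G \<longleftrightarrow> (\<forall>K. subgroup K G \<and> countable K \<longrightarrow> free_abelian (G\<lparr>carrier := K\<rparr>))"

text \<open>Homomorphisms are taken extensional, so that equal homomorphisms are equal as functions.\<close>
definition hom_group ::
    "('a, 'm) monoid_scheme \<Rightarrow> ('b, 'n) monoid_scheme \<Rightarrow> ('a \<Rightarrow> 'b) monoid" where
  "hom_group G A =
     \<lparr>carrier = hom G A \<inter> extensional (carrier G),
      monoid.mult = (\<lambda>f g. \<lambda>x\<in>carrier G. f x \<otimes>\<^bsub>A\<^esub> g x),
      one = (\<lambda>x\<in>carrier G. \<one>\<^bsub>A\<^esub>)\<rparr>"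

abbreviation End :: "('a, 'm) monoid_scheme \<Rightarrow> ('a \<Rightarrow> 'a) set" where
  "End G \<equiv> carrier (hom_group G G)"

abbreviation dual_group :: "('a, 'm) monoid_scheme \<Rightarrow> ('a \<Rightarrow> int) monoid" where
  "dual_group G \<equiv> hom_group G integer_group"

definition evaluation :: "('a, 'm) monoid_scheme \<Rightarrow> 'a \<Rightarrow> ('a \<Rightarrow> int) \<Rightarrow> int" where
  "evaluation G g = (\<lambda>\<phi>\<in>carrier (dual_group G). \<phi> g)"

definition reflexive_group :: "('a, 'm) monoid_scheme \<Rightarrow> bool" where
  "reflexive_group G \<longleftrightarrow> evaluation G \<in> iso G (dual_group (dual_group G))"

definition independent_in :: "('a, 'm) monoid_scheme \<Rightarrow> 'a set \<Rightarrow> bool" where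
  "independent_in G B \<longleftrightarrow> B \<subseteq> carrier G \<and>
     (\<forall>F c. finite F \<and> F \<subseteq> B \<and> finprod G (\<lambda>b. b [^]\<^bsub>G\<^esub> (c b :: int)) F = \<one>\<^bsub>G\<^esub> \<longrightarrow> (\<forall>b\<in>F. c b = 0))"

definition finite_rank :: "('a, 'm) monoid_scheme \<Rightarrow> bool" where
  "finite_rank G \<longleftrightarrow> (\<exists>r. \<forall>B. independent_in G B \<longrightarrow> finite B \<and> card B \<le> r)"

definition Fin :: "('a, 'm) monoid_scheme \<Rightarrow> ('a \<Rightarrow> 'a) set" where
  "Fin G = {\<phi> \<in> End G. finite_rank (G\<lparr>carrier := \<phi> ` carrier G\<rparr>)}"

definition bilinear_form ::
    "('a, 'm) monoid_scheme \<Rightarrow> ('b, 'n) monoid_scheme \<Rightarrow> ('a \<Rightarrow> 'b \<Rightarrow> int) \<Rightarrow> bool" where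
  "bilinear_form G H \<beta> \<longleftrightarrow>
     (\<forall>a\<in>carrier G. \<forall>a'\<in>carrier G. \<forall>b\<in>carrier H. \<beta> (a \<otimes>\<^bsub>G\<^esub> a') b = \<beta> a b + \<beta> a' b) \<and>
     (\<forall>a\<in>carrier G. \<forall>b\<in>carrier H. \<forall>b'\<in>carrier H. \<beta> a (b \<otimes>\<^bsub>H\<^esub> b') = \<beta> a b + \<beta> a b')"

definition multiples :: "('a, 'm) monoid_scheme \<Rightarrow> nat \<Rightarrow> 'a set" where
  "multiples G n = (\<lambda>x. x [^]\<^bsub>G\<^esub> n) ` carrier G"

definition zadic_topology :: "('a, 'm) monoid_scheme \<Rightarrow> 'a topology" where
  "zadic_topology G =
     topology (\<lambda>U. U \<subseteq> carrier G \<and> (\<forall>x\<in>U. \<exists>n>0. multiples G n #>\<^bsub>G\<^esub> x \<subseteq> U))"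


section \<open>The Baer-Specker group\<close>

abbreviation baer_specker :: "(nat \<Rightarrow> int) monoid" where
  "baer_specker \<equiv> product_group UNIV (\<lambda>_. integer_group)"

definition unit_vector :: "nat \<Rightarrow> nat \<Rightarrow> int" where
  "unit_vector n = (\<lambda>i. if i = n then 1 else 0)"

abbreviation SS :: "(nat \<Rightarrow> int) set" where
  "SS \<equiv> carrier (sum_group UNIV (\<lambda>_. integer_group))"

definition DD :: "(nat \<Rightarrow> int) set" where
  "DD = zadic_topology baer_specker closure_of SS"

definition slender :: "('a, 'm) monoid_scheme \<Rightarrow> bool" where
  "slender G \<longleftrightarrow> torsion_free G \<and>
     (\<forall>h\<in>hom baer_specker G. finite {n. h (unit_vector n) \<noteq> \<one>\<^bsub>G\<^esub>})"


section \<open>The completion of the integers and the scalar product\<close>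

text \<open>\<open>\<Z>\<close>-hat as the inverse limit of the groups \<open>\<int>/n\<int>\<close>, \<open>n \<ge> 1\<close>, with the inverse limit topology.\<close>
definition zhat :: "(nat \<Rightarrow> int) monoid" where
  "zhat = (product_group {1..} integer_mod_group)
     \<lparr>carrier := {f \<in> carrier (product_group {1..} integer_mod_group).
                  \<forall>m\<ge>1. \<forall>n\<ge>1. m dvd n \<longrightarrow> f n mod int m = f m}\<rparr>"

definition zhat_topology :: "(nat \<Rightarrow> int) topology" where
  "zhat_topology = subtopology
     (product_topology (\<lambda>n. discrete_topology (carrier (integer_mod_group n))) {1..}) (carrier zhat)"

definition zhat_of_int :: "int \<Rightarrow> nat \<Rightarrow> int" where
  "zhat_of_int k = (\<lambda>n\<in>{1..}. k mod int n)"

definition \<Phi> :: "(nat \<Rightarrow> int) \<Rightarrow> (nat \<Rightarrow> int) \<Rightarrow> nat \<Rightarrow> int" where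
  "\<Phi> a b = (THE z. limitin zhat_topology (\<lambda>N. zhat_of_int (\<Sum>i<N. a i * b i)) z sequentially)"

text \<open>The value of \<open>\<Phi>\<close> as an integer, for arguments where it lies in \<open>\<int>\<close>.\<close>
definition \<Phi>int :: "(nat \<Rightarrow> int) \<Rightarrow> (nat \<Rightarrow> int) \<Rightarrow> int" where
  "\<Phi>int a b = (THE k. zhat_of_int k = \<Phi> a b)"


section \<open>Basic facts\<close>

lemma (in group) istopology_zadic:
  "istopology (\<lambda>U. U \<subseteq> carrier G \<and> (\<forall>x\<in>U. \<exists>n>0. multiples G n #> x \<subseteq> U))"
  unfolding istopology_def
proof (intro conjI allI impI ballI)
  fix S T x
  assume S: "S \<subseteq> carrier G \<and> (\<forall>x\<in>S. \<exists>n>0. multiples G n #> x \<subseteq> S)"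
    and T: "T \<subseteq> carrier G \<and> (\<forall>x\<in>T. \<exists>n>0. multiples G n #> x \<subseteq> T)"
  show "S \<inter> T \<subseteq> carrier G" using S by blast
  assume x: "x \<in> S \<inter> T"
  then obtain m n where mn: "m > 0" "n > 0" "multiples G m #> x \<subseteq> S" "multiples G n #> x \<subseteq> T"
    using S T by blast
  have mul: "multiples G (k * l) \<subseteq> multiples G k" for k l
  proof
    fix y assume "y \<in> multiples G (k * l)"
    then obtain z where z: "z \<in> carrier G" "y = z [^] (k * l)" by (auto simp: multiples_def)
    then have "y = (z [^] l) [^] k" by (simp add: nat_pow_pow mult.commute)
    then show "y \<in> multiples G k" using z(1) by (auto simp: multiples_def)
  qed
  have "multiples G (m * n) \<subseteq> multiples G m" "multiples G (m * n) \<subseteq> multiples G n"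
    using mul[of m n] mul[of n m] by (simp_all add: mult.commute)
  then have "multiples G (m * n) #> x \<subseteq> S \<inter> T" using mn(3,4) unfolding r_coset_def by blast
  then show "\<exists>n>0. multiples G n #> x \<subseteq> S \<inter> T"
    using mn(1,2) by (intro exI[of _ "m * n"]) simp
next
  fix \<K> x
  assume K: "\<forall>K\<in>\<K>. K \<subseteq> carrier G \<and> (\<forall>x\<in>K. \<exists>n>0. multiples G n #> x \<subseteq> K)"
  then show "\<Union>\<K> \<subseteq> carrier G" by blast
  assume "x \<in> \<Union>\<K>"
  then obtain K where "K \<in> \<K>" "x \<in> K" by blast
  moreover from this K obtain n where "n > 0" "multiples G n #> x \<subseteq> K" by blast
  ultimately show "\<exists>n>0. multiples G n #> x \<subseteq> \<Union>\<K>" by blast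
qed

lemma (in group) openin_zadic:
  "openin (zadic_topology G) U \<longleftrightarrow> U \<subseteq> carrier G \<and> (\<forall>x\<in>U. \<exists>n>0. multiples G n #> x \<subseteq> U)"
  unfolding zadic_topology_def using istopology_zadic by (simp add: topology_inverse')


lemma (in comm_group) zadic_closure_of:
  assumes "A \<subseteq> carrier G"
  shows "zadic_topology G closure_of A =
    {x \<in> carrier G. \<forall>n>0. (multiples G n #> x) \<inter> A \<noteq> {}}"
proof -
  have sub: "multiples G n #> x \<subseteq> carrier G" if "x \<in> carrier G" for x n
    using that by (auto simp: r_coset_def multiples_def)
  have self: "x \<in> multiples G n #> x" if "x \<in> carrier G" for x n
    using that by (auto simp: r_coset_def multiples_def intro!: bexI[of _ \<one>])
  have top: "topspace (zadic_topology G) = carrier G"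
  proof
    show "topspace (zadic_topology G) \<subseteq> carrier G"
      using openin_zadic[of "topspace (zadic_topology G)"] by simp
    have "openin (zadic_topology G) (carrier G)"
      unfolding openin_zadic using sub by (auto intro!: exI[of _ 1])
    then show "carrier G \<subseteq> topspace (zadic_topology G)" by (rule openin_subset)
  qed
  have op: "openin (zadic_topology G) (multiples G n #> x)" if x: "x \<in> carrier G" and n: "n > 0" for x n
    unfolding openin_zadic
  proof (intro conjI ballI)
    show "multiples G n #> x \<subseteq> carrier G" using sub x by blast
    fix y assume "y \<in> multiples G n #> x"
    then obtain z where z: "z \<in> carrier G" "y = z [^] n \<otimes> x" by (auto simp: r_coset_def multiples_def)
    have "w [^] n \<otimes> y \<in> multiples G n #> x" if w: "w \<in> carrier G" for w
    proof -
      have "w [^] n \<otimes> y = (w \<otimes> z) [^] n \<otimes> x"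
        using w z x by (simp add: nat_pow_distrib m_assoc)
      then show ?thesis using w z(1) by (auto simp: r_coset_def multiples_def)
    qed
    then have "multiples G n #> y \<subseteq> multiples G n #> x" by (auto simp: r_coset_def[of _ _ y] multiples_def)
    then show "\<exists>n'>0. multiples G n' #> y \<subseteq> multiples G n #> x" using n by blast
  qed
  show ?thesis
  proof (intro Set.set_eqI iffI)
    fix x assume x: "x \<in> zadic_topology G closure_of A"
    then have "x \<in> carrier G" using top by (simp add: in_closure_of)
    have "(multiples G n #> x) \<inter> A \<noteq> {}" if "n > 0" for n
    proof -
      have "\<exists>y. y \<in> A \<and> y \<in> multiples G n #> x"
        using x op[of x n] self[of x n] \<open>x \<in> carrier G\<close> that unfolding in_closure_of by simp
      then show ?thesis by blast
    qed
    then show "x \<in> {x \<in> carrier G. \<forall>n>0. (multiples G n #> x) \<inter> A \<noteq> {}}"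
      using \<open>x \<in> carrier G\<close> by simp
  next
    fix x assume x: "x \<in> {x \<in> carrier G. \<forall>n>0. (multiples G n #> x) \<inter> A \<noteq> {}}"
    have "\<exists>y. y \<in> A \<and> y \<in> T" if T: "x \<in> T" "openin (zadic_topology G) T" for T
    proof -
      from T obtain n where "n > 0" "multiples G n #> x \<subseteq> T" using openin_zadic by blast
      moreover from this x have "(multiples G n #> x) \<inter> A \<noteq> {}" by blast
      ultimately show ?thesis by blast
    qed
    then show "x \<in> zadic_topology G closure_of A" using x top by (simp add: in_closure_of)
  qed
qed

lemma mem_SS_iff: "x \<in> SS \<longleftrightarrow> finite {i. x i \<noteq> 0}"
  by (simp add: carrier_sum_group)

lemma pow_baer_specker: "x [^]\<^bsub>baer_specker\<^esub> (n::nat) = (\<lambda>i. int n * x i)"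
proof (induction n)
  case 0
  show ?case by (simp add: nat_pow_def product_group_def)
next
  case (Suc n)
  have "x [^]\<^bsub>baer_specker\<^esub> (Suc n) = x [^]\<^bsub>baer_specker\<^esub> n \<otimes>\<^bsub>baer_specker\<^esub> x"
    by (simp add: nat_pow_def)
  also have "\<dots> = (\<lambda>i. int n * x i) \<otimes>\<^bsub>baer_specker\<^esub> x" by (simp only: Suc)
  finally show ?case by (simp add: product_group_def algebra_simps)
qed

lemma mem_DD_iff: "x \<in> DD \<longleftrightarrow> (\<forall>n>0. finite {i. \<not> int n dvd x i})"
proof -
  interpret comm_group baer_specker
    by (rule group.group_comm_groupI) (simp, simp add: product_group_def algebra_simps)
  have 1: "((multiples baer_specker n #>\<^bsub>baer_specker\<^esub> x) \<inter> SS \<noteq> {}) \<longleftrightarrow>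
           (\<exists>z. finite {i. int n * z i + x i \<noteq> 0})" for n
  proof -
    have "multiples baer_specker n #>\<^bsub>baer_specker\<^esub> x = range (\<lambda>z i. int n * z i + x i)"
      unfolding r_coset_def multiples_def pow_baer_specker
      by (auto simp: product_group_def restrict_def)
    moreover have "(\<lambda>i. int n * z i + x i) \<in> SS \<longleftrightarrow> finite {i. int n * z i + x i \<noteq> 0}" for z
      by (rule mem_SS_iff)
    ultimately show ?thesis by (smt (verit) disjoint_iff imageE rangeI)
  qed
  have 2: "(\<exists>z. finite {i. int n * z i + x i \<noteq> 0}) \<longleftrightarrow> finite {i. \<not> int n dvd x i}" for n
  proof
    assume "\<exists>z. finite {i. int n * z i + x i \<noteq> 0}"
    then obtain z where "finite {i. int n * z i + x i \<noteq> 0}" by blast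
    moreover have "{i. \<not> int n dvd x i} \<subseteq> {i. int n * z i + x i \<noteq> 0}"
    proof (intro subsetI CollectI notI)
      fix i assume "i \<in> {i. \<not> int n dvd x i}" "int n * z i + x i = 0"
      moreover from this have "x i = int n * - z i" by simp
      ultimately show False by (metis dvd_triv_left mem_Collect_eq)
    qed
    ultimately show "finite {i. \<not> int n dvd x i}" by (rule finite_subset[rotated])
  next
    assume *: "finite {i. \<not> int n dvd x i}"
    have "{i. int n * - (x i div int n) + x i \<noteq> 0} \<subseteq> {i. \<not> int n dvd x i}" by auto
    then show "\<exists>z. finite {i. int n * z i + x i \<noteq> 0}"
      using * by (intro exI[of _ "\<lambda>i. - (x i div int n)"]) (rule finite_subset)
  qed
  show ?thesis unfolding DD_def
    by (subst zadic_closure_of) (simp_all add: 1 2)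
qed

lemma zhat_of_int_eq_iff [simp]: "zhat_of_int k = zhat_of_int l \<longleftrightarrow> k = l"
proof
  assume eq: "zhat_of_int k = zhat_of_int l"
  define n where "n = Suc (nat \<bar>k - l\<bar>)"
  have "k mod int n = l mod int n" using fun_cong[OF eq, of n] by (simp add: zhat_of_int_def n_def)
  then have "int n dvd k - l" by (rule mod_eq_dvd_iff[THEN iffD1])
  then show "k = l" using zdvd_not_zless[of "\<bar>k - l\<bar>" "int n"] by (cases "k = l") (auto simp: n_def)
qed simp

lemma zhat_of_int_in_zhat: "zhat_of_int k \<in> carrier zhat"
proof -
  have "zhat_of_int k n mod int m = zhat_of_int k m" if "m \<ge> 1" "n \<ge> 1" "m dvd n" for m n
  proof -
    have "int m dvd int n" using that(3) by simp
    then show ?thesis using that(1,2) by (simp add: zhat_of_int_def mod_mod_cancel)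
  qed
  moreover have "zhat_of_int k \<in> carrier (product_group {1..} integer_mod_group)"
    by (simp add: zhat_of_int_def product_group_def PiE_iff carrier_integer_mod_group)
  ultimately show ?thesis by (simp add: zhat_def)
qed

lemma limitin_zhat:
  "limitin zhat_topology (\<lambda>N. zhat_of_int (s N)) z sequentially \<longleftrightarrow>
     z \<in> carrier zhat \<and> (\<forall>n\<ge>1. \<forall>\<^sub>F N in sequentially. s N mod int n = z n)"
proof -
  have sub: "carrier zhat \<subseteq> carrier (product_group {1..} integer_mod_group)" by (auto simp: zhat_def)
  have c: "zhat_of_int k n = k mod int n" if "n \<ge> 1" for k n using that by (simp add: zhat_of_int_def)
  have "limitin (discrete_topology (carrier (integer_mod_group n))) (\<lambda>N. zhat_of_int (s N) n) (z n) sequentially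
      \<longleftrightarrow> (\<forall>\<^sub>F N in sequentially. s N mod int n = z n)" if "n \<ge> 1" "z \<in> carrier zhat" for n
  proof -
    have "z n \<in> carrier (integer_mod_group n)"
      using that sub by (auto simp: product_group_def PiE_iff)
    show ?thesis
    proof
      assume "limitin (discrete_topology (carrier (integer_mod_group n))) (\<lambda>N. zhat_of_int (s N) n) (z n) sequentially"
      then have "\<forall>\<^sub>F N in sequentially. zhat_of_int (s N) n \<in> {z n}"
        using \<open>z n \<in> _\<close> unfolding limitin_def by (metis insertCI openin_discrete_topology insert_subset empty_subsetI)
      then show "\<forall>\<^sub>F N in sequentially. s N mod int n = z n" using that by (simp add: c)
    next
      assume "\<forall>\<^sub>F N in sequentially. s N mod int n = z n"
      then show "limitin (discrete_topology (carrier (integer_mod_group n))) (\<lambda>N. zhat_of_int (s N) n) (z n) sequentially"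
        using \<open>z n \<in> _\<close> that unfolding limitin_def by (auto simp: c elim: eventually_mono)
    qed
  qed
  moreover have "zhat_of_int k \<in> (\<Pi>\<^sub>E n\<in>{1..}. carrier (integer_mod_group n))" for k
    using zhat_of_int_in_zhat[of k] sub by (auto simp: product_group_def)
  moreover have "z \<in> extensional {1..}" if "z \<in> carrier zhat"
    using that sub by (auto simp: product_group_def PiE_iff)
  ultimately show ?thesis
    unfolding zhat_topology_def limitin_subtopology limitin_componentwise
    using zhat_of_int_in_zhat by (auto simp: topspace_product_topology)
qed

lemma \<Phi>_converges:
  assumes "a \<in> DD" "b \<in> DD"
  shows "limitin zhat_topology (\<lambda>N. zhat_of_int (\<Sum>i<N. a i * b i)) (\<Phi> a b) sequentially"
proof -
  define s where "s N = (\<Sum>i<N. a i * b i)" for N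
  have "\<exists>K. \<forall>N\<ge>K. s N mod int n = s K mod int n" if "n \<ge> 1" for n
  proof -
    have "finite {i. \<not> int n dvd a i}" using assms(1) that by (simp add: mem_DD_iff)
    then obtain K where K: "\<And>i. i \<ge> K \<Longrightarrow> int n dvd a i"
      by (metis (mono_tags, lifting) finite_nat_set_iff_bounded mem_Collect_eq not_le)
    have "s N mod int n = s K mod int n" if "N \<ge> K" for N
      using that
    proof (induction N rule: dec_induct)
      case (step N)
      then have "int n dvd a N * b N" using K by simp
      then have "s (Suc N) mod int n = s N mod int n" by (simp add: s_def mod_eq_dvd_iff)
      then show ?case using step by simp
    qed simp
    then show ?thesis by blast
  qed
  then have "\<forall>n\<in>{1..}. \<exists>K. \<forall>N\<ge>K. s N mod int n = s K mod int n" by simp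
  from bchoice[OF this] obtain K
    where K': "\<forall>n\<in>{1..}. \<forall>N\<ge>K n. s N mod int n = s (K n) mod int n"
    by (rule exE)
  have K: "s N mod int n = s (K n) mod int n" if "n \<ge> 1" "N \<ge> K n" for n N
    by (rule K'[rule_format]) (use that in simp_all)
  define z where "z = (\<lambda>n\<in>{1..}. s (K n) mod int n)"
  have ev: "\<forall>\<^sub>F N in sequentially. s N mod int n = z n" if "n \<ge> 1" for n
    unfolding eventually_sequentially
  proof (intro exI allI impI)
    fix N assume "K n \<le> N"
    then have "s N mod int n = s (K n) mod int n" by (rule K[OF that])
    also have "\<dots> = z n" using that by (simp add: z_def)
    finally show "s N mod int n = z n" .
  qed
  have "z n mod int m = z m" if "m \<ge> 1" "n \<ge> 1" "m dvd n" for m n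
  proof -
    have "s (max (K m) (K n)) mod int n = s (K n) mod int n"
      using that by (intro K) auto
    then have "s (max (K m) (K n)) mod int n = z n" using that by (simp add: z_def del: mod_mod_trivial)
    moreover have "s (max (K m) (K n)) mod int m = s (K m) mod int m"
      using that by (intro K) auto
    then have "s (max (K m) (K n)) mod int m = z m" using that by (simp add: z_def)
    moreover have "int m dvd int n" using that(3) by simp
    ultimately show ?thesis by (metis mod_mod_cancel)
  qed
  then have "z \<in> carrier zhat"
    by (auto simp: zhat_def product_group_def integer_mod_group_def z_def)
  then have lim: "limitin zhat_topology (\<lambda>N. zhat_of_int (s N)) z sequentially"
    using ev by (simp add: limitin_zhat)
  moreover have "z' = z" if "limitin zhat_topology (\<lambda>N. zhat_of_int (s N)) z' sequentially" for z'
  proof -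
    have "z' n = z n" if n: "n \<ge> 1" for n
    proof -
      have "\<forall>\<^sub>F N in sequentially. s N mod int n = z' n \<and> s N mod int n = z n"
        using \<open>limitin _ _ z' _\<close> ev[OF n] n by (simp add: limitin_zhat eventually_conj)
      then show ?thesis using eventually_happens by fastforce
    qed
    moreover have "z' \<in> extensional {1..}" "z \<in> extensional {1..}"
      using that lim by (auto simp: limitin_zhat zhat_def product_group_def PiE_iff)
    ultimately show ?thesis by (intro extensionalityI[of _ "{1..}"]) auto
  qed
  ultimately show ?thesis unfolding \<Phi>_def s_def by (rule theI)
qed

lemma \<Phi>_eq_of_int_iff:
  assumes "a \<in> DD" "b \<in> DD"
  shows "\<Phi> a b = zhat_of_int k \<longleftrightarrow>
    (\<forall>n\<ge>1. \<forall>\<^sub>F N in sequentially. (\<Sum>i<N. a i * b i) mod int n = k mod int n)"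
proof -
  note lim = \<Phi>_converges[OF assms, unfolded limitin_zhat]
  show ?thesis
  proof
    assume "\<Phi> a b = zhat_of_int k"
    then show "\<forall>n\<ge>1. \<forall>\<^sub>F N in sequentially. (\<Sum>i<N. a i * b i) mod int n = k mod int n"
      using lim by (simp add: zhat_of_int_def)
  next
    assume *: "\<forall>n\<ge>1. \<forall>\<^sub>F N in sequentially. (\<Sum>i<N. a i * b i) mod int n = k mod int n"
    have "\<Phi> a b n = zhat_of_int k n" if "n \<ge> 1" for n
    proof -
      have "\<forall>\<^sub>F N in sequentially. (\<Sum>i<N. a i * b i) mod int n = k mod int n \<and>
              (\<Sum>i<N. a i * b i) mod int n = \<Phi> a b n"
        using * lim that by (simp add: eventually_conj)
      then show ?thesis using eventually_happens that by (fastforce simp: zhat_of_int_def)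
    qed
    moreover have "\<Phi> a b \<in> extensional {1..}" "zhat_of_int k \<in> extensional {1..}"
      using lim by (auto simp: zhat_of_int_def zhat_def product_group_def PiE_iff)
    ultimately show "\<Phi> a b = zhat_of_int k" by (intro extensionalityI[of _ "{1..}"]) auto
  qed
qed

lemma \<Phi>int_eqI: "\<Phi> a b = zhat_of_int k \<Longrightarrow> \<Phi>int a b = k"
  by (simp add: \<Phi>int_def)

end

theory Submission
  imports Defs
begin

text \<open>
  The pair is built by transfinite recursion over the integer matrices \<open>M\<close>, adding countably many vectors
  at each step, so that at every stage fewer than continuum many vectors have been chosen. Homomorphisms
  \<open>H\<^sub>1 \<rightarrow> \<int>\<close> correspond to vectors \<open>b\<close> with \<open>\<Phi>(H\<^sub>1, b) \<subseteq> \<int>\<close>; given \<open>b\<close>, either it is added to \<open>H\<^sub>2\<close>, or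
  it is linearly independent of the vectors in \<open>H\<^sub>2\<close> and \<open>S\<close>, and a generic \<open>x\<close> added to \<open>H\<^sub>1\<close> satisfies
  \<open>\<Phi>(x, b) \<notin> \<int>\<close>. An endomorphism of \<open>H\<^sub>1\<close> is given by a matrix \<open>M\<close> with rows in \<open>H\<^sub>1\<close> and columns in
  \<open>H\<^sub>2\<close>; a generic pair \<open>(x, y)\<close> satisfies \<open>\<Phi>(x M, y) \<notin> \<int>\<close> unless, on finitely supported vectors orthogonal
  to finitely many given ones, \<open>z \<cdot> w = 0\<close> implies \<open>z M w = 0\<close>. In the latter case the form \<open>z M w\<close> is a multiple
  of \<open>z \<cdot> w\<close> there, and \<open>M\<close> is a scalar matrix up to finite rank.

  Slenderness and the fact that \<open>H \<oplus> \<int>\<close> is not isomorphic to \<open>H\<close> follow from the description of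
  the endomorphisms: a homomorphism \<open>\<int>\<^sup>\<omega> \<rightarrow> H\<close> composed with a projection to half of the coordinates restricts to an endomorphism of \<open>H\<close>
  with scalar part 0, and an injective endomorphism has torsion cokernel.
\<close>

section \<open>Integer linear algebra\<close>

text \<open>A refusal made at one stage must survive all later ones: a vector kept out of a group
  has to stay out. So every refusal is witnessed by vectors put into the groups, and witnesses are
  never lost. A witness has to pair integrally with all vectors chosen before, which may be
  uncountably many. Finite approximations with finitely many promises form a c.c.c. order with one
  dense set for each chosen vector; this is where Martin's axiom enters. That a limit in the
  completion is not an integer is forced by countably many requirements, one for each integer
  \<open>j\<close>: at a finite stage the partial sum differs from \<open>j\<close> modulo some
  \<open>m\<close>, and all later terms are divisible by \<open>m\<close>. Against a matrix,
  \<open>x\<close> and \<open>y\<close> enter together and must have an integral product of their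
  own. Hence only pairs of directions \<open>z\<close>, \<open>w\<close> with product 0 can be used,
  and this is how scalar matrices escape. No closure property is arranged in the recursion. Each set
  ends up as the set of all vectors that pair integrally with the other one, and being a pure
  subgroup that contains \<open>SS\<close> is read off from that.\<close>

lemma nonzero_solution:
  fixes a :: "'i \<Rightarrow> 'j \<Rightarrow> int"
  assumes "finite I" "finite J" "card I < card J"
  shows "\<exists>c. (\<exists>j\<in>J. c j \<noteq> 0) \<and> (\<forall>i\<in>I. (\<Sum>j\<in>J. c j * a i j) = 0)"
  using assms
proof (induction I arbitrary: J a rule: finite_induct)
  case empty
  then obtain j where "j \<in> J" by fastforce
  then show ?case by (intro exI[of _ "\<lambda>_. 1"]) auto
next
  case (insert i0 I)
  show ?case
  proof (cases "\<forall>j\<in>J. a i0 j = 0")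
    case True
    have "card I < card J" using insert by simp
    then obtain c where "\<exists>j\<in>J. c j \<noteq> 0" "\<forall>i\<in>I. (\<Sum>j\<in>J. c j * a i j) = 0"
      using insert.IH[of J a] insert.prems by blast
    then show ?thesis using True by (intro exI[of _ c]) auto
  next
    case False
    then obtain l where l: "l \<in> J" "a i0 l \<noteq> 0" by blast
    define J' where "J' = J - {l}"
    have J: "J = insert l J'" "l \<notin> J'" "finite J'" using l insert.prems by (auto simp: J'_def)
    have "card I < card J'" using insert J by simp
    then obtain c where c: "\<exists>j\<in>J'. c j \<noteq> 0"
      "\<forall>i\<in>I. (\<Sum>j\<in>J'. c j * (a i0 l * a i j - a i0 j * a i l)) = 0"
      using insert.IH[of J' "\<lambda>i j. a i0 l * a i j - a i0 j * a i l"] J by blast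
    \<comment> \<open>Fraction-free elimination: the coefficients are scaled by the pivot
      \<open>a i0 l\<close>, and the entry at \<open>l\<close> is chosen to solve the equation
      \<open>i0\<close>.\<close>
    define d where "d j = (if j = l then - (\<Sum>j\<in>J'. c j * a i0 j) else a i0 l * c j)" for j
    have d: "(\<Sum>j\<in>J. d j * a i j) = (\<Sum>j\<in>J'. c j * (a i0 l * a i j - a i0 j * a i l))" for i
    proof -
      have "(\<Sum>j\<in>J'. d j * a i j) = (\<Sum>j\<in>J'. a i0 l * c j * a i j)"
        using J by (intro sum.cong) (auto simp: d_def)
      then have "(\<Sum>j\<in>J. d j * a i j) = - (\<Sum>j\<in>J'. c j * a i0 j) * a i l + (\<Sum>j\<in>J'. a i0 l * c j * a i j)"
        using J by (simp add: d_def)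
      moreover have "(\<Sum>j\<in>J'. c j * (a i0 l * a i j - a i0 j * a i l)) =
          (\<Sum>j\<in>J'. a i0 l * c j * a i j) - (\<Sum>j\<in>J'. c j * a i0 j) * a i l"
        unfolding sum_distrib_right sum_subtractf[symmetric] by (intro sum.cong) (auto simp: algebra_simps)
      ultimately show ?thesis by simp
    qed
    have "\<exists>j\<in>J. d j \<noteq> 0" using c(1) l J by (auto simp: d_def)
    moreover have "(\<Sum>j\<in>J. d j * a i j) = 0" if "i \<in> insert i0 I" for i
    proof (cases "i = i0")
      case True
      then show ?thesis unfolding d by (simp add: mult.commute)
    next
      case False
      then show ?thesis unfolding d using c(2) that by simp
    qed
    ultimately show ?thesis by blast
  qed
qed

text \<open>The vectors by which a condition of length \<open>n\<close> may be prolonged;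
  \<open>finsupp 0\<close> is \<open>SS\<close>.\<close>

definition finsupp :: "nat \<Rightarrow> (nat \<Rightarrow> int) set" where
  "finsupp n = {z. (\<forall>i<n. z i = 0) \<and> finite {i. z i \<noteq> 0}}"

definition psum :: "(nat \<Rightarrow> int) \<Rightarrow> (nat \<Rightarrow> int) \<Rightarrow> nat \<Rightarrow> int" where
  "psum a b N = (\<Sum>i<N. a i * b i)"

text \<open>The index set is the support of \<open>z\<close> alone: once \<open>z\<close> is
  finitely supported, \<open>h\<close> may be any sequence, and linearity in \<open>h\<close> is
  immediate.\<close>

definition dot :: "(nat \<Rightarrow> int) \<Rightarrow> (nat \<Rightarrow> int) \<Rightarrow> int" where
  "dot z h = (\<Sum>i | z i \<noteq> 0. z i * h i)"

lemma psum_commute: "psum a b N = psum b a N"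
  by (simp add: psum_def mult.commute)

lemma dot_eq_psum: "dot z h = psum z h N" if "\<And>i. i \<ge> N \<Longrightarrow> z i = 0"
  unfolding dot_def psum_def
  by (rule sum.mono_neutral_left) (use that in \<open>auto simp: not_less[symmetric]\<close>)

lemma finite_support_bound: "finite {i. z i \<noteq> (0::int)} \<Longrightarrow> \<exists>N\<ge>m. \<forall>i\<ge>N. z i = 0"
  for z :: "nat \<Rightarrow> int"
proof -
  assume "finite {i. z i \<noteq> (0::int)}"
  then obtain N where "\<forall>i\<in>{i. z i \<noteq> 0}. i < N" using finite_nat_set_iff_bounded by blast
  then have "\<forall>i\<ge>max N m. z i = 0" by (auto simp: not_less[symmetric])
  then show ?thesis by (intro exI[of _ "max N m"]) auto
qed

lemma finsupp_lincomb:
  assumes "y \<in> finsupp n" "z \<in> finsupp n"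
  shows "(\<lambda>i. p * y i + q * z i) \<in> finsupp n"
proof -
  have "finite ({i. y i \<noteq> 0} \<union> {i. z i \<noteq> 0})" using assms by (simp add: finsupp_def)
  then have "finite {i. p * y i + q * z i \<noteq> 0}" by (rule finite_subset[rotated]) auto
  then show ?thesis using assms by (simp add: finsupp_def)
qed

lemma dot_lincomb_left:
  assumes "y \<in> finsupp n" "z \<in> finsupp n"
  shows "dot (\<lambda>i. p * y i + q * z i) h = p * dot y h + q * dot z h"
proof -
  obtain N where N: "\<forall>i\<ge>N. y i = 0" using finite_support_bound[of y 0] assms by (auto simp: finsupp_def)
  obtain N' where N': "\<forall>i\<ge>N'. z i = 0" using finite_support_bound[of z 0] assms by (auto simp: finsupp_def)
  let ?N = "max N N'"
  have "dot y h = psum y h ?N" "dot z h = psum z h ?N"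
    "dot (\<lambda>i. p * y i + q * z i) h = psum (\<lambda>i. p * y i + q * z i) h ?N"
    using N N' by (auto intro!: dot_eq_psum)
  then show ?thesis
    by (simp add: psum_def sum_distrib_left sum.distrib algebra_simps)
qed

lemma dot_lincomb_right: "dot y (\<lambda>i. p * h i + q * k i) = p * dot y h + q * dot y k"
  by (simp add: dot_def sum_distrib_left sum.distrib algebra_simps)

lemma dot_commute:
  assumes "y \<in> finsupp n" "z \<in> finsupp m"
  shows "dot y z = dot z y"
proof -
  obtain N where N: "\<forall>i\<ge>N. y i = 0" using finite_support_bound[of y 0] assms by (auto simp: finsupp_def)
  obtain N' where N': "\<forall>i\<ge>N'. z i = 0" using finite_support_bound[of z 0] assms by (auto simp: finsupp_def)
  have "dot y z = psum y z (max N N')" "dot z y = psum z y (max N N')"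
    using N N' by (auto intro!: dot_eq_psum)
  then show ?thesis by (simp add: psum_commute)
qed

lemma unit_vector_finsupp: "i \<ge> n \<Longrightarrow> unit_vector i \<in> finsupp n"
  by (simp add: finsupp_def unit_vector_def)

lemma dot_unit_vector [simp]: "dot (unit_vector i) h = h i"
  by (simp add: dot_def unit_vector_def)

text \<open>A functional that vanishes on the common kernel of finitely many functionals is a
  combination of them. Over the integers this holds for a nonzero multiple, and vectors starting at
  \<open>n\<close> see only the coordinates from \<open>n\<close> on. The vectors of
  \<open>V\<close> are removed one at a time.\<close>

lemma in_span_if_kernel:
  assumes "finite V" "\<And>z. z \<in> finsupp n \<Longrightarrow> \<forall>v\<in>V. dot z v = 0 \<Longrightarrow> dot z b = 0"
  shows "\<exists>q k. q \<noteq> 0 \<and> (\<forall>i\<ge>n. q * b i = (\<Sum>v\<in>V. k v * v i))"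
  using assms
proof (induction V arbitrary: b rule: finite_induct)
  case empty
  have "b i = 0" if "i \<ge> n" for i
    using empty[of "unit_vector i"] that by (simp add: unit_vector_finsupp)
  then show ?case by (intro exI[of _ 1]) auto
next
  case (insert v V)
  show ?case
  proof (cases "\<exists>z\<in>finsupp n. (\<forall>w\<in>V. dot z w = 0) \<and> dot z v \<noteq> 0")
    case False
    then have "dot z b = 0" if "z \<in> finsupp n" "\<forall>v\<in>V. dot z v = 0" for z
      using insert.prems that by blast
    then obtain q k where "q \<noteq> 0" and qk: "\<forall>i\<ge>n. q * b i = (\<Sum>v\<in>V. k v * v i)"
      using insert.IH by blast
    moreover have "(\<Sum>w\<in>insert v V. (k(v := 0)) w * w i) = (\<Sum>w\<in>V. k w * w i)" for i
      using insert.hyps by (auto intro!: sum.cong)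
    ultimately show ?thesis by (intro exI[of _ q] exI[of _ "k(v := 0)"]) auto
  next
    case True
    then obtain z0 where z0: "z0 \<in> finsupp n" "\<forall>w\<in>V. dot z0 w = 0" "dot z0 v \<noteq> 0" by blast
    \<comment> \<open>\<open>z0\<close> lies in the kernel of \<open>V\<close> but is seen by
      \<open>v\<close>. After scaling, subtracting the multiple of \<open>v\<close> that agrees with
      \<open>b\<close> at \<open>z0\<close> leaves a functional that vanishes on the whole kernel of
      \<open>V\<close>, to which the induction hypothesis applies.\<close>
    define a c where "a = dot z0 v" and "c = dot z0 b"
    have "dot z (\<lambda>i. a * b i + (- c) * v i) = 0" if z: "z \<in> finsupp n" "\<forall>w\<in>V. dot z w = 0" for z
    proof -
      let ?z = "\<lambda>i. a * z i + (- dot z v) * z0 i"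
      have "?z \<in> finsupp n" by (rule finsupp_lincomb[OF z(1) z0(1)])
      moreover have "\<forall>w\<in>insert v V. dot ?z w = 0"
        unfolding dot_lincomb_left[OF z(1) z0(1)] using z z0 by (simp add: a_def)
      ultimately have "dot ?z b = 0" by (rule insert.prems)
      then show ?thesis
        unfolding dot_lincomb_left[OF z(1) z0(1)] dot_lincomb_right by (simp add: c_def mult.commute)
    qed
    then obtain q k where q: "q \<noteq> 0" "\<forall>i\<ge>n. q * (a * b i + (- c) * v i) = (\<Sum>v\<in>V. k v * v i)"
      using insert.IH by blast
    have "(\<Sum>w\<in>insert v V. (k(v := q * c)) w * w i) = q * c * v i + (\<Sum>w\<in>V. k w * w i)" for i
      using insert.hyps by (auto intro!: sum.cong)
    then have "\<forall>i\<ge>n. (q * a) * b i = (\<Sum>w\<in>insert v V. (k(v := q * c)) w * w i)"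
      using q(2) by (auto simp: algebra_simps)
    moreover have "q * a \<noteq> 0" using q(1) z0(3) by (simp add: a_def)
    ultimately show ?thesis by blast
  qed
qed

text \<open>Rank below \<open>r\<close>. Families are used rather than sets, so a repeated vector
  counts as a dependence; \<open>A\<close> may be any set of vectors.\<close>

definition dependent_families :: "nat \<Rightarrow> (nat \<Rightarrow> int) set \<Rightarrow> bool" where
  "dependent_families r A \<longleftrightarrow>
     (\<forall>y. (\<forall>j<r. y j \<in> A) \<longrightarrow> (\<exists>c. (\<exists>j<r. c j \<noteq> 0) \<and> (\<forall>i. (\<Sum>j<r. c j * y j i) = 0)))"

text \<open>If \<open>y0\<close> in \<open>A\<close> is nonzero at \<open>i0\<close>, then the
  vectors of \<open>A\<close> that vanish at \<open>i0\<close> have smaller rank: a relation between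
  \<open>y0\<close> and such vectors, read at \<open>i0\<close>, gives \<open>y0\<close> the
  coefficient 0. So one coordinate is spent for each drop of the rank.\<close>

lemma determining_coordinates:
  assumes "dependent_families r A"
  shows "\<exists>E. finite E \<and> (\<forall>y\<in>A. (\<forall>i\<in>E. y i = 0) \<longrightarrow> (\<forall>i. y i = 0))"
  using assms
proof (induction r arbitrary: A)
  case 0
  then show ?case by (simp add: dependent_families_def)
next
  case (Suc r)
  show ?case
  proof (cases "\<exists>y\<in>A. \<exists>i. y i \<noteq> 0")
    case False
    then show ?thesis by (intro exI[of _ "{}"]) auto
  next
    case True
    then obtain y0 i0 where y0: "y0 \<in> A" "y0 i0 \<noteq> 0" by blast
    have "dependent_families r {y \<in> A. y i0 = 0}"
      unfolding dependent_families_def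
    proof (intro allI impI)
      fix y assume y: "\<forall>j<r. y j \<in> {y \<in> A. y i0 = 0}"
      define y' where "y' j = (if j = r then y0 else y j)" for j
      have "\<forall>j<Suc r. y' j \<in> A" using y y0 by (auto simp: y'_def less_Suc_eq)
      then obtain c where c: "\<exists>j<Suc r. c j \<noteq> 0" "\<forall>i. (\<Sum>j<Suc r. c j * y' j i) = 0"
        using Suc.prems unfolding dependent_families_def by blast
      have s: "(\<Sum>j<r. c j * y j i) + c r * y0 i = 0" for i
        using c(2)[rule_format, of i] by (simp add: y'_def)
      have "(\<Sum>j<r. c j * y j i0) = 0" using y by (intro sum.neutral) auto
      then have "c r = 0" using s[of i0] y0(2) by simp
      then show "\<exists>c. (\<exists>j<r. c j \<noteq> 0) \<and> (\<forall>i. (\<Sum>j<r. c j * y j i) = 0)"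
        using s c(1) by (intro exI[of _ c]) (auto simp: less_Suc_eq)
    qed
    then obtain E where "finite E" "\<forall>y\<in>{y \<in> A. y i0 = 0}. (\<forall>i\<in>E. y i = 0) \<longrightarrow> (\<forall>i. y i = 0)"
      using Suc.IH by blast
    then show ?thesis by (intro exI[of _ "insert i0 E"]) auto
  qed
qed

section \<open>The pairing\<close>

text \<open>\<open>\<Phi> a b = k\<close>, with convergence in the completion spelled out by congruences of partial sums.\<close>
definition pairs :: "(nat \<Rightarrow> int) \<Rightarrow> (nat \<Rightarrow> int) \<Rightarrow> int \<Rightarrow> bool" where
  "pairs a b k \<longleftrightarrow> (\<forall>n>0. \<exists>N0. \<forall>N\<ge>N0. int n dvd psum a b N - k)"

lemma pairsD:
  assumes "pairs a b k" "m \<noteq> 0"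
  shows "\<exists>N0. \<forall>N\<ge>N0. m dvd psum a b N - k"
proof -
  have "nat \<bar>m\<bar> > 0" using assms by simp
  then obtain N0 where "\<forall>N\<ge>N0. int (nat \<bar>m\<bar>) dvd psum a b N - k"
    using assms(1) unfolding pairs_def by blast
  then show ?thesis by auto
qed

lemma pairsI: "(\<And>n. n > 0 \<Longrightarrow> \<exists>N0. \<forall>N\<ge>N0. int n dvd psum a b N - k) \<Longrightarrow> pairs a b k"
  by (simp add: pairs_def)

lemma pairs_unique:
  assumes "pairs a b k" "pairs a b l"
  shows "k = l"
proof -
  have "n dvd k - l" if n: "n \<noteq> 0" for n
  proof -
    obtain N1 where "\<forall>N\<ge>N1. n dvd psum a b N - k" using pairsD[OF assms(1) n] by blast
    moreover obtain N2 where "\<forall>N\<ge>N2. n dvd psum a b N - l" using pairsD[OF assms(2) n] by blast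
    ultimately have "n dvd psum a b (max N1 N2) - k" "n dvd psum a b (max N1 N2) - l" by auto
    then have "n dvd (psum a b (max N1 N2) - l) - (psum a b (max N1 N2) - k)" using dvd_diff by blast
    then show ?thesis by simp
  qed
  from this[of "\<bar>k - l\<bar> + 1"] have "\<bar>k - l\<bar> + 1 dvd k - l" by simp
  then show ?thesis using zdvd_imp_le[of "\<bar>k - l\<bar> + 1" "\<bar>k - l\<bar>"] by (cases "k = l") auto
qed

lemma pairs_commute: "pairs a b k \<longleftrightarrow> pairs b a k"
  by (simp add: pairs_def psum_commute)

lemma pairs_lincomb:
  assumes "pairs a b k" "pairs a' b l"
  shows "pairs (\<lambda>i. p * a i + q * a' i) b (p * k + q * l)"
proof (rule pairsI)
  fix n :: nat assume "n > 0"
  then obtain N1 N2 where N: "\<forall>N\<ge>N1. int n dvd psum a b N - k" "\<forall>N\<ge>N2. int n dvd psum a' b N - l"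
    using assms unfolding pairs_def by meson
  have "int n dvd psum (\<lambda>i. p * a i + q * a' i) b N - (p * k + q * l)" if "N \<ge> max N1 N2" for N
  proof -
    have "psum (\<lambda>i. p * a i + q * a' i) b N = p * psum a b N + q * psum a' b N"
      by (simp add: psum_def sum_distrib_left sum.distrib algebra_simps)
    then have "psum (\<lambda>i. p * a i + q * a' i) b N - (p * k + q * l) = p * (psum a b N - k) + q * (psum a' b N - l)"
      by (simp add: algebra_simps)
    then show ?thesis using N that by simp
  qed
  then show "\<exists>N0. \<forall>N\<ge>N0. int n dvd psum (\<lambda>i. p * a i + q * a' i) b N - (p * k + q * l)" by blast
qed

lemma pairs_finite_left:
  assumes "\<And>i. i \<ge> N \<Longrightarrow> z i = 0"
  shows "pairs z b (psum z b N)"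
proof (rule pairsI)
  fix n :: nat
  have "psum z b M = psum z b N" if "M \<ge> N" for M
    using dot_eq_psum[of N z b] dot_eq_psum[of M z b] assms that by simp
  then show "\<exists>N0. \<forall>M\<ge>N0. int n dvd psum z b M - psum z b N" by (metis diff_self dvd_0_right)
qed

lemma pairs_dot: "pairs z b (dot z b)" if z: "z \<in> finsupp n"
proof -
  obtain N where "\<forall>i\<ge>N. z i = 0" using z finite_support_bound[of z 0] by (auto simp: finsupp_def)
  then show ?thesis using pairs_finite_left[of N z b] dot_eq_psum[of N z b] by simp
qed

lemma pairs_zero: "pairs (\<lambda>_. 0) b 0"
  by (simp add: pairs_def psum_def)

text \<open>The quotient of the completion by the integers is torsion-free: \<open>q\<close> times
  the partial sums tends to \<open>k\<close>, so \<open>q\<close> divides \<open>k\<close>, and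
  congruences modulo \<open>q * n\<close> can be divided by \<open>q\<close>. Purity of the groups
  rests on this.\<close>

lemma pairs_divide:
  assumes "pairs (\<lambda>i. q * a i) b k" "q \<noteq> 0"
  shows "\<exists>l. k = q * l \<and> pairs a b l"
proof -
  have ps: "psum (\<lambda>i. q * a i) b N = q * psum a b N" for N
    by (simp add: psum_def sum_distrib_left algebra_simps)
  obtain N0 where "\<forall>N\<ge>N0. q dvd psum (\<lambda>i. q * a i) b N - k" using pairsD assms by blast
  then have "q dvd q * psum a b N0 - k" by (auto simp: ps)
  then have "q dvd k" by (simp add: dvd_diff_right_iff)
  then obtain l where l: "k = q * l" by blast
  have "pairs a b l"
  proof (rule pairsI)
    fix n :: nat assume "n > 0"
    then have "q * int n \<noteq> 0" using assms by simp
    then obtain N0 where "\<forall>N\<ge>N0. q * int n dvd psum (\<lambda>i. q * a i) b N - k" using pairsD assms by meson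
    then have "\<forall>N\<ge>N0. q * int n dvd q * (psum a b N - l)" by (simp add: ps l algebra_simps)
    then show "\<exists>N0. \<forall>N\<ge>N0. int n dvd psum a b N - l" using assms(2) by auto
  qed
  with l show ?thesis by blast
qed

lemma pairs_sum:
  assumes "finite J" "\<And>j. j \<in> J \<Longrightarrow> pairs (a j) b (k j)"
  shows "pairs (\<lambda>i. \<Sum>j\<in>J. c j * a j i) b (\<Sum>j\<in>J. c j * k j)"
  using assms
proof (induction J rule: finite_induct)
  case empty
  show ?case by (simp add: pairs_zero)
next
  case (insert j J)
  then have "pairs (\<lambda>i. c j * a j i + 1 * (\<Sum>j\<in>J. c j * a j i)) b (c j * k j + 1 * (\<Sum>j\<in>J. c j * k j))"
    by (intro pairs_lincomb) auto
  then show ?case using insert by simp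
qed

section \<open>The Z-adic closure of the finitely supported vectors\<close>

lemma mem_DD: "x \<in> DD \<longleftrightarrow> (\<forall>m. m \<noteq> 0 \<longrightarrow> (\<exists>N. \<forall>i\<ge>N. m dvd x i))"
proof -
  have *: "finite {i. \<not> m dvd x i} \<longleftrightarrow> (\<exists>N. \<forall>i\<ge>N. m dvd x i)" for m
    unfolding finite_nat_set_iff_bounded by (auto simp: not_less[symmetric])
  show ?thesis
  proof
    assume x: "x \<in> DD"
    show "\<forall>m. m \<noteq> 0 \<longrightarrow> (\<exists>N. \<forall>i\<ge>N. m dvd x i)"
    proof (intro allI impI)
      fix m :: int assume "m \<noteq> 0"
      then have "nat \<bar>m\<bar> > 0" by simp
      then have "finite {i. \<not> int (nat \<bar>m\<bar>) dvd x i}" using x unfolding mem_DD_iff by blast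
      then show "\<exists>N. \<forall>i\<ge>N. m dvd x i" by (simp add: *)
    qed
  qed (auto simp: mem_DD_iff *)
qed

lemma DD_lincomb:
  assumes "x \<in> DD" "y \<in> DD"
  shows "(\<lambda>i. p * x i + q * y i) \<in> DD"
  unfolding mem_DD
proof (intro allI impI)
  fix m :: int assume "m \<noteq> 0"
  then obtain N N' where "\<forall>i\<ge>N. m dvd x i" "\<forall>i\<ge>N'. m dvd y i" using assms unfolding mem_DD by meson
  then show "\<exists>N. \<forall>i\<ge>N. m dvd p * x i + q * y i" by (intro exI[of _ "max N N'"]) simp
qed

lemma DD_divide:
  assumes "(\<lambda>i. q * x i) \<in> DD" "q \<noteq> 0"
  shows "x \<in> DD"
  unfolding mem_DD
proof (intro allI impI)
  fix m :: int assume "m \<noteq> 0"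
  then have "q * m \<noteq> 0" using assms by simp
  then obtain N where "\<forall>i\<ge>N. q * m dvd q * x i" using assms unfolding mem_DD by meson
  then show "\<exists>N. \<forall>i\<ge>N. m dvd x i" using assms(2) by auto
qed

lemma finsupp_DD: "z \<in> finsupp n \<Longrightarrow> z \<in> DD"
  unfolding mem_DD finsupp_def using finite_support_bound[of z 0] by fastforce

lemma SS_eq_finsupp: "SS = finsupp 0"
  using mem_SS_iff by (auto simp: finsupp_def)

lemma \<Phi>_eq_iff_pairs:
  assumes "a \<in> DD" "b \<in> DD"
  shows "\<Phi> a b = zhat_of_int k \<longleftrightarrow> pairs a b k"
  unfolding \<Phi>_eq_of_int_iff[OF assms] pairs_def psum_def eventually_sequentially mod_eq_dvd_iff
  by (auto simp: Suc_le_eq)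

lemma \<Phi>int_eq: "a \<in> DD \<Longrightarrow> b \<in> DD \<Longrightarrow> pairs a b k \<Longrightarrow> \<Phi>int a b = k"
  by (rule \<Phi>int_eqI) (simp add: \<Phi>_eq_iff_pairs)

section \<open>Cardinals below the continuum\<close>

abbreviation small :: "'a set \<Rightarrow> bool" where
  "small A \<equiv> A \<prec> (UNIV :: nat set set)"

lemma lesspoll_iff_ordLess: "A \<prec> B \<longleftrightarrow> ordLess2 (card_of A) (card_of B)"
proof -
  have "A \<lesssim> B \<longleftrightarrow> ordLeq3 (card_of A) (card_of B)"
    by (simp add: lepoll_def card_of_ordLeq)
  then show ?thesis
    unfolding lesspoll_def eqpoll_iff_card_of_ordIso
    by (meson ordLeq_iff_ordLess_or_ordIso not_ordLess_ordIso)
qed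

lemma small_subset: "small B \<Longrightarrow> A \<subseteq> B \<Longrightarrow> small A"
  using lesspoll_trans1 subset_imp_lepoll by blast

lemma small_image: "small A \<Longrightarrow> small (f ` A)"
  using lesspoll_trans1 image_lepoll by blast

lemma small_countable: "countable A \<Longrightarrow> small A"
proof -
  assume "countable A"
  then have "A \<lesssim> (UNIV :: nat set)" unfolding countable_def lepoll_def by auto
  then show ?thesis using lesspoll_trans1 lesspoll_Pow_self[of "UNIV :: nat set"] by simp
qed

lemma infinite_UNIV_nat_set: "infinite (UNIV :: nat set set)"
  by (simp add: Finite_Set.finite_set)

lemma small_Un: "small A \<Longrightarrow> small B \<Longrightarrow> small (A \<union> B)"
  unfolding lesspoll_iff_ordLess by (rule card_of_Un_ordLess_infinite[OF infinite_UNIV_nat_set])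

text \<open>The union is no larger than the infinite set \<open>B\<close>, which is still below the
  continuum. The summand \<open>nat\<close> in \<open>B\<close> covers finite \<open>I\<close> and
  bounds each \<open>A i\<close>.\<close>

lemma small_UN_countable:
  assumes "small I" "\<And>i. i \<in> I \<Longrightarrow> countable (A i)"
  shows "small (\<Union>i\<in>I. A i)"
proof -
  define B where "B = (UNIV :: nat set) <+> I"
  have "small (UNIV :: nat set)" by (rule small_countable) simp
  then have "small B"
    using assms(1) unfolding B_def lesspoll_iff_ordLess
    by (rule card_of_Plus_ordLess_infinite[OF infinite_UNIV_nat_set])
  have inf: "infinite B" by (simp add: B_def finite_Plus_iff)
  have "ordLeq3 (card_of (\<Union>i\<in>I. A i)) (card_of B)"
  proof (rule card_of_UNION_ordLeq_infinite[OF inf])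
    have "inj_on Inr I" "Inr ` I \<subseteq> B" by (auto simp: B_def inj_on_def)
    then show "ordLeq3 (card_of I) (card_of B)" using card_of_ordLeq by blast
    show "\<forall>i\<in>I. ordLeq3 (card_of (A i)) (card_of B)"
    proof
      fix i assume "i \<in> I"
      then obtain f :: "_ \<Rightarrow> nat" where "inj_on f (A i)" using assms(2) by (auto simp: countable_def)
      then have "inj_on (Inl \<circ> f :: _ \<Rightarrow> nat + _) (A i)" by (auto simp: inj_on_def)
      moreover have "(Inl \<circ> f) ` A i \<subseteq> B" by (auto simp: B_def)
      ultimately show "ordLeq3 (card_of (A i)) (card_of B)" using card_of_ordLeq by blast
    qed
  qed
  then have "(\<Union>i\<in>I. A i) \<lesssim> B" by (simp add: lepoll_def card_of_ordLeq)
  then show ?thesis using \<open>small B\<close> lesspoll_trans1 by blast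
qed

text \<open>Bookkeeping for the whole construction. Consistency is a relation between pairs, so it
  passes to unions of chains, and a fulfilled task remains fulfilled by \<open>mono\<close>. Along a
  well-order of least possible length every task has fewer than continuum many predecessors, so what
  precedes it is small.\<close>

lemma pairwise_transfinite_extension:
  fixes r :: "'a \<Rightarrow> 'a \<Rightarrow> bool" and Good :: "'t \<Rightarrow> 'a set \<Rightarrow> bool"
  assumes tasks: "(UNIV :: 't set) \<lesssim> (UNIV :: nat set set)"
    and mono: "\<And>t C C'. Good t C \<Longrightarrow> C \<subseteq> C' \<Longrightarrow> Good t C'"
    and step: "\<And>t C. small C \<Longrightarrow> \<forall>a\<in>C. \<forall>b\<in>C. r a b \<Longrightarrow>
      \<exists>A. countable A \<and> (\<forall>a\<in>C \<union> A. \<forall>b\<in>C \<union> A. r a b) \<and> Good t (C \<union> A)"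
  shows "\<exists>C. (\<forall>a\<in>C. \<forall>b\<in>C. r a b) \<and> (\<forall>t. Good t C)"
proof -
  define R where "R = card_of (UNIV :: 't set)"
  have card: "Card_order R" "Field R = UNIV" by (simp_all add: R_def card_of_Card_order)
  then have wo: "wo_rel R" by (simp add: wo_rel_def R_def card_of_Well_order)
  have wf: "wf (R - Id)" using wo by (simp add: wo_rel_def well_order_on_def)
  have tot: "s = t \<or> (s, t) \<in> R - Id \<or> (t, s) \<in> R - Id" for s t
    using wo_rel.TOTALS[OF wo] card(2) by blast
  have tr: "(s, u) \<in> R - Id" if "(s, t) \<in> R - Id" "(t, u) \<in> R - Id" for s t u
    using wo_rel.TRANS[OF wo] wo_rel.ANTISYM[OF wo] that by (auto dest: transD antisymD)
  define below where "below t = {s. (s, t) \<in> R - Id}" for t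
  have below: "small (below t)" for t
  proof -
    have "ordLess2 (card_of (underS R t)) R" by (rule card_of_underS[OF card(1)]) (simp add: card(2))
    then have "underS R t \<prec> (UNIV :: 't set)" by (simp add: lesspoll_iff_ordLess R_def)
    moreover have "below t = underS R t" by (auto simp: below_def underS_def)
    ultimately show ?thesis using tasks lesspoll_trans2 by metis
  qed
  define P where "P f t A \<longleftrightarrow> countable A \<and>
    ((\<forall>s\<in>below t. countable (f s)) \<and> (\<forall>a\<in>\<Union>(f ` below t). \<forall>b\<in>\<Union>(f ` below t). r a b) \<longrightarrow>
      (\<forall>a\<in>\<Union>(f ` below t) \<union> A. \<forall>b\<in>\<Union>(f ` below t) \<union> A. r a b) \<and> Good t (\<Union>(f ` below t) \<union> A))"
    for f :: "'t \<Rightarrow> 'a set" and t A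
  have "\<exists>f. \<forall>t. P f t (f t)"
  proof (rule dependent_wf_choice[OF wf])
    fix f g :: "'t \<Rightarrow> 'a set" and t A
    assume eq: "\<And>z. (z, t) \<in> R - Id \<Longrightarrow> f z = g z"
    have "f ` below t = g ` below t" by (rule image_cong) (use eq in \<open>auto simp: below_def\<close>)
    moreover have "(\<forall>s\<in>below t. countable (f s)) \<longleftrightarrow> (\<forall>s\<in>below t. countable (g s))"
      using eq by (auto simp: below_def)
    ultimately show "P f t A = P g t A" unfolding P_def by simp
  next
    fix t and f :: "'t \<Rightarrow> 'a set"
    show "\<exists>A. P f t A"
    proof (cases "(\<forall>s\<in>below t. countable (f s)) \<and> (\<forall>a\<in>\<Union>(f ` below t). \<forall>b\<in>\<Union>(f ` below t). r a b)")
      case True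
      then have "small (\<Union>(f ` below t))" using below by (intro small_UN_countable) auto
      from step[OF this conjunct2[OF True], of t] obtain A where A: "countable A"
        "(\<forall>a\<in>\<Union>(f ` below t) \<union> A. \<forall>b\<in>\<Union>(f ` below t) \<union> A. r a b) \<and> Good t (\<Union>(f ` below t) \<union> A)"
        by (elim exE conjE) (rule that, assumption, rule conjI)
      have "P f t A" unfolding P_def by (rule conjI[OF A(1)]) (rule impI, rule A(2))
      then show ?thesis ..
    next
      case False
      have "P f t {}" unfolding P_def by (rule conjI[OF countable_empty]) (rule impI, erule notE[OF False])
      then show ?thesis ..
    qed
  qed
  then obtain f where f: "\<And>t. P f t (f t)" by (elim exE) (rule that, erule spec)
  have count: "countable (f t)" for t using f[of t, unfolded P_def] by (rule conjunct1)
  have main: "(\<forall>a\<in>\<Union>(f ` below t) \<union> f t. \<forall>b\<in>\<Union>(f ` below t) \<union> f t. r a b) \<and> Good t (\<Union>(f ` below t) \<union> f t)" for t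
    using wf
  proof (induction t rule: wf_induct_rule)
    case (less t)
    have "r a b" if ab: "a \<in> \<Union>(f ` below t)" "b \<in> \<Union>(f ` below t)" for a b
    proof -
      obtain s s' where s: "s \<in> below t" "s' \<in> below t" "a \<in> f s" "b \<in> f s'" using ab by blast
      show ?thesis
        using tot[of s s']
      proof (elim disjE)
        assume "(s, s') \<in> R - Id"
        then have "a \<in> \<Union>(f ` below s')" using s unfolding below_def by blast
        moreover have "(s', t) \<in> R - Id" using s unfolding below_def by blast
        ultimately show ?thesis using less[of s'] s by blast
      next
        assume "(s', s) \<in> R - Id"
        then have "b \<in> \<Union>(f ` below s)" using s unfolding below_def by blast
        moreover have "(s, t) \<in> R - Id" using s unfolding below_def by blast
        ultimately show ?thesis using less[of s] s by blast
      next
        assume "s = s'"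
        moreover have "(s, t) \<in> R - Id" using s unfolding below_def by blast
        ultimately show ?thesis using less[of s] s by blast
      qed
    qed
    then have "(\<forall>s\<in>below t. countable (f s)) \<and> (\<forall>a\<in>\<Union>(f ` below t). \<forall>b\<in>\<Union>(f ` below t). r a b)"
      using count by blast
    then show ?case using f[of t, unfolded P_def, THEN conjunct2, rule_format] by blast
  qed
  have "r a b" if ab: "a \<in> \<Union>(range f)" "b \<in> \<Union>(range f)" for a b
  proof -
    obtain s s' where s: "a \<in> f s" "b \<in> f s'" using ab by blast
    show ?thesis
      using tot[of s s']
    proof (elim disjE)
      assume "(s, s') \<in> R - Id"
      then have "a \<in> \<Union>(f ` below s')" using s unfolding below_def by blast
      then show ?thesis using main[of s'] s by blast
    next
      assume "(s', s) \<in> R - Id"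
      then have "b \<in> \<Union>(f ` below s)" using s unfolding below_def by blast
      then show ?thesis using main[of s] s by blast
    next
      assume "s = s'"
      then show ?thesis using main[of s] s by blast
    qed
  qed
  moreover have "Good t (\<Union>(range f))" for t
    by (rule mono[OF conjunct2[OF main]]) auto
  ultimately show ?thesis by blast
qed

section \<open>Generic pairs of vectors\<close>

datatype condition = Condition (len: nat) (left: "nat \<Rightarrow> int") (right: "nat \<Rightarrow> int")
  (md: nat) (left_con: "(nat \<Rightarrow> int) set") (right_con: "(nat \<Rightarrow> int) set")

definition conditions :: "(nat \<Rightarrow> int) set \<Rightarrow> (nat \<Rightarrow> int) set \<Rightarrow> condition set" where
  "conditions C1 C2 = {p. (\<forall>i\<ge>len p. left p i = 0 \<and> right p i = 0) \<and> md p > 0 \<and>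
     finite (left_con p) \<and> left_con p \<subseteq> C2 \<and> finite (right_con p) \<and> right_con p \<subseteq> C1}"

text \<open>
  \<open>left p\<close> and \<open>right p\<close> are finite approximations of vectors \<open>x\<close> and \<open>y\<close>, to be added to \<open>C1\<close> and \<open>C2\<close>. Further
  entries must be divisible by \<open>md p\<close> and may change neither the products with the vectors in \<open>left_con p\<close> and
  \<open>right_con p\<close> nor the product of \<open>x\<close> and \<open>y\<close>, so that these products converge to integers.
\<close>
definition extends :: "condition \<Rightarrow> condition \<Rightarrow> bool" where
  "extends q p \<longleftrightarrow> len p \<le> len q \<and>
     (\<forall>i<len p. left q i = left p i \<and> right q i = right p i) \<and>
     (\<forall>i\<ge>len p. int (md p) dvd left q i \<and> int (md p) dvd right q i) \<and>
     md p dvd md q \<and> left_con p \<subseteq> left_con q \<and> right_con p \<subseteq> right_con q \<and>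
     (\<forall>h\<in>left_con p. dot (left q) h = dot (left p) h) \<and>
     (\<forall>h\<in>right_con p. dot (right q) h = dot (right p) h) \<and>
     dot (left q) (right q) = dot (left p) (right p)"

lemma extendsD:
  assumes "extends q p"
  shows "len p \<le> len q" "md p dvd md q"
    "i < len p \<Longrightarrow> left q i = left p i" "i < len p \<Longrightarrow> right q i = right p i"
    "len p \<le> i \<Longrightarrow> int (md p) dvd left q i" "len p \<le> i \<Longrightarrow> int (md p) dvd right q i"
    "h \<in> left_con p \<Longrightarrow> dot (left q) h = dot (left p) h"
    "h \<in> right_con p \<Longrightarrow> dot (right q) h = dot (right p) h"
    "dot (left q) (right q) = dot (left p) (right p)"
  using assms unfolding extends_def by blast+

text \<open>What a member of the generic filter guarantees about the limit vectors: the promises of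
  \<open>extends\<close>, with products of finite approximations replaced by limits in the
  completion.\<close>

definition approximates :: "condition \<Rightarrow> (nat \<Rightarrow> int) \<Rightarrow> (nat \<Rightarrow> int) \<Rightarrow> bool" where
  "approximates p x y \<longleftrightarrow>
     (\<forall>i<len p. x i = left p i \<and> y i = right p i) \<and>
     (\<forall>i\<ge>len p. int (md p) dvd x i \<and> int (md p) dvd y i) \<and>
     (\<forall>h\<in>left_con p. pairs x h (dot (left p) h)) \<and>
     (\<forall>h\<in>right_con p. pairs y h (dot (right p) h)) \<and>
     pairs x y (dot (left p) (right p))"

lemma extends_refl: "p \<in> conditions C1 C2 \<Longrightarrow> extends p p"
  by (auto simp: extends_def conditions_def)

lemma extends_trans:
  assumes "extends r q" "extends q p"
  shows "extends r p"
proof -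
  have "int (md p) dvd left r i \<and> int (md p) dvd right r i" if i: "i \<ge> len p" for i
  proof (cases "i < len q")
    case True
    then show ?thesis using assms i by (simp add: extends_def)
  next
    case False
    have "int (md p) dvd int (md q)" using assms by (simp add: extends_def)
    moreover have "int (md q) dvd left r i" "int (md q) dvd right r i"
      using False assms by (simp_all add: extends_def)
    ultimately show ?thesis using dvd_trans by blast
  qed
  then show ?thesis using assms unfolding extends_def by (auto intro: dvd_trans)
qed

lemma extends_antisym:
  assumes "p \<in> conditions C1 C2" "q \<in> conditions C1 C2" "extends p q" "extends q p"
  shows "p = q"
proof -
  have l: "len p = len q" using assms by (simp add: extends_def)
  have "left p i = left q i \<and> right p i = right q i" for i
    using assms l by (cases "i < len p") (auto simp: extends_def conditions_def not_less)
  then have "left p = left q" "right p = right q" by auto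
  moreover have "md p = md q" using assms dvd_antisym by (auto simp: extends_def)
  moreover have "left_con p = left_con q" "right_con p = right_con q" using assms by (auto simp: extends_def)
  ultimately show ?thesis using l by (intro condition.expand) simp
qed

text \<open>Strengthens only the promises about later entries. Both approximations stay as they are,
  and since they vanish from \<open>len p\<close> on, no divisibility clause is violated.\<close>

definition tighten :: "condition \<Rightarrow> nat \<Rightarrow> (nat \<Rightarrow> int) set \<Rightarrow> (nat \<Rightarrow> int) set \<Rightarrow> condition" where
  "tighten p k v u = Condition (len p) (left p) (right p) (md p * k) (left_con p \<union> v) (right_con p \<union> u)"

lemma tighten_simps [simp]:
  "len (tighten p k v u) = len p" "left (tighten p k v u) = left p" "right (tighten p k v u) = right p"
  "md (tighten p k v u) = md p * k" "left_con (tighten p k v u) = left_con p \<union> v"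
  "right_con (tighten p k v u) = right_con p \<union> u"
  by (simp_all add: tighten_def)

lemma tighten_extends:
  assumes "p \<in> conditions C1 C2" "k > 0" "finite u" "u \<subseteq> C1" "finite v" "v \<subseteq> C2"
  shows "tighten p k v u \<in> conditions C1 C2" "extends (tighten p k v u) p"
  using assms by (auto simp: conditions_def extends_def)

text \<open>The only way in which approximations grow. The factor \<open>md p\<close> keeps the
  divisibility promise. In the product of the new vectors the cross terms vanish, because
  \<open>z\<close> and \<open>w\<close> start where \<open>left p\<close> and \<open>right p\<close>
  end; what remains is a multiple of \<open>dot z w\<close>, which has to be 0.\<close>

lemma prolong:
  assumes p: "p \<in> conditions C1 C2"
    and z: "z \<in> finsupp (len p)" "\<forall>h\<in>left_con p. dot z h = 0"
    and w: "w \<in> finsupp (len p)" "\<forall>h\<in>right_con p. dot w h = 0"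
    and zw: "dot z w = 0"
  shows "\<exists>q\<in>conditions C1 C2. extends q p \<and> m \<le> len q \<and> md q = md p \<and>
    left_con q = left_con p \<and> right_con q = right_con p \<and>
    left q = (\<lambda>i. left p i + int (md p) * z i) \<and> right q = (\<lambda>i. right p i + int (md p) * w i)"
proof -
  obtain N1 where N1: "N1 \<ge> max m (len p)" "\<forall>i\<ge>N1. z i = 0"
    using finite_support_bound[of z "max m (len p)"] z by (auto simp: finsupp_def)
  obtain N2 where N2: "N2 \<ge> N1" "\<forall>i\<ge>N2. w i = 0"
    using finite_support_bound[of w N1] w by (auto simp: finsupp_def)
  define x y where "x i = left p i + int (md p) * z i" and "y i = right p i + int (md p) * w i" for i
  define q where "q = Condition N2 x y (md p) (left_con p) (right_con p)"
  have fs: "left p \<in> finsupp 0" "right p \<in> finsupp 0" "z \<in> finsupp 0" "w \<in> finsupp 0"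
  proof -
    have "{i. left p i \<noteq> 0} \<subseteq> {..<len p}" "{i. right p i \<noteq> 0} \<subseteq> {..<len p}"
      using p by (auto simp: conditions_def not_less[symmetric])
    then show "left p \<in> finsupp 0" "right p \<in> finsupp 0"
      by (auto simp: finsupp_def intro: finite_subset)
    show "z \<in> finsupp 0" "w \<in> finsupp 0" using z w by (auto simp: finsupp_def)
  qed
  have x: "dot x h = dot (left p) h + int (md p) * dot z h" for h
    using dot_lincomb_left[OF fs(1,3), of 1 "int (md p)" h] by (simp add: x_def[abs_def])
  have y: "dot y h = dot (right p) h + int (md p) * dot w h" for h
    using dot_lincomb_left[OF fs(2,4), of 1 "int (md p)" h] by (simp add: y_def[abs_def])
  have "dot (left p) w = 0"
    unfolding dot_def using p w by (intro sum.neutral) (auto simp: conditions_def finsupp_def not_less[symmetric])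
  moreover have "dot z (right p) = 0"
    unfolding dot_def using p z by (intro sum.neutral) (auto simp: conditions_def finsupp_def not_less[symmetric])
  moreover have "dot h y = dot h (right p) + int (md p) * dot h w" for h
    using dot_lincomb_right[of h 1 "right p" "int (md p)" w] by (simp add: y_def[abs_def])
  ultimately have xy: "dot x y = dot (left p) (right p)" unfolding x using zw by simp
  have "q \<in> conditions C1 C2"
    using p N1 N2 by (auto simp: conditions_def q_def x_def y_def)
  moreover have "extends q p"
    using p z w N1 N2 xy unfolding extends_def q_def
    by (auto simp: x y conditions_def finsupp_def) (auto simp: x_def y_def)
  ultimately show ?thesis
    using N1 N2 by (intro bexI[of _ q]) (auto simp: q_def x_def y_def)
qed

lemma partial_order_conditions:
  "partial_order_on (conditions C1 C2)
     {(q, p). q \<in> conditions C1 C2 \<and> p \<in> conditions C1 C2 \<and> extends q p}"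
  unfolding partial_order_on_def preorder_on_def
proof (intro conjI)
  show "trans {(q, p). q \<in> conditions C1 C2 \<and> p \<in> conditions C1 C2 \<and> extends q p}"
    by (rule transI) (auto intro: extends_trans)
  show "antisym {(q, p). q \<in> conditions C1 C2 \<and> p \<in> conditions C1 C2 \<and> extends q p}"
    by (rule antisymI) (auto intro: extends_antisym)
qed (auto simp: refl_on_def extends_refl)

text \<open>Conditions that differ only in \<open>left_con\<close> and \<open>right_con\<close> are compatible.\<close>
lemma ccc_conditions:
  "ccc (conditions C1 C2) {(q, p). q \<in> conditions C1 C2 \<and> p \<in> conditions C1 C2 \<and> extends q p}"
  (is "ccc ?P ?R")
  unfolding ccc_def
proof (intro allI impI)
  fix A assume A: "A \<subseteq> ?P" and anti: "\<forall>p\<in>A. \<forall>q\<in>A. p \<noteq> q \<longrightarrow> \<not> compatible_in ?P ?R p q"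
  \<comment> \<open>\<open>f p\<close> takes values in a countable type and forgets only the two
    finite sets of constraints, so it tells the members of an antichain apart.\<close>
  define f where "f p = (len p, map (left p) [0..<len p], map (right p) [0..<len p], md p)" for p
  have "inj_on f A"
  proof (rule inj_onI)
    fix p q assume pq: "p \<in> A" "q \<in> A" "f p = f q"
    then have pq': "p \<in> ?P" "q \<in> ?P" using A by auto
    have l: "len p = len q" "md p = md q" using pq by (simp_all add: f_def)
    have "left p i = left q i \<and> right p i = right q i" for i
    proof (cases "i < len p")
      case True
      then show ?thesis using pq(3) l by (simp add: f_def)
    next
      case False
      then show ?thesis using pq' l by (simp add: conditions_def)
    qed
    then have e: "left p = left q" "right p = right q" by auto
    let ?r = "tighten p 1 (left_con q) (right_con q)"
    let ?r' = "tighten q 1 (left_con p) (right_con p)"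
    have "?r = ?r'" unfolding tighten_def using l e by (simp add: Un_commute)
    moreover have "finite (left_con p)" "left_con p \<subseteq> C2" "finite (left_con q)" "left_con q \<subseteq> C2"
      "finite (right_con p)" "right_con p \<subseteq> C1" "finite (right_con q)" "right_con q \<subseteq> C1"
      using pq' by (simp_all add: conditions_def)
    then have "?r \<in> ?P" "extends ?r p" "extends ?r' q"
      using tighten_extends pq' by simp_all
    ultimately have "compatible_in ?P ?R p q"
      unfolding compatible_in_def using pq' by (intro bexI[of _ ?r]) auto
    then show "p = q" using anti pq by blast
  qed
  then show "countable A" by (rule countableI')
qed

text \<open>The dense sets are one for each vector of \<open>C1\<close> and \<open>C2\<close>, fewer
  than continuum many, and countably many more: lengths and moduli must grow, and the requirements
  \<open>Q j\<close> are left to the applications, where they keep some value away from the integer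
  \<open>j\<close>.\<close>

theorem generic_pair:
  assumes MA: "martins_axiom TYPE(condition)"
    and small: "small C1" "small C2"
    and dense: "\<And>(j::int) p. p \<in> conditions C1 C2 \<Longrightarrow> \<exists>q\<in>conditions C1 C2. extends q p \<and> Q j q"
  shows "\<exists>x\<in>DD. \<exists>y\<in>DD. (\<forall>h\<in>C2. \<exists>k. pairs x h k) \<and> (\<forall>h\<in>C1. \<exists>k. pairs y h k) \<and> (\<exists>k. pairs x y k) \<and>
    (\<forall>j. \<exists>p\<in>conditions C1 C2. Q j p \<and> approximates p x y)"
proof -
  let ?P = "conditions C1 C2"
  let ?R = "{(q, p). q \<in> ?P \<and> p \<in> ?P \<and> extends q p}"
  define L where "L h = {p \<in> ?P. h \<in> left_con p}" for h
  define R where "R h = {p \<in> ?P. h \<in> right_con p}" for h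
  \<comment> \<open>With \<open>Suc m\<close> every positive number divides some modulus in the
    filter, and divisibility by 0 is never asked for.\<close>
  define M where "M m = {p \<in> ?P. m \<le> len p \<and> Suc m dvd md p}" for m
  define Q' where "Q' j = {p \<in> ?P. Q j p}" for j
  define \<D> where "\<D> = L ` C2 \<union> R ` C1 \<union> (range M \<union> range Q')"
  have "Condition 0 (\<lambda>_. 0) (\<lambda>_. 0) 1 {} {} \<in> ?P" by (simp add: conditions_def)
  then have ne: "?P \<noteq> {}" by blast
  have D1: "dense_subset ?P ?R (L h)" if "h \<in> C2" for h
    unfolding dense_subset_def
  proof (intro conjI ballI)
    fix p assume p: "p \<in> ?P"
    have "tighten p 1 {h} {} \<in> ?P" "extends (tighten p 1 {h} {}) p" "h \<in> left_con (tighten p 1 {h} {})"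
      using tighten_extends[OF p, of 1] that by simp_all
    then show "\<exists>d\<in>L h. (d, p) \<in> ?R" using p by (intro bexI[of _ "tighten p 1 {h} {}"]) (auto simp: L_def)
  qed (auto simp: L_def)
  have D2: "dense_subset ?P ?R (R h)" if "h \<in> C1" for h
    unfolding dense_subset_def
  proof (intro conjI ballI)
    fix p assume p: "p \<in> ?P"
    have "tighten p 1 {} {h} \<in> ?P" "extends (tighten p 1 {} {h}) p" "h \<in> right_con (tighten p 1 {} {h})"
      using tighten_extends[OF p, of 1] that by simp_all
    then show "\<exists>d\<in>R h. (d, p) \<in> ?R" using p by (intro bexI[of _ "tighten p 1 {} {h}"]) (auto simp: R_def)
  qed (auto simp: R_def)
  have D3: "dense_subset ?P ?R (M m)" for m
    unfolding dense_subset_def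
  proof (intro conjI ballI)
    fix p assume p: "p \<in> ?P"
    have zero: "(\<lambda>_. 0) \<in> finsupp n" "dot (\<lambda>_. 0) h = 0" for n h by (simp_all add: finsupp_def dot_def)
    obtain q where q: "q \<in> ?P" "extends q p" "m \<le> len q"
      using prolong[OF p, of "\<lambda>_. 0" "\<lambda>_. 0" m] zero by blast
    define r where "r = tighten q (Suc m) {} {}"
    have r: "r \<in> ?P" "extends r q" unfolding r_def using tighten_extends[OF q(1), of "Suc m"] by simp_all
    have "m \<le> len r" "Suc m dvd md r" using q by (simp_all add: r_def del: mult_Suc_right)
    then show "\<exists>d\<in>M m. (d, p) \<in> ?R"
      using p r q extends_trans by (intro bexI[of _ r]) (auto simp: M_def)
  qed (auto simp: M_def)
  have D4: "dense_subset ?P ?R (Q' j)" for j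
    unfolding dense_subset_def using dense[of _ j] by (auto simp: Q'_def)
  have "small (range M)" "small (range Q')" by (auto intro!: small_countable)
  then have "\<D> \<prec> (UNIV :: nat set set)"
    unfolding \<D>_def
    by (rule small_Un[OF small_Un[OF small_image[OF small(2)] small_image[OF small(1)]] small_Un])
  moreover have "\<forall>D\<in>\<D>. dense_subset ?P ?R D"
    unfolding \<D>_def using D1 D2 D3 D4 by blast
  ultimately have "?P \<noteq> {} \<and> partial_order_on ?P ?R \<and> ccc ?P ?R \<and>
      \<D> \<prec> (UNIV :: nat set set) \<and> (\<forall>D\<in>\<D>. dense_subset ?P ?R D)"
    using ne partial_order_conditions ccc_conditions by (intro conjI)
  from MA[unfolded martins_axiom_def, THEN spec[of _ ?P], THEN spec[of _ ?R], THEN spec[of _ \<D>], THEN mp, OF this]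
  obtain G where G: "G \<subseteq> ?P" "down_directed ?R G" "\<forall>D\<in>\<D>. G \<inter> D \<noteq> {}"
    by (elim exE conjE)
  have dir: "\<exists>r\<in>G. extends r p \<and> extends r q" if "p \<in> G" "q \<in> G" for p q
    using G(2) that unfolding down_directed_def by blast
  have meetM: "\<exists>p\<in>G. m \<le> len p \<and> Suc m dvd md p" for m
  proof -
    have "M m \<in> \<D>" by (simp add: \<D>_def)
    then have "G \<inter> M m \<noteq> {}" using G(3) by blast
    then show ?thesis by (auto simp: M_def)
  qed
  \<comment> \<open>Any condition of the filter that is long enough gives the entries at
    \<open>i\<close>; directedness makes the choice immaterial.\<close>
  define g where "g i = (SOME p. p \<in> G \<and> i < len p)" for i
  have g: "g i \<in> G \<and> i < len (g i)" for i
  proof -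
    have "\<exists>p. p \<in> G \<and> i < len p" using meetM[of "Suc i"] Suc_le_lessD by blast
    from someI_ex[OF this] show ?thesis by (simp add: g_def)
  qed
  define x y where "x i = left (g i) i" and "y i = right (g i) i" for i
  have xy: "x i = left p i" "y i = right p i" if p: "p \<in> G" "i < len p" for p i
  proof -
    obtain r where "r \<in> G" "extends r p" "extends r (g i)" using dir p g by blast
    then have "left r i = left p i" "left r i = left (g i) i" "right r i = right p i" "right r i = right (g i) i"
      using p g[of i] by (blast intro: extendsD)+
    then show "x i = left p i" "y i = right p i" by (simp_all add: x_def y_def)
  qed
  have div: "int (md p) dvd x i \<and> int (md p) dvd y i" if p: "p \<in> G" "len p \<le> i" for p i
  proof -
    obtain r where r: "r \<in> G" "extends r p" "extends r (g i)" using dir p g by blast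
    then have "i < len r" using g[of i] extendsD(1) less_le_trans by blast
    then show ?thesis using xy[OF r(1)] extendsD(5,6)[OF r(2) p(2)] by simp
  qed
  have "\<exists>N. \<forall>i\<ge>N. m dvd x i \<and> m dvd y i" if "m \<noteq> 0" for m
  proof -
    obtain p where p: "p \<in> G" "Suc (nat \<bar>m\<bar> - 1) dvd md p" using meetM by blast
    then have "nat \<bar>m\<bar> dvd md p" using that by simp
    then have "m dvd int (md p)" using int_dvd_int_iff[of "nat \<bar>m\<bar>"] by simp
    then show ?thesis using div[OF p(1)] dvd_trans by blast
  qed
  then have DD: "x \<in> DD" "y \<in> DD" unfolding mem_DD by meson+
  \<comment> \<open>Used three times: for \<open>x\<close> and a vector of
    \<open>left_con p\<close>, for \<open>y\<close> and a vector of \<open>right_con p\<close>, and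
    for \<open>x\<close> and \<open>y\<close>. An extension \<open>r\<close> of \<open>p\<close>
    with \<open>n\<close> dividing \<open>md r\<close> gives the promised value at
    \<open>len r\<close>, and from there on the entries of \<open>a\<close> are divisible by
    \<open>n\<close>.\<close>
  have pairing: "pairs a b (dot (s p) (t p))"
    if p: "p \<in> G" and t: "\<And>r. r \<in> G \<Longrightarrow> psum (s r) (t r) (len r) = psum a b (len r)"
      and eq: "\<And>r. r \<in> G \<Longrightarrow> extends r p \<Longrightarrow> dot (s r) (t r) = dot (s p) (t p)"
      and ps: "\<And>r. r \<in> G \<Longrightarrow> dot (s r) (t r) = psum (s r) (t r) (len r)"
      and dv: "\<And>r i. r \<in> G \<Longrightarrow> len r \<le> i \<Longrightarrow> int (md r) dvd a i"
    for a b :: "nat \<Rightarrow> int" and s t :: "condition \<Rightarrow> nat \<Rightarrow> int" and p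
  proof (rule pairsI)
    fix n :: nat assume n: "n > 0"
    obtain q where q: "q \<in> G" "Suc (n - 1) dvd md q" using meetM by blast
    obtain r where r: "r \<in> G" "extends r p" "extends r q" using dir p q by blast
    have "n dvd md r" using q(2) extendsD(2)[OF r(3)] n dvd_trans by fastforce
    then have nr: "int n dvd int (md r)" by simp
    have start: "psum a b (len r) = dot (s p) (t p)" using t[OF r(1)] ps[OF r(1)] eq[OF r(1,2)] by simp
    have "int n dvd psum a b N - dot (s p) (t p)" if "N \<ge> len r" for N
      using that
    proof (induction N rule: dec_induct)
      case base
      then show ?case using start by simp
    next
      case (step N)
      have "int n dvd a N" using dv[OF r(1) step(1)] nr dvd_trans by blast
      then have "int n dvd (psum a b N - dot (s p) (t p)) + a N * b N" using step by simp
      moreover have "(psum a b N - dot (s p) (t p)) + a N * b N = psum a b (Suc N) - dot (s p) (t p)"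
        by (simp add: psum_def)
      ultimately show ?case by simp
    qed
    then show "\<exists>N0. \<forall>N\<ge>N0. int n dvd psum a b N - dot (s p) (t p)" by blast
  qed
  have dl: "dot (left r) h = psum (left r) h (len r)" "dot (right r) h = psum (right r) h (len r)"
    if "r \<in> G" for r h
    using that G(1) by (auto intro!: dot_eq_psum simp: conditions_def)
  have ps: "psum (left r) h (len r) = psum x h (len r)" "psum (right r) h (len r) = psum y h (len r)"
    "psum (left r) (right r) (len r) = psum x y (len r)" if "r \<in> G" for r h
    unfolding psum_def using xy[OF that] by (auto intro!: sum.cong)
  have approx: "approximates p x y" if p: "p \<in> G" for p
    unfolding approximates_def
  proof (intro conjI allI impI ballI)
    show "x i = left p i" "y i = right p i" if "i < len p" for i using xy p that by auto
    show "int (md p) dvd x i" "int (md p) dvd y i" if "i \<ge> len p" for i using div p that by auto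
    show "pairs x h (dot (left p) h)" if "h \<in> left_con p" for h
      by (rule pairing[where p = p and a = x and b = h and s = left and t = "\<lambda>_. h", OF p])
        (blast intro: ps(1) dl(1) extendsD(7) that dest: div)+
    show "pairs y h (dot (right p) h)" if "h \<in> right_con p" for h
      by (rule pairing[where p = p and a = y and b = h and s = right and t = "\<lambda>_. h", OF p])
        (blast intro: ps(2) dl(2) extendsD(8) that dest: div)+
    show "pairs x y (dot (left p) (right p))"
      by (rule pairing[where p = p and a = x and b = y and s = left and t = right, OF p])
        (blast intro: ps(3) dl(1) extendsD(9) dest: div)+
  qed
  have "\<exists>k. pairs x h k" if h: "h \<in> C2" for h
  proof -
    have "G \<inter> L h \<noteq> {}" using G(3) h unfolding \<D>_def by blast
    then obtain p where "p \<in> G" "h \<in> left_con p" by (auto simp: L_def)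
    then show ?thesis using approx unfolding approximates_def by blast
  qed
  moreover have "\<exists>k. pairs y h k" if h: "h \<in> C1" for h
  proof -
    have "G \<inter> R h \<noteq> {}" using G(3) h unfolding \<D>_def by blast
    then obtain p where "p \<in> G" "h \<in> right_con p" by (auto simp: R_def)
    then show ?thesis using approx unfolding approximates_def by blast
  qed
  moreover have "\<exists>k. pairs x y k" using approx[of "g 0"] g unfolding approximates_def by blast
  moreover have "\<exists>p\<in>?P. Q j p \<and> approximates p x y" for j
  proof -
    have "Q' j \<in> \<D>" by (simp add: \<D>_def)
    then have "G \<inter> Q' j \<noteq> {}" using G(3) by blast
    then obtain p where "p \<in> G" "p \<in> Q' j" by blast
    then show ?thesis using approx unfolding Q'_def by blast
  qed
  ultimately show ?thesis using DD by blast
qed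

section \<open>Matrices\<close>

definition compatible :: "(nat \<Rightarrow> int) \<Rightarrow> (nat \<Rightarrow> int) \<Rightarrow> bool" where
  "compatible a b \<longleftrightarrow> (\<exists>k. pairs a b k)"

definition pairing :: "(nat \<Rightarrow> int) \<Rightarrow> (nat \<Rightarrow> int) \<Rightarrow> int" where
  "pairing a b = (THE k. pairs a b k)"

definition column :: "(nat \<Rightarrow> nat \<Rightarrow> int) \<Rightarrow> nat \<Rightarrow> nat \<Rightarrow> int" where
  "column M m = (\<lambda>n. M n m)"

definition matrix_form :: "(nat \<Rightarrow> nat \<Rightarrow> int) \<Rightarrow> (nat \<Rightarrow> int) \<Rightarrow> (nat \<Rightarrow> int) \<Rightarrow> int" where
  "matrix_form M z w = dot z (\<lambda>i. dot w (M i))"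

text \<open>The row vector \<open>x M\<close>. Its entries are limits in the completion, meaningful
  only where \<open>x\<close> pairs integrally with the columns.\<close>

definition transform :: "(nat \<Rightarrow> nat \<Rightarrow> int) \<Rightarrow> (nat \<Rightarrow> int) \<Rightarrow> nat \<Rightarrow> int" where
  "transform M x = (\<lambda>m. pairing x (column M m))"

text \<open>The directions in which a condition of length \<open>n\<close> with constraints
  \<open>v\<close> may be prolonged.\<close>

definition orth :: "nat \<Rightarrow> (nat \<Rightarrow> int) set \<Rightarrow> (nat \<Rightarrow> int) set" where
  "orth n v = {z \<in> finsupp n. \<forall>h\<in>v. dot z h = 0}"

text \<open>\<open>b M = c 1\<close> up to a matrix of finite rank.\<close>
definition scalar_mod_finite :: "(nat \<Rightarrow> nat \<Rightarrow> int) \<Rightarrow> (nat \<Rightarrow> int) set \<Rightarrow> (nat \<Rightarrow> int) set \<Rightarrow> bool" where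
  "scalar_mod_finite M C1 C2 \<longleftrightarrow>
     (\<exists>b c n u v. b \<noteq> 0 \<and> finite u \<and> u \<subseteq> C1 \<and> finite v \<and> v \<subseteq> C2 \<and>
        (\<forall>z\<in>orth n v. \<forall>w\<in>orth n u. b * matrix_form M z w = c * dot z w))"

lemma pairing_eq: "pairs a b k \<Longrightarrow> pairing a b = k"
  unfolding pairing_def using pairs_unique by blast

lemma pairs_pairing: "compatible a b \<Longrightarrow> pairs a b (pairing a b)"
  unfolding compatible_def using pairing_eq by blast

lemma compatible_commute: "compatible a b \<longleftrightarrow> compatible b a"
  by (simp add: compatible_def pairs_commute)

lemma orth_lincomb: "y \<in> orth n v \<Longrightarrow> z \<in> orth n v \<Longrightarrow> (\<lambda>i. p * y i + q * z i) \<in> orth n v"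
  unfolding orth_def by (auto simp: finsupp_lincomb dot_lincomb_left)

lemma matrix_form_lincomb_left:
  "y \<in> finsupp n \<Longrightarrow> z \<in> finsupp n \<Longrightarrow>
    matrix_form M (\<lambda>i. p * y i + q * z i) w = p * matrix_form M y w + q * matrix_form M z w"
  unfolding matrix_form_def by (rule dot_lincomb_left)

lemma matrix_form_lincomb_right:
  assumes "y \<in> finsupp n" "z \<in> finsupp n"
  shows "matrix_form M w (\<lambda>i. p * y i + q * z i) = p * matrix_form M w y + q * matrix_form M w z"
  unfolding matrix_form_def dot_lincomb_left[OF assms] by (rule dot_lincomb_right)

lemma matrix_form_transpose: "matrix_form M z w = matrix_form (column M) w z"
proof -
  have "matrix_form M z w = (\<Sum>i | z i \<noteq> 0. \<Sum>j | w j \<noteq> 0. z i * (w j * M i j))"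
    by (simp add: matrix_form_def dot_def sum_distrib_left)
  also have "\<dots> = (\<Sum>j | w j \<noteq> 0. \<Sum>i | z i \<noteq> 0. z i * (w j * M i j))"
    by (rule sum.swap)
  also have "\<dots> = matrix_form (column M) w z"
    by (simp add: matrix_form_def dot_def sum_distrib_left column_def mult.left_commute)
  finally show ?thesis .
qed

text \<open>The factor is read off at one pair \<open>z0\<close>, \<open>w0\<close> with nonzero
  product. The difference \<open>N\<close> then vanishes at this pair, and every other pair is moved
  by multiples of \<open>z0\<close> and \<open>w0\<close> to a pair with product 0, where
  \<open>N\<close> vanishes by hypothesis.\<close>

lemma matrix_form_proportional:
  assumes zero: "\<And>z w. z \<in> orth n v \<Longrightarrow> w \<in> orth n u \<Longrightarrow> dot z w = 0 \<Longrightarrow> matrix_form M z w = 0"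
  shows "\<exists>b c. b \<noteq> 0 \<and> (\<forall>z\<in>orth n v. \<forall>w\<in>orth n u. b * matrix_form M z w = c * dot z w)"
proof (cases "\<exists>z\<in>orth n v. \<exists>w\<in>orth n u. dot z w \<noteq> 0")
  case False
  then show ?thesis using zero by (intro exI[of _ 1] exI[of _ 0]) auto
next
  case True
  then obtain z0 w0 where z0: "z0 \<in> orth n v" and w0: "w0 \<in> orth n u" and b0: "dot z0 w0 \<noteq> 0" by blast
  define b c where "b = dot z0 w0" and "c = matrix_form M z0 w0"
  define N where "N z w = b * matrix_form M z w - c * dot z w" for z w
  have fs: "z \<in> finsupp n" if "z \<in> orth n t" for z t using that by (simp add: orth_def)
  have Nl: "N (\<lambda>i. p * y i + q * z i) w = p * N y w + q * N z w"
    if "y \<in> orth n v" "z \<in> orth n v" for p q y z w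
    using matrix_form_lincomb_left[OF fs fs, OF that] dot_lincomb_left[OF fs fs, OF that]
    by (simp add: N_def algebra_simps)
  have Nr: "N w (\<lambda>i. p * y i + q * z i) = p * N w y + q * N w z"
    if "y \<in> orth n u" "z \<in> orth n u" for p q y z w
    using matrix_form_lincomb_right[OF fs fs, OF that] dot_lincomb_right[of w p y q z]
    by (simp add: N_def algebra_simps)
  have N0: "N z w = 0" if "z \<in> orth n v" "w \<in> orth n u" "dot z w = 0" for z w
    using zero[OF that] that by (simp add: N_def)
  have N00: "N z0 w0 = 0" by (simp add: N_def b_def c_def)
  have b: "b \<noteq> 0" using b0 by (simp add: b_def)
  have Nzw0: "N z w0 = 0" if z: "z \<in> orth n v" for z
  proof -
    let ?z = "\<lambda>i. b * z i + (- dot z w0) * z0 i"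
    have "dot ?z w0 = 0"
      unfolding dot_lincomb_left[OF fs[OF z] fs[OF z0]] by (simp add: b_def)
    then have "N ?z w0 = 0" by (intro N0 orth_lincomb z z0 w0)
    then show ?thesis unfolding Nl[OF z z0] using N00 b by simp
  qed
  have Nz0w: "N z0 w = 0" if w: "w \<in> orth n u" for w
  proof -
    let ?w = "\<lambda>i. b * w i + (- dot z0 w) * w0 i"
    have "dot z0 ?w = 0"
      unfolding dot_lincomb_right by (simp add: b_def)
    then have "N z0 ?w = 0" by (intro N0 orth_lincomb w z0 w0)
    then show ?thesis unfolding Nr[OF w w0] using N00 b by simp
  qed
  have "N z w = 0" if z: "z \<in> orth n v" and w: "w \<in> orth n u" for z w
  proof -
    \<comment> \<open>\<open>w\<close> is replaced by \<open>w + w0\<close> if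
      \<open>dot z0 w\<close> is 0. The new vector has the nonzero product \<open>t\<close> with
      \<open>z0\<close>, so its product with \<open>z\<close> can be cancelled by a multiple of
      \<open>z0\<close>.\<close>
    define \<beta> where "\<beta> = (if dot z0 w = 0 then 1 else 0 :: int)"
    define t where "t = dot z0 w + \<beta> * b"
    have t: "t \<noteq> 0" using b by (simp add: t_def \<beta>_def)
    let ?w = "\<lambda>i. 1 * w i + \<beta> * w0 i"
    let ?s = "dot z w + \<beta> * dot z w0"
    let ?z = "\<lambda>i. t * z i + (- ?s) * z0 i"
    have w': "?w \<in> orth n u" by (rule orth_lincomb[OF w w0])
    have z': "?z \<in> orth n v" by (rule orth_lincomb[OF z z0])
    have d: "dot x ?w = dot x w + \<beta> * dot x w0" for x
      using dot_lincomb_right[of x 1 w \<beta> w0] by simp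
    have "dot ?z ?w = t * dot z ?w + (- ?s) * dot z0 ?w"
      by (rule dot_lincomb_left[OF fs[OF z] fs[OF z0]])
    also have "\<dots> = 0" unfolding d by (simp add: t_def b_def algebra_simps)
    finally have "N ?z ?w = 0" by (rule N0[OF z' w'])
    moreover have "N ?z ?w = t * N z ?w + (- ?s) * N z0 ?w" by (rule Nl[OF z z0])
    moreover have "N z0 ?w = 0" by (rule Nz0w[OF w'])
    moreover have "N z ?w = 1 * N z w + \<beta> * N z w0" by (rule Nr[OF w w0])
    moreover have "N z w0 = 0" by (rule Nzw0[OF z])
    ultimately show ?thesis using t by simp
  qed
  then show ?thesis using b by (intro exI[of _ b] exI[of _ c]) (simp add: N_def)
qed

section \<open>Forcing a product not to be an integer\<close>

lemma psum_tail:
  assumes "\<And>i. n \<le> i \<Longrightarrow> m dvd a i" "n \<le> N"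
  shows "m dvd psum a b N - psum a b n"
  using assms(2)
proof (induction N rule: dec_induct)
  case (step N)
  have "m dvd (psum a b N - psum a b n) + a N * b N" using step assms(1) by simp
  then show ?case by (simp add: psum_def algebra_simps)
qed simp

text \<open>From \<open>n\<close> on the partial sums no longer change modulo \<open>m\<close>, so a
  finite stage decides that the limit differs from \<open>j\<close>.\<close>

lemma not_pairs_if_residue:
  assumes "\<And>i. n \<le> i \<Longrightarrow> m dvd a i" "m \<noteq> 0" "\<not> m dvd psum a b n - j"
  shows "\<not> pairs a b j"
proof
  assume "pairs a b j"
  then obtain N0 where N0: "\<forall>N\<ge>N0. m dvd psum a b N - j" using pairsD assms by blast
  have "m dvd psum a b (max N0 n) - psum a b n" by (rule psum_tail) (use assms in auto)
  moreover have "m dvd psum a b (max N0 n) - j" using N0 by simp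
  ultimately have "m dvd (psum a b (max N0 n) - j) - (psum a b (max N0 n) - psum a b n)"
    by (rule dvd_diff[rotated])
  then show False using assms(3) by simp
qed

text \<open>Turns a difference \<open>d\<close> into a residue: raising the modulus by the factor
  \<open>\<bar>d\<bar> + 1\<close> makes \<open>d\<close> visible.\<close>

lemma not_dvd_larger: "\<not> m * (\<bar>d\<bar> + 1) dvd d" if "d \<noteq> 0" for d m :: int
proof
  assume "m * (\<bar>d\<bar> + 1) dvd d"
  then have "\<bar>d\<bar> + 1 dvd \<bar>d\<bar>" using dvd_mult_right by (simp add: dvd_mult_right)
  then show False using zdvd_imp_le[of "\<bar>d\<bar> + 1" "\<bar>d\<bar>"] that by simp
qed

text \<open>As no nonzero multiple of \<open>b\<close> is a combination of the constraints beyond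
  the length of a condition, some permitted direction \<open>z\<close> has \<open>dot z b\<close>
  nonzero. Moving the left vector along \<open>z\<close> changes its product with \<open>b\<close>,
  so any single integer \<open>j\<close> can be avoided; then the modulus is raised until the
  difference is visible.\<close>

theorem separating_vector:
  fixes C1 C2 :: "(nat \<Rightarrow> int) set"
  assumes MA: "martins_axiom TYPE(condition)" and small: "small C1" "small C2"
    and indep: "\<And>q v k n. finite v \<Longrightarrow> v \<subseteq> C2 \<Longrightarrow> q \<noteq> 0 \<Longrightarrow> \<not> (\<forall>i\<ge>n. q * b i = (\<Sum>h\<in>v. k h * h i))"
  shows "\<exists>x\<in>DD. (\<forall>h\<in>C2. compatible x h) \<and> \<not> compatible x b"
proof -
  define Q where "Q j p \<longleftrightarrow> \<not> int (md p) dvd dot (left p) b - j" for j p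
  have "\<exists>q\<in>conditions C1 C2. extends q p \<and> Q j q" if p: "p \<in> conditions C1 C2" for j p
  proof -
    have "finite (left_con p)" "left_con p \<subseteq> C2" using p by (auto simp: conditions_def)
    then obtain z where z: "z \<in> finsupp (len p)" "\<forall>h\<in>left_con p. dot z h = 0" "dot z b \<noteq> 0"
      using in_span_if_kernel[of "left_con p" "len p" b] indep[of "left_con p"] by blast
    have zero: "(\<lambda>_. 0) \<in> finsupp n" "dot (\<lambda>_. 0) h = 0" "dot z (\<lambda>_. 0) = 0" for n h z
      by (simp_all add: finsupp_def dot_def)
    obtain q where q: "q \<in> conditions C1 C2" "extends q p" "left q = (\<lambda>i. left p i + int (md p) * z i)"
      using prolong[OF p z(1,2), of "\<lambda>_. 0" 0] zero by auto
    have "left p \<in> finsupp 0"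
      using p finite_subset[of "{i. left p i \<noteq> 0}" "{..<len p}"]
      by (auto simp: finsupp_def conditions_def not_less[symmetric])
    moreover have "z \<in> finsupp 0" using z by (simp add: finsupp_def)
    ultimately have "dot (left q) b = dot (left p) b + int (md p) * dot z b"
      using dot_lincomb_left[of "left p" 0 z 1 "int (md p)" b] by (simp add: q(3))
    then have "dot (left q) b \<noteq> dot (left p) b" using z p by (simp add: conditions_def)
    \<comment> \<open>At most one of \<open>p\<close> and \<open>q\<close> has the value
      \<open>j\<close>.\<close>
    then obtain r where r: "r \<in> conditions C1 C2" "extends r p" "dot (left r) b \<noteq> j"
      using p q extends_refl[OF p] by metis
    define s where "s = tighten r (nat (\<bar>dot (left r) b - j\<bar> + 1)) {} {}"
    have "s \<in> conditions C1 C2" "extends s r"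
      unfolding s_def by (rule tighten_extends[OF r(1)], simp_all)+
    moreover have "Q j s"
      using not_dvd_larger[of "dot (left r) b - j" "int (md r)"] r(3) by (simp add: Q_def s_def)
    ultimately show ?thesis using extends_trans r by blast
  qed
  then obtain x y where x: "x \<in> DD" "\<forall>h\<in>C2. \<exists>k. pairs x h k"
    and ap: "\<forall>j. \<exists>p\<in>conditions C1 C2. Q j p \<and> approximates p x y"
    using generic_pair[OF MA small, of Q] by blast
  have "\<not> pairs x b j" for j
  proof -
    obtain p where p: "p \<in> conditions C1 C2" "Q j p" "approximates p x y" using ap by blast
    have "psum x b (len p) = dot (left p) b"
    proof -
      have "dot (left p) b = psum (left p) b (len p)"
        using p(1) by (intro dot_eq_psum) (simp add: conditions_def)
      then show ?thesis using p(3) by (simp add: psum_def approximates_def)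
    qed
    then show ?thesis
      using p by (intro not_pairs_if_residue[of "len p" "int (md p)"])
        (auto simp: approximates_def Q_def conditions_def)
  qed
  then show ?thesis using x by (auto simp: compatible_def)
qed

text \<open>The product of \<open>x M\<close> and \<open>y\<close> is approximated by
  \<open>matrix_form M (left p) (right p)\<close>. A permitted pair of directions with
  \<open>dot z w = 0\<close> and \<open>z M w\<close> nonzero changes this value without touching
  the product of \<open>x\<close> and \<open>y\<close>; a condition without such a pair would make
  \<open>M\<close> scalar up to finite rank.\<close>

theorem breaking_pair:
  fixes C1 C2 :: "(nat \<Rightarrow> int) set"
  assumes MA: "martins_axiom TYPE(condition)" and small: "small C1" "small C2"
    and rows: "\<And>n. M n \<in> C1" and cols: "\<And>m. column M m \<in> C2"
    and not: "\<not> scalar_mod_finite M C1 C2"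
  shows "\<exists>x\<in>DD. \<exists>y\<in>DD. (\<forall>h\<in>C2. compatible x h) \<and> (\<forall>h\<in>C1. compatible y h) \<and> compatible x y \<and>
    \<not> compatible (transform M x) y"
proof -
  define Q where "Q j p \<longleftrightarrow> (\<forall>m<len p. column M m \<in> left_con p) \<and>
    \<not> int (md p) dvd matrix_form M (left p) (right p) - j" for j p
  have "\<exists>q\<in>conditions C1 C2. extends q p \<and> Q j q" if p: "p \<in> conditions C1 C2" for j p
  proof -
    \<comment> \<open>Orthogonality to the rows and columns with index below \<open>len p\<close>
      makes both cross terms vanish, so that the form changes only by the square of the modulus
      times \<open>z M w\<close>.\<close>
    define p1 where "p1 = tighten p 1 (column M ` {..<len p}) (M ` {..<len p})"
    have p1: "p1 \<in> conditions C1 C2" "extends p1 p"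
      unfolding p1_def using rows cols tighten_extends[OF p, of 1 "M ` {..<len p}" "column M ` {..<len p}"] by auto
    have fin: "finite (left_con p1)" "left_con p1 \<subseteq> C2" "finite (right_con p1)" "right_con p1 \<subseteq> C1"
      using p1 by (auto simp: conditions_def)
    have "\<not> (\<forall>z\<in>orth (len p1) (left_con p1). \<forall>w\<in>orth (len p1) (right_con p1). dot z w = 0 \<longrightarrow> matrix_form M z w = 0)"
    proof
      assume a: "\<forall>z\<in>orth (len p1) (left_con p1). \<forall>w\<in>orth (len p1) (right_con p1). dot z w = 0 \<longrightarrow> matrix_form M z w = 0"
      have "\<exists>b c. b \<noteq> 0 \<and>
        (\<forall>z\<in>orth (len p1) (left_con p1). \<forall>w\<in>orth (len p1) (right_con p1). b * matrix_form M z w = c * dot z w)"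
        by (rule matrix_form_proportional) (use a in blast)
      then have "scalar_mod_finite M C1 C2" unfolding scalar_mod_finite_def
        using fin by (elim exE, intro exI conjI) auto
      then show False using not by contradiction
    qed
    then obtain z w where z: "z \<in> orth (len p1) (left_con p1)" and w: "w \<in> orth (len p1) (right_con p1)"
      and zw: "dot z w = 0" "matrix_form M z w \<noteq> 0" by blast
    obtain q where q: "q \<in> conditions C1 C2" "extends q p1"
      "left q = (\<lambda>i. left p1 i + int (md p1) * z i)" "right q = (\<lambda>i. right p1 i + int (md p1) * w i)"
      using prolong[OF p1(1), of z w 0] z w zw by (auto simp: orth_def)
    have fs: "left p1 \<in> finsupp 0" "right p1 \<in> finsupp 0" "z \<in> finsupp 0" "w \<in> finsupp 0"
      using p1 z w finite_subset[of "{i. left p1 i \<noteq> 0}" "{..<len p1}"]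
        finite_subset[of "{i. right p1 i \<noteq> 0}" "{..<len p1}"]
      by (auto simp: finsupp_def conditions_def orth_def not_less[symmetric])
    have lz: "left p1 i = 0" "right p1 i = 0" if "i \<ge> len p1" for i
      using p1 that by (simp_all add: conditions_def)
    have "matrix_form M (left p1) w = 0"
      unfolding matrix_form_def dot_def[of "left p1"]
    proof (intro sum.neutral ballI)
      fix i assume "i \<in> {i. left p1 i \<noteq> 0}"
      then have "i < len p1" using lz not_less by blast
      then have "M i \<in> right_con p1" by (simp add: p1_def)
      then show "left p1 i * dot w (M i) = 0" using w by (simp add: orth_def)
    qed
    moreover have "matrix_form M z (right p1) = 0"
      unfolding matrix_form_transpose[of M] unfolding matrix_form_def dot_def[of "right p1"]
    proof (intro sum.neutral ballI)
      fix i assume "i \<in> {i. right p1 i \<noteq> 0}"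
      then have "i < len p1" using lz not_less by blast
      then have "column M i \<in> left_con p1" by (simp add: p1_def)
      then show "right p1 i * dot z (column M i) = 0" using z by (simp add: orth_def)
    qed
    moreover have "matrix_form M (left q) y = matrix_form M (left p1) y + int (md p1) * matrix_form M z y" for y
      using matrix_form_lincomb_left[OF fs(1,3), of M 1 "int (md p1)" y] by (simp add: q(3))
    moreover have "matrix_form M x (right q) = matrix_form M x (right p1) + int (md p1) * matrix_form M x w" for x
      using matrix_form_lincomb_right[OF fs(2,4), of M x 1 "int (md p1)"] by (simp add: q(4))
    ultimately have "matrix_form M (left q) (right q) =
        matrix_form M (left p1) (right p1) + int (md p1) * (int (md p1) * matrix_form M z w)" by simp
    then have "matrix_form M (left q) (right q) \<noteq> matrix_form M (left p1) (right p1)"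
      using zw p1 by (simp add: conditions_def)
    then obtain r where r: "r \<in> conditions C1 C2" "extends r p1" "matrix_form M (left r) (right r) \<noteq> j"
      using p1 q extends_refl[OF p1(1)] by metis
    \<comment> \<open>Constraining the columns below \<open>len r\<close> fixes those entries of
      \<open>x M\<close>: they equal the products of \<open>left r\<close> with the columns. Hence
      the partial sum at \<open>len r\<close> is exactly the value of the form, and later terms are
      divisible by the modulus because the entries of \<open>y\<close> are.\<close>
    define s where "s = tighten r (nat (\<bar>matrix_form M (left r) (right r) - j\<bar> + 1)) (column M ` {..<len r}) {}"
    have "s \<in> conditions C1 C2" "extends s r"
      unfolding s_def using cols tighten_extends[OF r(1), of "nat (\<bar>matrix_form M (left r) (right r) - j\<bar> + 1)" "{}" "column M ` {..<len r}"]
      by auto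
    moreover have "Q j s"
      using not_dvd_larger[of "matrix_form M (left r) (right r) - j" "int (md r)"] r(3) by (simp add: Q_def s_def)
    ultimately show ?thesis using extends_trans r p1 by blast
  qed
  then obtain x y where xy: "x \<in> DD" "y \<in> DD" "\<forall>h\<in>C2. \<exists>k. pairs x h k" "\<forall>h\<in>C1. \<exists>k. pairs y h k"
    "\<exists>k. pairs x y k" and ap: "\<forall>j. \<exists>p\<in>conditions C1 C2. Q j p \<and> approximates p x y"
    using generic_pair[OF MA small, of Q] by blast
  have "\<not> pairs (transform M x) y j" for j
  proof -
    obtain p where p: "p \<in> conditions C1 C2" "Q j p" "approximates p x y" using ap by blast
    have "psum (right p) (transform M x) (len p) = matrix_form M (left p) (right p)"
    proof -
      have "matrix_form M (left p) (right p) = psum (right p) (\<lambda>m. dot (left p) (column M m)) (len p)"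
        unfolding matrix_form_transpose[of M] unfolding matrix_form_def
        using p(1) by (intro dot_eq_psum) (simp add: conditions_def)
      also have "\<dots> = psum (right p) (transform M x) (len p)"
        unfolding psum_def
      proof (intro sum.cong refl)
        fix m assume "m \<in> {..<len p}"
        then have "pairs x (column M m) (dot (left p) (column M m))"
          using p by (simp add: Q_def approximates_def)
        then show "right p m * dot (left p) (column M m) = right p m * transform M x m"
          by (simp add: transform_def pairing_eq)
      qed
      finally show ?thesis by simp
    qed
    moreover have "psum y (transform M x) (len p) = psum (right p) (transform M x) (len p)"
      using p(3) by (simp add: psum_def approximates_def)
    ultimately have "\<not> pairs y (transform M x) j"
      using p by (intro not_pairs_if_residue[of "len p" "int (md p)"])
        (auto simp: approximates_def Q_def conditions_def)
    then show ?thesis by (simp add: pairs_commute)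
  qed
  then show ?thesis using xy unfolding compatible_def by blast
qed

section \<open>Construction of the pair\<close>

text \<open>The recursion produces a set of tagged vectors: \<open>(False, a)\<close> stands for \<open>a \<in> H1\<close> and \<open>(True, b)\<close> for \<open>b \<in> H2\<close>.\<close>
lemma exists_rigid_pair:
  assumes MA: "martins_axiom TYPE(nat set)"
  shows "\<exists>H1 H2. H1 \<subseteq> DD \<and> H2 \<subseteq> DD \<and> (\<forall>a\<in>H1. \<forall>b\<in>H2. compatible a b) \<and>
    (\<forall>a. (\<forall>b\<in>H2. compatible a b) \<longrightarrow> a \<in> H1) \<and>
    (\<forall>b. (\<forall>a\<in>H1. compatible a b) \<longrightarrow> b \<in> H2) \<and>
    (\<forall>M. range M \<subseteq> H1 \<longrightarrow> range (column M) \<subseteq> H2 \<longrightarrow> (\<forall>x\<in>H1. transform M x \<in> H1) \<longrightarrow>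
      scalar_mod_finite M H1 H2)"
proof -
  note MA' = martins_axiom_transfer[OF MA, where 'a = condition]
  define r where "r p q \<longleftrightarrow> snd p \<in> DD \<and> snd q \<in> DD \<and> (fst p \<noteq> fst q \<longrightarrow> compatible (snd p) (snd q))"
    for p q :: "bool \<times> (nat \<Rightarrow> int)"
  define ok where "ok C \<longleftrightarrow> (\<forall>p\<in>C. \<forall>q\<in>C. r p q)" for C
  define side where "side i C = {a. (i, a) \<in> C}" for i :: bool and C :: "(bool \<times> (nat \<Rightarrow> int)) set"
  \<comment> \<open>Vector task: \<open>b\<close> joins side \<open>i\<close>, or some vector on the
    opposite side keeps it out.\<close>
  define G1 where "G1 i b C \<longleftrightarrow> b \<in> side i C \<or> (\<exists>a\<in>side (\<not> i) C. \<not> compatible a b)" for i b C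
  define RC where "RC M = range (\<lambda>n. (False, M n)) \<union> range (\<lambda>m. (True, column M m))" for M
  \<comment> \<open>Matrix task: the rows and columns cannot join the groups consistently, or a pair
    already shows that \<open>M\<close> does not act on the first group, or \<open>M\<close> is
    scalar up to finite rank. Each of the three persists when \<open>C\<close> grows.\<close>
  define G2 where "G2 M C \<longleftrightarrow> \<not> ok (C \<union> RC M) \<or>
    (\<exists>x\<in>side False C. \<exists>y\<in>side True C. \<not> compatible (transform M x) y) \<or>
    scalar_mod_finite M (side False (C \<union> RC M)) (side True (C \<union> RC M))" for M C
  have ok_insert: "ok (insert (i, x) C)"
    if "ok C" "x \<in> DD" "\<And>h. h \<in> side (\<not> i) C \<Longrightarrow> compatible x h" for i x C
    unfolding ok_def
  proof (intro ballI)
    fix p q assume pq: "p \<in> insert (i, x) C" "q \<in> insert (i, x) C"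
    have old: "r p q" if "p \<in> C" "q \<in> C" for p q using \<open>ok C\<close> that by (simp add: ok_def)
    have new: "r (i, x) q" "r q (i, x)" if q: "q \<in> C" for q
    proof -
      have "snd q \<in> DD" using old[OF q q] by (simp add: r_def)
      moreover have "compatible x (snd q)" if "i \<noteq> fst q"
      proof -
        have "(\<not> i, snd q) \<in> C" using q that by (cases q) auto
        then show ?thesis using \<open>\<And>h. h \<in> side (\<not> i) C \<Longrightarrow> compatible x h\<close> by (simp add: side_def)
      qed
      ultimately show "r (i, x) q" "r q (i, x)" using \<open>x \<in> DD\<close> by (auto simp: r_def compatible_commute)
    qed
    have "r (i, x) (i, x)" using \<open>x \<in> DD\<close> by (simp add: r_def)
    then show "r p q" using pq old new unfolding insert_iff by blast
  qed
  have side_mono: "side i C \<subseteq> side i C'" if "C \<subseteq> C'" for i C C' using that by (auto simp: side_def)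
  have side_small: "small (side i C)" if "small C" for i C
    by (rule small_subset[OF small_image[OF that, of snd]]) (force simp: side_def)
  have ok_subset: "ok C" if "ok C'" "C \<subseteq> C'" for C C' using that by (auto simp: ok_def)
  have side_DD: "a \<in> DD" if "ok C" "a \<in> side i C" for a i C using that by (force simp: ok_def side_def r_def)
  have side_compat: "compatible a b" if "ok C" "a \<in> side i C" "b \<in> side (\<not> i) C" for a b i C
    using that by (force simp: ok_def side_def r_def)
  have mono1: "G1 i b C'" if "G1 i b C" "C \<subseteq> C'" for i b C C'
    using that side_mono[OF that(2)] unfolding G1_def by blast
  have mono2: "G2 M C'" if "G2 M C" "C \<subseteq> C'" for M C C'
  proof -
    have sub: "C \<union> RC M \<subseteq> C' \<union> RC M" using that by blast
    have "scalar_mod_finite M (side False (C' \<union> RC M)) (side True (C' \<union> RC M))"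
      if "scalar_mod_finite M (side False (C \<union> RC M)) (side True (C \<union> RC M))"
      using that side_mono[OF sub, of False] side_mono[OF sub, of True]
      unfolding scalar_mod_finite_def by (meson order_trans)
    then show ?thesis using that ok_subset[OF _ sub] side_mono[OF that(2)] unfolding G2_def by blast
  qed
  have step1: "\<exists>A. countable A \<and> ok (C \<union> A) \<and> G1 i b (C \<union> A)" if C: "small C" "ok C" for i b C
  proof (cases "\<exists>q v k n. finite v \<and> v \<subseteq> side i C \<and> q \<noteq> 0 \<and> (\<forall>j\<ge>n. q * b j = (\<Sum>h\<in>v. k h * h j))")
    case True
    then obtain q v k n where v: "finite v" "v \<subseteq> side i C" "q \<noteq> 0"
      and eq: "\<forall>j\<ge>n. q * b j = (\<Sum>h\<in>v. k h * h j)" by blast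
    \<comment> \<open>Up to the finitely supported correction \<open>t\<close> the vector
      \<open>q * b\<close> is a combination of vectors of \<open>side i C\<close>, so
      \<open>b\<close> pairs integrally with the opposite side and may be added.\<close>
    define t where "t j = (if j < n then q * b j - (\<Sum>h\<in>v. k h * h j) else 0)" for j
    have t: "t \<in> finsupp 0"
      using finite_subset[of "{i. t i \<noteq> 0}" "{..<n}"] by (auto simp: finsupp_def t_def)
    have qb: "(\<lambda>j. q * b j) = (\<lambda>j. 1 * (\<Sum>h\<in>v. k h * h j) + 1 * t j)"
      using eq by (auto simp: t_def fun_eq_iff)
    have "(\<lambda>j. \<Sum>h\<in>v. k h * h j) \<in> DD"
      using v(1,2)
    proof (induction v rule: finite_induct)
      case empty
      show ?case by (simp add: mem_DD)
    next
      case (insert h v)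
      then have "(\<lambda>j. k h * h j + 1 * (\<Sum>h\<in>v. k h * h j)) \<in> DD"
        using side_DD[OF C(2)] by (intro DD_lincomb) auto
      then show ?case using insert by simp
    qed
    then have "(\<lambda>j. q * b j) \<in> DD" unfolding qb by (rule DD_lincomb[OF _ finsupp_DD[OF t]])
    then have b: "b \<in> DD" using DD_divide v by blast
    have "compatible b a" if a: "a \<in> side (\<not> i) C" for a
    proof -
      have "compatible h a" if "h \<in> v" for h
        using side_compat[OF C(2) _ a] v that by blast
      then have "pairs h a (pairing h a)" if "h \<in> v" for h using that pairs_pairing by blast
      then have "pairs (\<lambda>j. \<Sum>h\<in>v. k h * h j) a (\<Sum>h\<in>v. k h * pairing h a)"
        by (intro pairs_sum v(1))
      from pairs_lincomb[OF this pairs_dot[OF t], of 1 1, folded qb]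
      show ?thesis using pairs_divide v(3) unfolding compatible_def by blast
    qed
    then have "ok (C \<union> {(i, b)})" using ok_insert[OF C(2) b] by simp
    moreover have "G1 i b (C \<union> {(i, b)})" by (simp add: G1_def side_def)
    ultimately show ?thesis by (intro exI[of _ "{(i, b)}"]) simp
  next
    case False
    then obtain x where x: "x \<in> DD" "\<forall>h\<in>side i C. compatible x h" "\<not> compatible x b"
      using separating_vector[OF MA' side_small[OF C(1), of "\<not> i"] side_small[OF C(1), of i], of b] by blast
    then have "ok (C \<union> {(\<not> i, x)})" using ok_insert[OF C(2) x(1), of "\<not> i"] by simp
    moreover have "G1 i b (C \<union> {(\<not> i, x)})" using x by (auto simp: G1_def side_def)
    ultimately show ?thesis by (intro exI[of _ "{(\<not> i, x)}"]) simp
  qed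
  have step2: "\<exists>A. countable A \<and> ok (C \<union> A) \<and> G2 M (C \<union> A)" if C: "small C" "ok C" for M C
  proof (cases "ok (C \<union> RC M)")
    case False
    then have "G2 M C" by (simp add: G2_def)
    then show ?thesis using C by (intro exI[of _ "{}"]) simp
  next
    case True
    let ?C = "C \<union> RC M"
    have cRC: "countable (RC M)" by (simp add: RC_def)
    show ?thesis
    proof (cases "scalar_mod_finite M (side False ?C) (side True ?C)")
      case True
      then have "G2 M ?C" by (simp add: G2_def)
      then show ?thesis using \<open>ok ?C\<close> cRC by blast
    next
      case False
      have sm: "small (side i ?C)" for i by (intro side_small small_Un C small_countable cRC)
      have "M n \<in> side False ?C" "column M m \<in> side True ?C" for n m by (auto simp: side_def RC_def)
      then obtain x y where xy: "x \<in> DD" "y \<in> DD" "\<forall>h\<in>side True ?C. compatible x h"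
        "\<forall>h\<in>side False ?C. compatible y h" "compatible x y" "\<not> compatible (transform M x) y"
        using breaking_pair[OF MA' sm sm _ _ False] by blast
      have ok1: "ok (insert (False, x) ?C)" using ok_insert[OF \<open>ok ?C\<close> xy(1), of False] xy(3) by simp
      have "compatible y h" if "h \<in> side False (insert (False, x) ?C)" for h
        using that xy(4,5) by (auto simp: side_def compatible_commute)
      then have "ok (insert (True, y) (insert (False, x) ?C))" using ok_insert[OF ok1 xy(2), of True] by simp
      moreover have "insert (True, y) (insert (False, x) ?C) = C \<union> ({(True, y), (False, x)} \<union> RC M)" by blast
      moreover have "G2 M (insert (True, y) (insert (False, x) ?C))"
        using xy(6) by (auto simp: G2_def side_def)
      moreover have "countable ({(True, y), (False, x)} \<union> RC M)" using cRC by simp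
      ultimately show ?thesis by metis
    qed
  qed
  \<comment> \<open>Vector tasks are carried by row 0 of a matrix, so that one type indexes all
    tasks.\<close>
  define Good where "Good M C \<longleftrightarrow> G1 False (M 0) C \<and> G1 True (M 0) C \<and> G2 M C" for M C
  have tasks: "(UNIV :: (nat \<Rightarrow> nat \<Rightarrow> int) set) \<lesssim> (UNIV :: nat set set)"
  proof -
    have "inj (\<lambda>M :: nat \<Rightarrow> nat \<Rightarrow> int. {to_nat (i, j, M i j) | i j. True})"
    proof (rule injI)
      fix M N :: "nat \<Rightarrow> nat \<Rightarrow> int"
      assume eq: "{to_nat (i, j, M i j) | i j. True} = {to_nat (i, j, N i j) | i j. True}"
      have "M i j = N i j" for i j
      proof -
        have "to_nat (i, j, M i j) \<in> {to_nat (i, j, N i j) | i j. True}" using eq by blast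
        then show ?thesis by auto
      qed
      then show "M = N" by blast
    qed
    then show ?thesis unfolding lepoll_def by blast
  qed
  have step: "\<exists>A. countable A \<and> ok (C \<union> A) \<and> Good M (C \<union> A)" if C: "small C" "ok C" for M C
  proof -
    obtain A1 where A1: "countable A1" "ok (C \<union> A1)" "G1 False (M 0) (C \<union> A1)" using step1[OF C] by blast
    have s1: "small (C \<union> A1)" by (intro small_Un C small_countable A1)
    obtain A2 where A2: "countable A2" "ok (C \<union> A1 \<union> A2)" "G1 True (M 0) (C \<union> A1 \<union> A2)"
      using step1[OF s1 A1(2)] by blast
    have s2: "small (C \<union> A1 \<union> A2)" by (intro small_Un s1 small_countable A2)
    obtain A3 where A3: "countable A3" "ok (C \<union> A1 \<union> A2 \<union> A3)" "G2 M (C \<union> A1 \<union> A2 \<union> A3)"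
      using step2[OF s2 A2(2)] by blast
    have "G1 False (M 0) (C \<union> A1 \<union> A2 \<union> A3)" by (rule mono1[OF A1(3)]) blast
    moreover have "G1 True (M 0) (C \<union> A1 \<union> A2 \<union> A3)" by (rule mono1[OF A2(3)]) blast
    moreover have "C \<union> A1 \<union> A2 \<union> A3 = C \<union> (A1 \<union> A2 \<union> A3)" by blast
    moreover have "countable (A1 \<union> A2 \<union> A3)" using A1 A2 A3 by simp
    ultimately show ?thesis using A3 unfolding Good_def by metis
  qed
  have good_mono: "Good M C'" if "Good M C" "C \<subseteq> C'" for M C C'
    using that mono1 mono2 unfolding Good_def by blast
  have "\<exists>C. ok C \<and> (\<forall>M. Good M C)"
    unfolding ok_def
    by (rule pairwise_transfinite_extension[OF tasks, where Good = Good, OF good_mono step[unfolded ok_def]])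
  then obtain C where C: "ok C" "\<And>M. Good M C" by blast
  have g1: "G1 False b C" "G1 True b C" for b using C(2)[of "\<lambda>_. b"] by (simp_all add: Good_def)
  have g2: "G2 M C" for M using C(2) by (simp add: Good_def)
  show ?thesis
  proof (rule exI[of _ "side False C"], rule exI[of _ "side True C"], intro conjI allI impI ballI)
    show "side False C \<subseteq> DD" "side True C \<subseteq> DD" using side_DD[OF C(1)] by blast+
    show "compatible a b" if "a \<in> side False C" "b \<in> side True C" for a b
      using side_compat[OF C(1) that(1)] that(2) by simp
    show "a \<in> side False C" if "\<forall>b\<in>side True C. compatible a b" for a
      using g1(1)[of a] that by (auto simp: G1_def compatible_commute)
    show "b \<in> side True C" if "\<forall>a\<in>side False C. compatible a b" for b
      using g1(2)[of b] that by (auto simp: G1_def)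
    fix M
    assume M: "range M \<subseteq> side False C" "range (column M) \<subseteq> side True C" "\<forall>x\<in>side False C. transform M x \<in> side False C"
    then have "C \<union> RC M = C" by (auto simp: RC_def side_def)
    then show "scalar_mod_finite M (side False C) (side True C)"
      using g2[of M] C(1) M(3) side_compat[OF C(1), of _ False] unfolding G2_def by auto
  qed
qed

section \<open>Homomorphisms of a rigid pair\<close>

text \<open>Being a subgroup, in a form that keeps arguments about sequences free of group
  records.\<close>

definition lincomb_closed :: "(nat \<Rightarrow> int) set \<Rightarrow> bool" where
  "lincomb_closed H \<longleftrightarrow> H \<noteq> {} \<and> (\<forall>x\<in>H. \<forall>y\<in>H. \<forall>p q. (\<lambda>i. p * x i + q * y i) \<in> H)"

definition additive_on :: "(nat \<Rightarrow> int) set \<Rightarrow> ((nat \<Rightarrow> int) \<Rightarrow> int) \<Rightarrow> bool" where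
  "additive_on H \<phi> \<longleftrightarrow> (\<forall>x\<in>H. \<forall>y\<in>H. \<phi> (\<lambda>i. x i + y i) = \<phi> x + \<phi> y)"

lemma lincomb_closedD: "lincomb_closed H \<Longrightarrow> x \<in> H \<Longrightarrow> y \<in> H \<Longrightarrow> (\<lambda>i. p * x i + q * y i) \<in> H"
  by (simp add: lincomb_closed_def)

lemma lincomb_closed_scale: "lincomb_closed H \<Longrightarrow> x \<in> H \<Longrightarrow> (\<lambda>i. p * x i) \<in> H"
  using lincomb_closedD[of H x x p 0] by simp

lemma lincomb_closed_zero:
  assumes "lincomb_closed H"
  shows "(\<lambda>i. 0) \<in> H"
proof -
  obtain x where "x \<in> H" using assms unfolding lincomb_closed_def by blast
  from lincomb_closed_scale[OF assms this, of 0] show ?thesis by simp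
qed

lemma lincomb_closed_sum:
  assumes "lincomb_closed H" "finite J" "\<And>j. j \<in> J \<Longrightarrow> y j \<in> H"
  shows "(\<lambda>i. \<Sum>j\<in>J. c j * y j i) \<in> H"
  using assms(2,3)
proof (induction J rule: finite_induct)
  case empty
  then show ?case by (simp add: lincomb_closed_zero assms(1))
next
  case (insert j J)
  then have "(\<lambda>i. c j * y j i + 1 * (\<Sum>j\<in>J. c j * y j i)) \<in> H"
    by (intro lincomb_closedD assms(1)) auto
  then show ?case using insert by simp
qed

lemma additive_scale:
  assumes H: "lincomb_closed H" and add: "additive_on H \<phi>" and x: "x \<in> H"
  shows "\<phi> (\<lambda>i. p * x i) = p * \<phi> x"
proof -
  have sc: "(\<lambda>i. q * x i) \<in> H" for q by (rule lincomb_closed_scale[OF H x])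
  have plus: "\<phi> (\<lambda>i. (q + q') * x i) = \<phi> (\<lambda>i. q * x i) + \<phi> (\<lambda>i. q' * x i)" for q q'
    using add sc[of q] sc[of q'] by (simp add: additive_on_def distrib_right)
  have zero: "\<phi> (\<lambda>i. 0) = 0" using plus[of 0 0] by simp
  have nat: "\<phi> (\<lambda>i. int n * x i) = int n * \<phi> x" for n
  proof (induction n)
    case (Suc n)
    then show ?case using plus[of "int n" 1] by (simp add: distrib_right add.commute)
  qed (simp add: zero)
  show ?thesis
  proof (cases "p \<ge> 0")
    case True
    then show ?thesis using nat[of "nat p"] by simp
  next
    case False
    then have "\<phi> (\<lambda>i. p * x i) + \<phi> (\<lambda>i. int (nat (- p)) * x i) = 0"
      using plus[of p "int (nat (- p))"] zero by simp
    then show ?thesis using nat[of "nat (- p)"] False by simp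
  qed
qed

lemma additive_lincomb:
  assumes H: "lincomb_closed H" and add: "additive_on H \<phi>" and xy: "x \<in> H" "y \<in> H"
  shows "\<phi> (\<lambda>i. p * x i + q * y i) = p * \<phi> x + q * \<phi> y"
proof -
  have "\<phi> (\<lambda>i. p * x i + q * y i) = \<phi> (\<lambda>i. p * x i) + \<phi> (\<lambda>i. q * y i)"
    using add lincomb_closed_scale[OF H] xy by (simp add: additive_on_def)
  then show ?thesis using additive_scale[OF H add] xy by simp
qed

lemma additive_sum:
  assumes H: "lincomb_closed H" and add: "additive_on H \<phi>" and "finite J" "\<And>j. j \<in> J \<Longrightarrow> y j \<in> H"
  shows "\<phi> (\<lambda>i. \<Sum>j\<in>J. c j * y j i) = (\<Sum>j\<in>J. c j * \<phi> (y j))"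
  using assms(3,4)
proof (induction J rule: finite_induct)
  case empty
  obtain x where "x \<in> H" using H unfolding lincomb_closed_def by blast
  then show ?case using additive_scale[OF H add, of x 0] by simp
next
  case (insert j J)
  have "\<phi> (\<lambda>i. c j * y j i + 1 * (\<Sum>j\<in>J. c j * y j i)) = c j * \<phi> (y j) + 1 * \<phi> (\<lambda>i. \<Sum>j\<in>J. c j * y j i)"
    using insert by (intro additive_lincomb[OF H add] lincomb_closed_sum[OF H]) auto
  then show ?case using insert by simp
qed

lemma additive_on_finsupp_dot:
  assumes H: "lincomb_closed H" and add: "additive_on H \<phi>" and units: "\<And>i. unit_vector i \<in> H"
    and z: "z \<in> finsupp n"
  shows "\<phi> z = dot z (\<lambda>i. \<phi> (unit_vector i))"
proof -
  let ?J = "{i. z i \<noteq> 0}"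
  have fin: "finite ?J" using z by (simp add: finsupp_def)
  have "z = (\<lambda>i. \<Sum>j\<in>?J. z j * unit_vector j i)"
  proof
    fix i
    have "(\<Sum>j\<in>?J. z j * unit_vector j i) = (\<Sum>j\<in>?J. if j = i then z i else 0)"
      by (intro sum.cong) (auto simp: unit_vector_def)
    also have "\<dots> = z i" using fin by (simp add: sum.delta)
    finally show "z i = (\<Sum>j\<in>?J. z j * unit_vector j i)" by simp
  qed
  then have "\<phi> z = \<phi> (\<lambda>i. \<Sum>j\<in>?J. z j * unit_vector j i)" by simp
  also have "\<dots> = (\<Sum>j\<in>?J. z j * \<phi> (unit_vector j))"
    by (rule additive_sum[OF H add fin]) (rule units)
  finally show ?thesis by (simp add: dot_def)
qed

text \<open>Up to a nonzero factor such a vector is determined by its coefficients along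
  \<open>u\<close> and its first \<open>n\<close> coordinates, which makes \<open>card u + n\<close>
  linear conditions on a combination.\<close>

lemma dependent_families_almost_span:
  assumes "finite u"
  shows "dependent_families (Suc (card u + n))
    {y. \<exists>q k. q \<noteq> 0 \<and> (\<forall>i\<ge>n. q * y i = (\<Sum>h\<in>u. k h * h i))}"
  unfolding dependent_families_def
proof (intro allI impI)
  let ?r = "Suc (card u + n)"
  fix y :: "nat \<Rightarrow> nat \<Rightarrow> int"
  assume "\<forall>j<?r. y j \<in> {y. \<exists>q k. q \<noteq> 0 \<and> (\<forall>i\<ge>n. q * y i = (\<Sum>h\<in>u. k h * h i))}"
  then have "\<forall>j\<in>{..<?r}. \<exists>q k. q \<noteq> 0 \<and> (\<forall>i\<ge>n. q * y j i = (\<Sum>h\<in>u. k h * h i))" by blast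
  then obtain q where "\<forall>j\<in>{..<?r}. \<exists>k. q j \<noteq> 0 \<and> (\<forall>i\<ge>n. q j * y j i = (\<Sum>h\<in>u. k h * h i))"
    by (rule bchoice[THEN exE])
  then obtain k where qk: "\<forall>j\<in>{..<?r}. q j \<noteq> 0 \<and> (\<forall>i\<ge>n. q j * y j i = (\<Sum>h\<in>u. k j h * h i))"
    by (rule bchoice[THEN exE])
  define I where "I = (\<lambda>h j. k j h) ` u \<union> (\<lambda>i j. q j * y j i) ` {..<n}"
  have "card I \<le> card u + n"
    unfolding I_def using card_image_le[OF assms, of "\<lambda>h j. k j h"] card_image_le[of "{..<n}" "\<lambda>i j. q j * y j i"]
      card_Un_le[of "(\<lambda>h j. k j h) ` u" "(\<lambda>i j. q j * y j i) ` {..<n}"] by simp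
  then obtain c where c: "\<exists>j\<in>{..<?r}. c j \<noteq> 0" "\<forall>g\<in>I. (\<Sum>j<?r. c j * g j) = 0"
    using nonzero_solution[of I "{..<?r}" "\<lambda>g. g"] assms by (auto simp: I_def)
  have "(\<Sum>j<?r. (c j * q j) * y j i) = 0" for i
  proof (cases "i < n")
    case True
    then have "(\<lambda>j. q j * y j i) \<in> I" by (simp add: I_def)
    then show ?thesis using c(2) by (auto simp: mult.assoc)
  next
    case False
    have "(\<Sum>j<?r. (c j * q j) * y j i) = (\<Sum>j<?r. c j * (\<Sum>h\<in>u. k j h * h i))"
      using qk False by (intro sum.cong) (auto simp: mult.assoc)
    also have "\<dots> = (\<Sum>j<?r. \<Sum>h\<in>u. (c j * k j h) * h i)" by (simp only: sum_distrib_left mult.assoc)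
    also have "\<dots> = (\<Sum>h\<in>u. \<Sum>j<?r. (c j * k j h) * h i)" by (rule sum.swap)
    also have "\<dots> = (\<Sum>h\<in>u. (\<Sum>j<?r. c j * k j h) * h i)" by (simp only: sum_distrib_right)
    also have "\<dots> = 0"
    proof (intro sum.neutral ballI)
      fix h assume "h \<in> u"
      then have "(\<lambda>j. k j h) \<in> I" by (simp add: I_def)
      then show "(\<Sum>j<?r. c j * k j h) * h i = 0" using c(2) by auto
    qed
    finally show ?thesis .
  qed
  moreover have "\<exists>j<?r. c j * q j \<noteq> 0" using c(1) qk by auto
  ultimately show "\<exists>c. (\<exists>j<?r. c j \<noteq> 0) \<and> (\<forall>i. (\<Sum>j<?r. c j * y j i) = 0)"
    by (intro exI[of _ "\<lambda>j. c j * q j"] conjI allI)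
qed

text \<open>Rank and nullity: some nontrivial combination of \<open>card G + 1\<close> preimages is
  killed by all of \<open>G\<close>, hence by \<open>f\<close>.\<close>

lemma dependent_families_kernel:
  assumes H: "lincomb_closed H" and f: "\<And>i. additive_on H (\<lambda>x. f x i)"
    and G: "finite G" "\<And>g. g \<in> G \<Longrightarrow> additive_on H g"
    and ker: "\<And>x. x \<in> H \<Longrightarrow> \<forall>g\<in>G. g x = 0 \<Longrightarrow> \<forall>i. f x i = 0"
  shows "dependent_families (Suc (card G)) (f ` H)"
  unfolding dependent_families_def
proof (intro allI impI)
  let ?r = "Suc (card G)"
  fix y assume "\<forall>j<?r. y j \<in> f ` H"
  then have "\<forall>j\<in>{..<?r}. \<exists>x. x \<in> H \<and> y j = f x" by blast
  then obtain x where x: "\<forall>j\<in>{..<?r}. x j \<in> H \<and> y j = f (x j)" by (rule bchoice[THEN exE])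
  obtain c where c: "\<exists>j\<in>{..<?r}. c j \<noteq> 0" "\<forall>g\<in>G. (\<Sum>j<?r. c j * g (x j)) = 0"
    using nonzero_solution[of G "{..<?r}" "\<lambda>g j. g (x j)"] G(1) by auto
  let ?x = "\<lambda>i. \<Sum>j<?r. c j * x j i"
  have "g ?x = (\<Sum>j<?r. c j * g (x j))" if "additive_on H g" for g
    using x by (intro additive_sum[OF H that]) auto
  then have "\<forall>g\<in>G. g ?x = 0" "\<forall>i. f ?x i = (\<Sum>j<?r. c j * f (x j) i)" using G(2) c(2) f by auto
  moreover have "?x \<in> H" by (rule lincomb_closed_sum[OF H]) (use x in auto)
  ultimately have "\<forall>i. (\<Sum>j<?r. c j * f (x j) i) = 0" using ker[of ?x] by simp
  then have "\<forall>i. (\<Sum>j<?r. c j * y j i) = 0" using x by auto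
  then show "\<exists>c. (\<exists>j<?r. c j \<noteq> 0) \<and> (\<forall>i. (\<Sum>j<?r. c j * y j i) = 0)" using c(1) by blast
qed

text \<open>\<open>max1\<close> and \<open>max2\<close> range over all integer sequences, because
  they are applied to value sequences of homomorphisms, whose membership in \<open>DD\<close> is a
  consequence.\<close>

locale dual_pair =
  fixes H1 H2 :: "(nat \<Rightarrow> int) set"
  assumes DD1: "H1 \<subseteq> DD" and DD2: "H2 \<subseteq> DD"
    and compat: "a \<in> H1 \<Longrightarrow> b \<in> H2 \<Longrightarrow> compatible a b"
    and max1: "(\<And>b. b \<in> H2 \<Longrightarrow> compatible a b) \<Longrightarrow> a \<in> H1"
    and max2: "(\<And>a. a \<in> H1 \<Longrightarrow> compatible a b) \<Longrightarrow> b \<in> H2"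
begin

lemma finsupp_H1: "z \<in> finsupp n \<Longrightarrow> z \<in> H1"
  by (rule max1) (unfold compatible_def, rule exI, rule pairs_dot)

lemma unit_vector_H1: "unit_vector i \<in> H1"
  by (rule finsupp_H1[OF unit_vector_finsupp[OF le0]])

lemma lincomb_closed_H1: "lincomb_closed H1"
  unfolding lincomb_closed_def
proof (intro conjI ballI allI)
  show "H1 \<noteq> {}" using unit_vector_H1 by blast
  show "(\<lambda>i. p * x i + q * y i) \<in> H1" if xy: "x \<in> H1" "y \<in> H1" for x y p q
  proof (rule max1)
    fix b assume b: "b \<in> H2"
    obtain k l where "pairs x b k" "pairs y b l" using compat xy b unfolding compatible_def by blast
    from pairs_lincomb[OF this] show "compatible (\<lambda>i. p * x i + q * y i) b" unfolding compatible_def by blast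
  qed
qed

lemma divide_H1:
  assumes "(\<lambda>i. q * x i) \<in> H1" "q \<noteq> 0"
  shows "x \<in> H1"
proof (rule max1)
  fix b assume "b \<in> H2"
  then obtain k where "pairs (\<lambda>i. q * x i) b k" using compat assms(1) unfolding compatible_def by blast
  from pairs_divide[OF this assms(2)] show "compatible x b" unfolding compatible_def by blast
qed

lemma pairs_H: "a \<in> H1 \<Longrightarrow> b \<in> H2 \<Longrightarrow> pairs a b (pairing a b)"
  by (rule pairs_pairing[OF compat])

lemma additive_pairing: "b \<in> H2 \<Longrightarrow> additive_on H1 (\<lambda>a. pairing a b)"
  unfolding additive_on_def
proof (intro ballI)
  fix x y assume "x \<in> H1" "y \<in> H1" and b: "b \<in> H2"
  then have "pairs (\<lambda>i. 1 * x i + 1 * y i) b (1 * pairing x b + 1 * pairing y b)"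
    by (intro pairs_lincomb pairs_H)
  then show "pairing (\<lambda>i. x i + y i) b = pairing x b + pairing y b" by (intro pairing_eq) simp
qed

text \<open>Elements of \<open>DD\<close> are finitely supported modulo \<open>n\<close>:
  \<open>x\<close> is a truncation \<open>z\<close> plus \<open>n\<close> times some
  \<open>y\<close>, which lies in \<open>H1\<close> by purity. So \<open>\<phi> x\<close> agrees
  with \<open>\<phi> z\<close> modulo \<open>n\<close>, for every \<open>n\<close>, and
  \<open>\<phi>\<close> is given by its values on the unit vectors.\<close>

lemma hom_pairs:
  assumes add: "additive_on H1 \<phi>" and x: "x \<in> H1"
  shows "pairs x (\<lambda>i. \<phi> (unit_vector i)) (\<phi> x)"
proof (rule pairsI)
  fix n :: nat assume n: "n > 0"
  have "x \<in> DD" using x DD1 by blast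
  moreover have "int n \<noteq> 0" using n by simp
  ultimately obtain N0 where N0: "\<forall>i\<ge>N0. int n dvd x i" unfolding mem_DD by blast
  have "int n dvd psum x (\<lambda>i. \<phi> (unit_vector i)) N - \<phi> x" if N: "N \<ge> N0" for N
  proof -
    define z where "z i = (if i < N then x i else 0)" for i
    define y where "y i = (if i < N then 0 else x i div int n)" for i
    have z: "z \<in> finsupp 0"
      using finite_subset[of "{i. z i \<noteq> 0}" "{..<N}"] by (auto simp: finsupp_def z_def)
    have "x i = 1 * z i + int n * y i" for i
      using N0 N by (auto simp: z_def y_def)
    then have eq: "x = (\<lambda>i. 1 * z i + int n * y i)" by blast
    have "(\<lambda>i. int n * y i) = (\<lambda>i. 1 * x i + (- 1) * z i)" using eq by (simp add: fun_eq_iff)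
    then have "(\<lambda>i. int n * y i) \<in> H1"
      using lincomb_closedD[OF lincomb_closed_H1 x finsupp_H1[OF z], of 1 "- 1"] by simp
    then have y: "y \<in> H1" using divide_H1 n by simp
    have "\<phi> x = 1 * \<phi> z + int n * \<phi> y"
      by (subst eq) (rule additive_lincomb[OF lincomb_closed_H1 add finsupp_H1[OF z] y])
    moreover have "\<phi> z = dot z (\<lambda>i. \<phi> (unit_vector i))"
      by (rule additive_on_finsupp_dot[OF lincomb_closed_H1 add unit_vector_H1 z])
    moreover have "\<dots> = psum z (\<lambda>i. \<phi> (unit_vector i)) N" by (rule dot_eq_psum) (simp add: z_def)
    moreover have "\<dots> = psum x (\<lambda>i. \<phi> (unit_vector i)) N" by (simp add: psum_def z_def)
    ultimately show ?thesis by simp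
  qed
  then show "\<exists>N0. \<forall>N\<ge>N0. int n dvd psum x (\<lambda>i. \<phi> (unit_vector i)) N - \<phi> x" by blast
qed

lemma hom_representative:
  assumes "additive_on H1 \<phi>"
  shows "(\<lambda>i. \<phi> (unit_vector i)) \<in> H2"
proof (rule max2)
  fix a assume "a \<in> H1"
  from hom_pairs[OF assms this] show "compatible a (\<lambda>i. \<phi> (unit_vector i))"
    unfolding compatible_def by blast
qed

end

lemma (in dual_pair) dual_pair_swap: "dual_pair H2 H1"
proof
  show "H2 \<subseteq> DD" "H1 \<subseteq> DD" by (rule DD2, rule DD1)
  show "compatible a b" if "a \<in> H2" "b \<in> H1" for a b using compat that compatible_commute by blast
  show "a \<in> H2" if "\<And>b. b \<in> H1 \<Longrightarrow> compatible a b" for a using max2 that compatible_commute by blast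
  show "b \<in> H1" if "\<And>a. a \<in> H2 \<Longrightarrow> compatible a b" for b using max1 that compatible_commute by blast
qed

locale rigid_pair = dual_pair +
  assumes rigid: "range M \<subseteq> H1 \<Longrightarrow> range (column M) \<subseteq> H2 \<Longrightarrow> (\<And>x. x \<in> H1 \<Longrightarrow> transform M x \<in> H1) \<Longrightarrow>
    scalar_mod_finite M H1 H2"

lemma pairing_commute: "pairing a b = pairing b a"
  by (simp add: pairing_def pairs_commute)

lemma pairing_unit_vector: "pairing (unit_vector i) b = b i"
  using pairing_eq[OF pairs_dot[OF unit_vector_finsupp[OF le0]], of i b] by simp

lemma column_column: "column (column M) = M"
  by (simp add: column_def fun_eq_iff)

text \<open>The hypothesis for the swapped pair follows by passing to the adjoint of a matrix.\<close>
lemma (in rigid_pair) rigid_pair_swap: "rigid_pair H2 H1"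
proof -
  interpret swap: dual_pair H2 H1 by (rule dual_pair_swap)
  show ?thesis
  proof
    fix M assume rows: "range M \<subseteq> H2" and cols: "range (column M) \<subseteq> H1"
      and tr: "\<And>y. y \<in> H2 \<Longrightarrow> transform M y \<in> H2"
    have tr': "transform (column M) x \<in> H1" if x: "x \<in> H1" for x
    proof (rule swap.max2)
      fix y assume y: "y \<in> H2"
      have "additive_on H2 (\<lambda>y. pairing (transform M y) x)"
        unfolding additive_on_def
      proof (intro ballI)
        fix y y' assume yy: "y \<in> H2" "y' \<in> H2"
        have "transform M (\<lambda>i. y i + y' i) m = transform M y m + transform M y' m" for m
        proof -
          have "column M m \<in> H1" using cols by blast
          from swap.additive_pairing[OF this] show ?thesis
            using yy by (simp add: transform_def additive_on_def)
        qed
        then have "transform M (\<lambda>i. y i + y' i) = (\<lambda>i. transform M y i + transform M y' i)" by blast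
        then show "pairing (transform M (\<lambda>i. y i + y' i)) x = pairing (transform M y) x + pairing (transform M y') x"
          using swap.additive_pairing[OF x] tr yy by (simp add: additive_on_def)
      qed
      \<comment> \<open>The functional taking \<open>y\<close> to
        \<open>pairing (transform M y) x\<close> is represented by its values on the unit vectors,
        and these are the entries of \<open>transform (column M) x\<close>.\<close>
      from swap.hom_pairs[OF this y] have "compatible y (\<lambda>i. pairing (transform M (unit_vector i)) x)"
        unfolding compatible_def by blast
      moreover have "transform M (unit_vector i) = M i" for i
        by (simp add: transform_def pairing_unit_vector column_def)
      ultimately show "compatible y (transform (column M) x)"
        by (simp add: transform_def column_column pairing_commute)
    qed
    have "scalar_mod_finite (column M) H1 H2"
      using rows cols tr' by (intro rigid) (simp_all add: column_column)
    then obtain b c n u v where *: "b \<noteq> 0" "finite u" "u \<subseteq> H1" "finite v" "v \<subseteq> H2"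
      "\<forall>z\<in>orth n v. \<forall>w\<in>orth n u. b * matrix_form (column M) z w = c * dot z w"
      unfolding scalar_mod_finite_def by blast
    have **: "b * matrix_form M w z = c * dot w z" if "w \<in> orth n u" "z \<in> orth n v" for w z
      using *(6) that matrix_form_transpose[of M w z] dot_commute[of w n z n] by (simp add: orth_def)
    show "scalar_mod_finite M H2 H1"
      unfolding scalar_mod_finite_def
      by (rule exI[of _ b], rule exI[of _ c], rule exI[of _ n], rule exI[of _ v], rule exI[of _ u])
        (intro conjI ballI * **)
  qed
qed

text \<open>The groups have infinite rank: some nontrivial combination of the first
  \<open>card G + 1\<close> unit vectors is killed by \<open>G\<close>. This keeps scalars apart
  from maps of finite rank.\<close>

lemma (in dual_pair) kernel_vector:
  assumes G: "finite G" "\<And>g. g \<in> G \<Longrightarrow> additive_on H1 g"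
  shows "\<exists>z\<in>H1. (\<exists>i. z i \<noteq> 0) \<and> (\<forall>g\<in>G. g z = 0)"
proof -
  let ?J = "{..card G}"
  obtain c where c: "\<exists>j\<in>?J. c j \<noteq> 0" "\<forall>g\<in>G. (\<Sum>j\<in>?J. c j * g (unit_vector j)) = 0"
    using nonzero_solution[OF G(1), of ?J "\<lambda>g j. g (unit_vector j)"] by auto
  define z where "z i = (\<Sum>j\<in>?J. c j * unit_vector j i)" for i
  have "z \<in> H1"
    unfolding z_def using lincomb_closed_sum[OF lincomb_closed_H1, of ?J unit_vector c] unit_vector_H1 by simp
  moreover have "g z = 0" if "g \<in> G" for g
    unfolding z_def using additive_sum[OF lincomb_closed_H1 G(2)[OF that], of ?J unit_vector c] unit_vector_H1 c(2) that by simp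
  moreover have zc: "z j = c j" if "j \<in> ?J" for j
  proof -
    have "z j = (\<Sum>i\<in>?J. if i = j then c j else 0)"
      unfolding z_def by (intro sum.cong) (auto simp: unit_vector_def)
    then show ?thesis using that by (simp add: sum.delta)
  qed
  moreover have "\<exists>j. z j \<noteq> 0" using c(1) zc by metis
  ultimately show ?thesis by (intro bexI[of _ z]) simp_all
qed

context rigid_pair
begin

text \<open>Rigidity controls only the form on finitely supported vectors. Two applications of
  \<open>in_span_if_kernel\<close> extend this to \<open>H1\<close>. For \<open>w\<close> in
  \<open>orth n u\<close> the functional taking \<open>x\<close> to \<open>dot w (\<phi> x)\<close>
  depends on \<open>v\<close> beyond \<open>n\<close>, so it vanishes once \<open>x\<close> is
  killed by \<open>v\<close> and by the first \<open>n\<close> coordinates; and then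
  \<open>\<phi> x\<close> itself depends on \<open>u\<close> beyond \<open>n\<close>. Hence
  \<open>\<phi> = b f - c\<close> has finite rank.\<close>

lemma rigid_endomorphism:
  assumes f: "\<And>x. x \<in> H1 \<Longrightarrow> f x \<in> H1" and add: "\<And>m. additive_on H1 (\<lambda>x. f x m)"
  shows "\<exists>s E. finite E \<and> (\<forall>x\<in>H1. (\<forall>i\<in>E. f x i = s * x i) \<longrightarrow> (\<forall>i. f x i = s * x i))"
proof -
  note lc = lincomb_closed_H1
  define M where "M i = f (unit_vector i)" for i
  have col: "column M m = (\<lambda>i. f (unit_vector i) m)" for m by (simp add: column_def M_def)
  have cols: "column M m \<in> H2" for m unfolding col by (rule hom_representative[OF add])
  have tr: "transform M x = f x" if "x \<in> H1" for x
    unfolding transform_def col using pairing_eq[OF hom_pairs[OF add that]] by simp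
  have "scalar_mod_finite M H1 H2"
    by (rule rigid) (use cols tr f unit_vector_H1 in \<open>auto simp: M_def\<close>)
  then obtain b c n u v where b: "b \<noteq> 0" and u: "finite u" "u \<subseteq> H1" and v: "finite v" "v \<subseteq> H2"
    and scal: "\<And>z w. z \<in> orth n v \<Longrightarrow> w \<in> orth n u \<Longrightarrow> b * matrix_form M z w = c * dot z w"
    unfolding scalar_mod_finite_def by blast
  define \<phi> where "\<phi> x = (\<lambda>i. b * f x i + (- c) * x i)" for x
  have \<phi>_add: "additive_on H1 (\<lambda>x. \<phi> x i)" for i
    using add[of i] unfolding additive_on_def \<phi>_def by (simp add: algebra_simps)
  have dot_zero: "dot w (\<phi> x) = 0"
    if w: "w \<in> orth n u" and x: "x \<in> H1" "\<forall>h\<in>v. pairing x h = 0" "\<forall>i<n. x i = 0" for w x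
  proof -
    define \<psi> where "\<psi> x = dot w (\<phi> x)" for x
    have \<psi>: "additive_on H1 \<psi>"
      unfolding additive_on_def
    proof (intro ballI)
      fix x y assume "x \<in> H1" "y \<in> H1"
      then have "\<phi> (\<lambda>i. x i + y i) = (\<lambda>i. 1 * \<phi> x i + 1 * \<phi> y i)"
        using \<phi>_add unfolding additive_on_def by auto
      then show "\<psi> (\<lambda>i. x i + y i) = \<psi> x + \<psi> y"
        using dot_lincomb_right[of w 1 "\<phi> x" 1 "\<phi> y"] by (simp add: \<psi>_def)
    qed
    define g where "g i = \<psi> (unit_vector i)" for i
    have "dot z g = 0" if z: "z \<in> finsupp n" "\<forall>h\<in>v. dot z h = 0" for z
    proof -
      have z1: "z \<in> H1" by (rule finsupp_H1[OF z(1)])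
      have zo: "z \<in> orth n v" using z by (simp add: orth_def)
      have wf: "w \<in> finsupp n" using w by (simp add: orth_def)
      have "f z = (\<lambda>i. dot z (column M i))"
        unfolding col using additive_on_finsupp_dot[OF lc add unit_vector_H1 z(1)] by blast
      then have "dot w (f z) = matrix_form M z w"
        unfolding matrix_form_transpose[of M] unfolding matrix_form_def by simp
      then have "\<psi> z = b * matrix_form M z w + (- c) * dot z w"
        unfolding \<psi>_def \<phi>_def dot_lincomb_right using dot_commute[OF wf z(1)] by simp
      also have "\<dots> = 0" using scal[OF zo w] by simp
      finally show ?thesis
        using additive_on_finsupp_dot[OF lc \<psi> unit_vector_H1 z(1)] by (simp add: g_def[abs_def])
    qed
    then obtain q k where q: "q \<noteq> 0" and qk: "\<forall>i\<ge>n. q * g i = (\<Sum>h\<in>v. k h * h i)"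
      using in_span_if_kernel[OF v(1), of n g] by blast
    \<comment> \<open>\<open>t\<close> repairs the first \<open>n\<close> coordinates. It
      contributes nothing to the product with \<open>x\<close>, which vanishes there.\<close>
    define t where "t i = (if i < n then q * g i - (\<Sum>h\<in>v. k h * h i) else 0)" for i
    have t: "t \<in> finsupp 0"
      using finite_subset[of "{i. t i \<noteq> 0}" "{..<n}"] by (auto simp: finsupp_def t_def)
    have qg: "(\<lambda>i. q * g i + 0 * g i) = (\<lambda>i. 1 * (\<Sum>h\<in>v. k h * h i) + 1 * t i)"
      using qk by (auto simp: t_def fun_eq_iff)
    have "pairs x g (\<psi> x)" unfolding g_def by (rule hom_pairs[OF \<psi> x(1)])
    then have gx: "pairs g x (\<psi> x)" by (simp add: pairs_commute)
    have "pairs h x 0" if "h \<in> v" for h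
      using pairs_H[OF x(1), of h] v x(2) that by (auto simp: pairs_commute)
    then have "pairs (\<lambda>i. \<Sum>h\<in>v. k h * h i) x (\<Sum>h\<in>v. k h * 0)" by (intro pairs_sum v(1))
    from pairs_lincomb[OF this pairs_dot[OF t], of 1 1] pairs_lincomb[OF gx gx, of q 0]
    have "q * \<psi> x + 0 * \<psi> x = 1 * (\<Sum>h\<in>v. k h * 0) + 1 * dot t x"
      unfolding qg by (rule pairs_unique[rotated])
    moreover have "dot t x = 0"
      unfolding dot_def using x(3) by (intro sum.neutral) (auto simp: t_def split: if_splits)
    ultimately show ?thesis using q by (simp add: \<psi>_def)
  qed
  \<comment> \<open>Vectors that depend on \<open>u\<close> beyond \<open>n\<close> have bounded
    rank, so finitely many coordinates decide whether they vanish. With these coordinates of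
    \<open>\<phi> x\<close> among the functionals in \<open>G\<close>, the common kernel of
    \<open>G\<close> is killed by \<open>\<phi>\<close>.\<close>
  obtain E0 where E0: "finite E0" and
    E0': "\<forall>y\<in>{y. \<exists>q k. q \<noteq> 0 \<and> (\<forall>i\<ge>n. q * y i = (\<Sum>h\<in>u. k h * h i))}.
        (\<forall>i\<in>E0. y i = 0) \<longrightarrow> (\<forall>i. y i = 0)"
    using determining_coordinates[OF dependent_families_almost_span[OF u(1), of n]] by blast
  define G where "G = (\<lambda>h x. pairing x h) ` v \<union> (\<lambda>i x. x i) ` {..<n} \<union> (\<lambda>i x. \<phi> x i) ` E0"
  have "dependent_families (Suc (card G)) (\<phi> ` H1)"
  proof (rule dependent_families_kernel[OF lc \<phi>_add])
    show "finite G" using v E0 by (simp add: G_def)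
    show "additive_on H1 g" if "g \<in> G" for g
      using that additive_pairing v \<phi>_add by (auto simp: G_def) (auto simp: additive_on_def)
    show "\<forall>i. \<phi> x i = 0" if x: "x \<in> H1" "\<forall>g\<in>G. g x = 0" for x
    proof -
      have "\<forall>h\<in>v. pairing x h = 0" "\<forall>i<n. x i = 0" "\<forall>i\<in>E0. \<phi> x i = 0"
        using x(2) by (auto simp: G_def)
      then have z: "dot w (\<phi> x) = 0" if "w \<in> orth n u" for w using dot_zero[OF that x(1)] by simp
      have "\<exists>q k. q \<noteq> 0 \<and> (\<forall>i\<ge>n. q * \<phi> x i = (\<Sum>h\<in>u. k h * h i))"
        by (rule in_span_if_kernel[OF u(1)], rule z) (simp add: orth_def)
      then show ?thesis using E0' \<open>\<forall>i\<in>E0. \<phi> x i = 0\<close> by blast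
    qed
  qed
  from determining_coordinates[OF this]
  obtain E where E: "finite E" "\<forall>y\<in>\<phi> ` H1. (\<forall>i\<in>E. y i = 0) \<longrightarrow> (\<forall>i. y i = 0)"
    by (elim exE conjE)
  \<comment> \<open>Take a nonzero vector killed by \<open>\<phi>\<close> and divide it by the gcd
    of its entries. On the resulting primitive vector \<open>f\<close> is multiplication by
    \<open>c / b\<close>, and since the values are integers, \<open>b\<close> divides
    \<open>c\<close>.\<close>
  have "b dvd c"
  proof -
    have "\<exists>z\<in>H1. (\<exists>i. z i \<noteq> 0) \<and> (\<forall>g\<in>(\<lambda>i x. \<phi> x i) ` E. g z = 0)"
      by (rule kernel_vector) (use E(1) \<phi>_add in auto)
    then obtain z j where z: "z \<in> H1" "z j \<noteq> 0" "\<forall>i\<in>E. \<phi> z i = 0" by auto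
    then have \<phi>0: "\<phi> z i = 0" for i using E(2) by blast
    define d where "d = Gcd (range z)"
    have d: "d \<noteq> 0" using z(2) by (auto simp: d_def Gcd_0_iff)
    define z' where "z' i = z i div d" for i
    have zd: "z = (\<lambda>i. d * z' i)" by (simp add: z'_def d_def Gcd_dvd)
    then have z': "z' \<in> H1" using divide_H1[of d z'] z(1) d by simp
    have "c * z i = (b * d) * f z' i" for i
      using \<phi>0[of i] additive_scale[OF lc add[of i] z', of d] by (simp add: \<phi>_def flip: zd)
    then have "b * d dvd c * z i" for i by simp
    then have "b * d dvd Gcd ((*) c ` range z)" by (intro Gcd_greatest) auto
    then have "b * d dvd c * d" by (simp add: Gcd_mult d_def)
    then show ?thesis using d by simp
  qed
  then obtain s where s: "c = b * s" by (elim dvdE)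
  have "\<phi> x i = b * (f x i - s * x i)" for x i by (simp add: \<phi>_def s algebra_simps)
  then have "\<phi> x i = 0 \<longleftrightarrow> f x i = s * x i" for x i using b by simp
  then show ?thesis using E by (intro exI[of _ s] exI[of _ E]) auto
qed

end

section \<open>Subgroups of the Baer-Specker group\<close>

abbreviation bs_subgroup :: "(nat \<Rightarrow> int) set \<Rightarrow> (nat \<Rightarrow> int) monoid" where
  "bs_subgroup H \<equiv> baer_specker\<lparr>carrier := H\<rparr>"

lemma mult_bs [simp]: "x \<otimes>\<^bsub>bs_subgroup H\<^esub> y = (\<lambda>i. x i + y i)"
  by (simp add: product_group_def restrict_def)

lemma one_bs [simp]: "\<one>\<^bsub>bs_subgroup H\<^esub> = (\<lambda>i. 0)"
  by (simp add: product_group_def restrict_def)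

lemma group_baer_specker: "group baer_specker"
  by simp

lemma mult_baer_specker: "x \<otimes>\<^bsub>baer_specker\<^esub> y = (\<lambda>i. x i + y i)"
  by (simp add: product_group_def restrict_def)

lemma one_baer_specker: "\<one>\<^bsub>baer_specker\<^esub> = (\<lambda>i. 0)"
  by (simp add: product_group_def restrict_def)

lemma inv_baer_specker: "inv\<^bsub>baer_specker\<^esub> x = (\<lambda>i. - x i)"
  using inv_product_group[of x UNIV "\<lambda>_. integer_group"] by (simp add: restrict_def)

lemma subgroup_iff_lincomb_closed: "subgroup H baer_specker \<longleftrightarrow> lincomb_closed H"
proof
  assume H: "subgroup H baer_specker"
  have plus: "(\<lambda>i. x i + y i) \<in> H" if "x \<in> H" "y \<in> H" for x y
    using subgroup.m_closed[OF H that] by (simp only: mult_baer_specker)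
  have minus: "(\<lambda>i. - x i) \<in> H" if "x \<in> H" for x
    using subgroup.m_inv_closed[OF H that] by (simp only: inv_baer_specker)
  have zero: "(\<lambda>i. 0) \<in> H" using subgroup.one_closed[OF H] by (simp only: one_baer_specker)
  have nat: "(\<lambda>i. int n * x i) \<in> H" if x: "x \<in> H" for x n
  proof (induction n)
    case (Suc n)
    from plus[OF this x] show ?case by (simp add: algebra_simps)
  qed (simp add: zero)
  have scale: "(\<lambda>i. p * x i) \<in> H" if x: "x \<in> H" for x p
  proof (cases "p \<ge> 0")
    case True
    then show ?thesis using nat[OF x, of "nat p"] by simp
  next
    case False
    then show ?thesis using minus[OF nat[OF x, of "nat (- p)"]] by simp
  qed
  show "lincomb_closed H"
    unfolding lincomb_closed_def
  proof (intro conjI ballI allI)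
    show "H \<noteq> {}" using zero by blast
    show "(\<lambda>i. p * x i + q * y i) \<in> H" if "x \<in> H" "y \<in> H" for x y p q
      by (rule plus[OF scale scale, OF that])
  qed
next
  assume H: "lincomb_closed H"
  show "subgroup H baer_specker"
  proof
    show "H \<subseteq> carrier baer_specker" by simp
    show "x \<otimes>\<^bsub>baer_specker\<^esub> y \<in> H" if "x \<in> H" "y \<in> H" for x y
      using lincomb_closedD[OF H that, of 1 1] by (simp only: mult_baer_specker mult_1)
    show "\<one>\<^bsub>baer_specker\<^esub> \<in> H" using lincomb_closed_zero[OF H] by (simp only: one_baer_specker)
    show "inv\<^bsub>baer_specker\<^esub> x \<in> H" if "x \<in> H" for x
      using lincomb_closed_scale[OF H that, of "- 1"] by (simp add: inv_baer_specker)
  qed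
qed

lemma group_bs: "lincomb_closed H \<Longrightarrow> group (bs_subgroup H)"
  by (rule subgroup.subgroup_is_group[OF _ group_baer_specker]) (simp only: subgroup_iff_lincomb_closed)

lemma comm_group_bs: "lincomb_closed H \<Longrightarrow> comm_group (bs_subgroup H)"
  by (rule group.group_comm_groupI[OF group_bs]) (simp_all only: mult_bs add.commute)

lemma nat_pow_bs [simp]: "x [^]\<^bsub>bs_subgroup H\<^esub> (n :: nat) = (\<lambda>i. int n * x i)"
proof (induction n)
  case (Suc n)
  have "x [^]\<^bsub>bs_subgroup H\<^esub> Suc n = x [^]\<^bsub>bs_subgroup H\<^esub> n \<otimes>\<^bsub>bs_subgroup H\<^esub> x"
    by (simp add: nat_pow_def)
  then show ?case unfolding Suc mult_bs by (simp add: algebra_simps)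
qed (simp add: nat_pow_def product_group_def restrict_def)

lemma int_pow_bs:
  assumes "lincomb_closed H" "x \<in> H"
  shows "x [^]\<^bsub>bs_subgroup H\<^esub> (n :: int) = (\<lambda>i. n * x i)"
proof -
  have inv: "inv\<^bsub>bs_subgroup H\<^esub> y = (\<lambda>i. - y i)" if "y \<in> H" for y
    using group.m_inv_consistent[OF group_baer_specker, of H y] subgroup_iff_lincomb_closed assms(1) that
      inv_baer_specker by simp
  show ?thesis
  proof (cases "n < 0")
    case True
    have "inv\<^bsub>bs_subgroup H\<^esub> (\<lambda>i. int (nat (- n)) * x i) = (\<lambda>i. - (int (nat (- n)) * x i))"
      by (rule inv[OF lincomb_closed_scale[OF assms]])
    then show ?thesis using True by (simp add: int_pow_def2)
  qed (simp add: int_pow_def2)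
qed

section \<open>Rank of subgroups in terms of sequences\<close>

lemma finprod_bs:
  assumes H: "lincomb_closed H" and F: "finite F" "F \<subseteq> H"
  shows "finprod (bs_subgroup H) (\<lambda>b. b [^]\<^bsub>bs_subgroup H\<^esub> (c b :: int)) F = (\<lambda>i. \<Sum>b\<in>F. c b * b i)"
  using F
proof (induction F rule: finite_induct)
  case empty
  interpret comm_group "bs_subgroup H" by (rule comm_group_bs[OF H])
  show ?case by (simp only: finprod_empty one_bs sum.empty)
next
  case (insert b F)
  interpret comm_group "bs_subgroup H" by (rule comm_group_bs[OF H])
  have mem: "(\<lambda>b. b [^]\<^bsub>bs_subgroup H\<^esub> c b) \<in> F \<rightarrow> carrier (bs_subgroup H)" "b [^]\<^bsub>bs_subgroup H\<^esub> c b \<in> carrier (bs_subgroup H)"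
    using insert.prems int_pow_bs[OF H] lincomb_closed_scale[OF H] by auto
  have "finprod (bs_subgroup H) (\<lambda>b. b [^]\<^bsub>bs_subgroup H\<^esub> c b) (insert b F) =
      b [^]\<^bsub>bs_subgroup H\<^esub> c b \<otimes>\<^bsub>bs_subgroup H\<^esub> finprod (bs_subgroup H) (\<lambda>b. b [^]\<^bsub>bs_subgroup H\<^esub> c b) F"
    by (rule finprod_insert) (use insert.hyps mem in auto)
  then show ?case using insert int_pow_bs[OF H, of b] by simp
qed

text \<open>Translates between independent sets in the group and families of sequences. A family
  with a repeated vector is dependent for a trivial reason and is treated separately.\<close>

lemma finite_rank_iff_dependent:
  assumes A: "lincomb_closed A"
  shows "finite_rank (bs_subgroup A) \<longleftrightarrow> (\<exists>r. dependent_families r A)"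
proof
  assume "finite_rank (bs_subgroup A)"
  then obtain r where r: "\<And>B. independent_in (bs_subgroup A) B \<Longrightarrow> finite B \<and> card B \<le> r"
    unfolding finite_rank_def by blast
  have "dependent_families (Suc r) A"
    unfolding dependent_families_def
  proof (intro allI impI)
    fix y :: "nat \<Rightarrow> nat \<Rightarrow> int" assume y: "\<forall>j<Suc r. y j \<in> A"
    show "\<exists>c. (\<exists>j<Suc r. c j \<noteq> 0) \<and> (\<forall>i. (\<Sum>j<Suc r. c j * y j i) = 0)"
    proof (cases "inj_on y {..<Suc r}")
      case False
      then obtain j k where jk: "j < Suc r" "k < Suc r" "j \<noteq> k" "y j = y k" by (auto simp: inj_on_def)
      define c :: "nat \<Rightarrow> int" where "c l = (if l = j then 1 else if l = k then - 1 else 0)" for l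
      have "(\<Sum>l<Suc r. c l * y l i) = (\<Sum>l\<in>{j, k}. c l * y l i)" for i
        by (rule sum.mono_neutral_right) (use jk in \<open>auto simp: c_def\<close>)
      then have "(\<Sum>l<Suc r. c l * y l i) = 0" for i using jk by (simp add: c_def)
      moreover have "c j \<noteq> 0" by (simp add: c_def)
      ultimately show ?thesis using jk(1) by (intro exI[of _ c]) blast
    next
      case True
      let ?B = "y ` {..<Suc r}"
      have "card ?B = Suc r" using True by (simp add: card_image)
      then have "\<not> independent_in (bs_subgroup A) ?B" using r[of ?B] by auto
      moreover have "?B \<subseteq> A" using y by auto
      ultimately obtain F c where F: "finite F" "F \<subseteq> ?B" "(\<lambda>i. \<Sum>b\<in>F. c b * b i) = (\<lambda>i. 0)" "\<not> (\<forall>b\<in>F. c b = 0)"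
        unfolding independent_in_def using finprod_bs[OF A] by fastforce
      then obtain b where b: "b \<in> F" "c b \<noteq> 0" by blast
      obtain J where J: "J \<subseteq> {..<Suc r}" "F = y ` J" using F(2) subset_image_iff by metis
      define d where "d j = (if j \<in> J then c (y j) else 0)" for j
      have "(\<Sum>j<Suc r. d j * y j i) = 0" for i
      proof -
        have "(\<Sum>j<Suc r. d j * y j i) = (\<Sum>j\<in>J. c (y j) * y j i)"
          by (rule sum.mono_neutral_cong_right) (use J in \<open>auto simp: d_def\<close>)
        also have "\<dots> = (\<Sum>b\<in>F. c b * b i)"
          unfolding J(2) using inj_on_subset[OF True J(1)] by (simp add: sum.reindex)
        finally show ?thesis using F(3) by (simp add: fun_eq_iff)
      qed
      moreover have "\<exists>j<Suc r. d j \<noteq> 0" using b J by (auto simp: d_def)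
      ultimately show ?thesis by (intro exI[of _ d] conjI allI)
    qed
  qed
  then show "\<exists>r. dependent_families r A" ..
next
  assume "\<exists>r. dependent_families r A"
  then obtain r where r: "dependent_families r A" ..
  have bound: "card F < r" if ind: "independent_in (bs_subgroup A) B" and F: "finite F" "F \<subseteq> B" for B F
  proof (rule ccontr)
    assume "\<not> card F < r"
    then obtain F' where F': "F' \<subseteq> F" "card F' = r" "finite F'" using obtain_subset_with_card_n by (metis not_less)
    then obtain y where y: "bij_betw y {..<r} F'" using ex_bij_betw_nat_finite lessThan_atLeast0 by metis
    have B: "B \<subseteq> A" using ind by (simp add: independent_in_def)
    then have "\<forall>j<r. y j \<in> A" using bij_betw_apply[OF y] F' F by blast
    from r[unfolded dependent_families_def, THEN spec, THEN mp, OF this]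
    obtain c where "(\<exists>j<r. c j \<noteq> 0) \<and> (\<forall>i. (\<Sum>j<r. c j * y j i) = 0)" ..
    then have c: "\<exists>j<r. c j \<noteq> 0" "\<forall>i. (\<Sum>j<r. c j * y j i) = 0" by (simp_all only: simp_thms)
    define d where "d b = c (the_inv_into {..<r} y b)" for b
    have dy: "d (y j) = c j" if "j < r" for j
      unfolding d_def using the_inv_into_f_f[OF bij_betw_imp_inj_on[OF y]] that by simp
    have "(\<Sum>b\<in>F'. d b * b i) = 0" for i
    proof -
      have "(\<Sum>b\<in>F'. d b * b i) = (\<Sum>j<r. d (y j) * y j i)" by (rule sum.reindex_bij_betw[OF y, symmetric])
      then show ?thesis using c(2) dy by simp
    qed
    moreover have "F' \<subseteq> A" "F' \<subseteq> B" using B F' F by auto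
    ultimately have "finprod (bs_subgroup A) (\<lambda>b. b [^]\<^bsub>bs_subgroup A\<^esub> d b) F' = \<one>\<^bsub>bs_subgroup A\<^esub>"
      using finprod_bs[OF A F'(3), of d] by simp
    then have "\<forall>b\<in>F'. d b = 0" using ind F'(3) \<open>F' \<subseteq> B\<close> unfolding independent_in_def by blast
    then have "\<forall>j<r. c j = 0" using dy bij_betw_apply[OF y] by force
    then show False using c(1) by blast
  qed
  have "finite B \<and> card B \<le> r" if ind: "independent_in (bs_subgroup A) B" for B
  proof -
    have "finite B"
    proof (rule ccontr)
      assume "infinite B"
      then obtain F where "F \<subseteq> B" "finite F" "card F = r" using infinite_arbitrarily_large by blast
      then show False using bound[OF ind] by blast
    qed
    then show ?thesis using bound[OF ind] by (simp add: less_imp_le)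
  qed
  then show "finite_rank (bs_subgroup A)" unfolding finite_rank_def by blast
qed

text \<open>For a subgroup the condition says that restriction to the coordinates in
  \<open>E\<close> is injective, which bounds the rank by \<open>card E\<close>.\<close>

lemma finite_rank_iff_coordinates:
  assumes A: "lincomb_closed A"
  shows "finite_rank (bs_subgroup A) \<longleftrightarrow>
    (\<exists>E. finite E \<and> (\<forall>y\<in>A. (\<forall>i\<in>E. y i = 0) \<longrightarrow> (\<forall>i. y i = 0)))"
proof
  assume "finite_rank (bs_subgroup A)"
  then obtain r where "dependent_families r A" using finite_rank_iff_dependent[OF A] by blast
  then show "\<exists>E. finite E \<and> (\<forall>y\<in>A. (\<forall>i\<in>E. y i = 0) \<longrightarrow> (\<forall>i. y i = 0))"
    by (rule determining_coordinates)
next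
  assume "\<exists>E. finite E \<and> (\<forall>y\<in>A. (\<forall>i\<in>E. y i = 0) \<longrightarrow> (\<forall>i. y i = 0))"
  then obtain E where E: "finite E" "\<forall>y\<in>A. (\<forall>i\<in>E. y i = 0) \<longrightarrow> (\<forall>i. y i = 0)" by blast
  have "dependent_families (Suc (card E)) A"
    unfolding dependent_families_def
  proof (intro allI impI)
    let ?r = "Suc (card E)"
    fix y assume y: "\<forall>j<?r. y j \<in> A"
    obtain c where c: "\<exists>j\<in>{..<?r}. c j \<noteq> 0" "\<forall>i\<in>E. (\<Sum>j<?r. c j * y j i) = 0"
      using nonzero_solution[OF E(1), of "{..<?r}" "\<lambda>i j. y j i"] by auto
    have "(\<lambda>i. \<Sum>j<?r. c j * y j i) \<in> A" by (rule lincomb_closed_sum[OF A]) (use y in auto)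
    from bspec[OF E(2) this] have "\<forall>i. (\<Sum>j<?r. c j * y j i) = 0" using c(2) by simp
    then show "\<exists>c. (\<exists>j<?r. c j \<noteq> 0) \<and> (\<forall>i. (\<Sum>j<?r. c j * y j i) = 0)"
      using c(1) by (intro exI[of _ c] conjI) auto
  qed
  then show "finite_rank (bs_subgroup A)" using finite_rank_iff_dependent[OF A] by blast
qed

section \<open>Homomorphisms from the Baer-Specker group to the integers\<close>

text \<open>A homomorphism that is nonzero on infinitely many unit vectors would be injective on an
  uncountable set of vectors with rapidly divisible coordinates.\<close>
theorem finite_nonzero_unit_vectors:
  assumes add: "additive_on UNIV \<phi>"
  shows "finite {n. \<phi> (unit_vector n) \<noteq> 0}"
proof (rule ccontr)
  assume inf: "infinite {n. \<phi> (unit_vector n) \<noteq> 0}" (is "infinite ?A")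
  have lc: "lincomb_closed UNIV" by (simp add: lincomb_closed_def)
  \<comment> \<open>The quotient of successive terms exceeds the absolute value of
    \<open>\<phi> (unit_vector n)\<close>. If \<open>X\<close> and \<open>Y\<close> first differ at
    \<open>n\<close>, equal values would make \<open>\<phi> (unit_vector n)\<close> a multiple of a
    number larger than its absolute value.\<close>
  define d where "d n = (\<Prod>i<n. \<bar>\<phi> (unit_vector i)\<bar> + 1)" for n
  have d0: "d n \<noteq> 0" for n by (auto simp: d_def)
  have dS: "d (Suc n) = d n * (\<bar>\<phi> (unit_vector n)\<bar> + 1)" for n by (simp add: d_def)
  have ddvd: "d n dvd d m" if "n \<le> m" for n m
    unfolding d_def using that by (intro prod_dvd_prod_subset) auto
  define v where "v X i = (if i \<in> X then d i else 0)" for X i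
  have neq: "\<phi> (v X) \<noteq> \<phi> (v Y)" if XY: "n \<in> X" "n \<notin> Y" "\<And>i. i < n \<Longrightarrow> i \<in> X \<longleftrightarrow> i \<in> Y" and n: "n \<in> ?A" for X Y n
  proof
    assume eq: "\<phi> (v X) = \<phi> (v Y)"
    define y where "y i = (if i \<le> n then 0 else (v X i - v Y i) div d (Suc n))" for i
    have "v X i + (- 1) * v Y i = d n * unit_vector n i + d (Suc n) * y i" for i
    proof (cases "i \<le> n")
      case True
      then show ?thesis using XY by (auto simp: v_def y_def unit_vector_def le_less)
    next
      case False
      then have "d (Suc n) dvd d i" by (intro ddvd) auto
      then have "d (Suc n) dvd v X i - v Y i" by (simp add: v_def)
      then show ?thesis using False by (simp add: y_def unit_vector_def)
    qed
    then have "(\<lambda>i. 1 * v X i + (- 1) * v Y i) = (\<lambda>i. d n * unit_vector n i + d (Suc n) * y i)" by simp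
    then have "1 * \<phi> (v X) + (- 1) * \<phi> (v Y) = d n * \<phi> (unit_vector n) + d (Suc n) * \<phi> y"
      using additive_lincomb[OF lc add, of "v X" "v Y" 1 "- 1"] additive_lincomb[OF lc add, of "unit_vector n" y]
      by simp
    then have "d n * (\<phi> (unit_vector n) + (\<bar>\<phi> (unit_vector n)\<bar> + 1) * \<phi> y) = 0"
      using eq by (simp add: dS algebra_simps)
    then have "\<phi> (unit_vector n) = (\<bar>\<phi> (unit_vector n)\<bar> + 1) * (- \<phi> y)" using d0 by simp
    then have "\<bar>\<phi> (unit_vector n)\<bar> + 1 dvd \<phi> (unit_vector n)" by (rule dvdI)
    then show False using n not_dvd_larger[of "\<phi> (unit_vector n)" 1] by simp
  qed
  have "inj_on (\<lambda>X. \<phi> (v X)) (Pow ?A)"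
  proof (rule inj_onI, rule ccontr)
    fix X Y assume XY: "X \<in> Pow ?A" "Y \<in> Pow ?A" "\<phi> (v X) = \<phi> (v Y)" "X \<noteq> Y"
    define n where "n = (LEAST n. (n \<in> X) \<noteq> (n \<in> Y))"
    have "\<exists>n. (n \<in> X) \<noteq> (n \<in> Y)" using XY(4) by blast
    then have n: "(n \<in> X) \<noteq> (n \<in> Y)" unfolding n_def by (rule LeastI_ex)
    have less: "(i \<in> X) = (i \<in> Y)" if "i < n" for i using not_less_Least[OF that[unfolded n_def]] by blast
    have "n \<in> ?A" using n XY by blast
    then show False using neq[of n X Y] neq[of n Y X] n less XY(3) by metis
  qed
  then have "countable (Pow ?A)" by (rule countableI')
  then have "Pow ?A \<lesssim> (UNIV :: nat set)" unfolding countable_def lepoll_def by auto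
  also have "(UNIV :: nat set) \<lesssim> ?A" using inf by (simp add: infinite_le_lepoll)
  finally have "?A \<approx> Pow ?A" by (rule lepoll_antisym[OF lepoll_Pow_self])
  then show False using lesspoll_Pow_self[of ?A] by (simp add: lesspoll_def)
qed

section \<open>Countable subgroups are free\<close>

lemma dot_sum_right: "dot z (\<lambda>i. \<Sum>v\<in>V. c v * v i) = (\<Sum>v\<in>V. c v * dot z v)"
proof -
  have "dot z (\<lambda>i. \<Sum>v\<in>V. c v * v i) = (\<Sum>i | z i \<noteq> 0. \<Sum>v\<in>V. c v * (z i * v i))"
    by (simp add: dot_def sum_distrib_left mult.left_commute)
  also have "\<dots> = (\<Sum>v\<in>V. \<Sum>i | z i \<noteq> 0. c v * (z i * v i))" by (rule sum.swap)
  finally show ?thesis by (simp add: dot_def sum_distrib_left)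
qed

text \<open>For finite \<open>V\<close> inside a subgroup \<open>K\<close>, the purification in
  \<open>K\<close> of the subgroup generated by \<open>V\<close>.\<close>

definition pure_hull :: "(nat \<Rightarrow> int) set \<Rightarrow> (nat \<Rightarrow> int) set \<Rightarrow> (nat \<Rightarrow> int) set" where
  "pure_hull K V = {x \<in> K. \<exists>q c. q \<noteq> 0 \<and> (\<forall>i. q * x i = (\<Sum>v\<in>V. c v * v i))}"

lemma pure_hullI: "x \<in> K \<Longrightarrow> q \<noteq> 0 \<Longrightarrow> (\<And>i. q * x i = (\<Sum>v\<in>V. c v * v i)) \<Longrightarrow> x \<in> pure_hull K V"
  unfolding pure_hull_def by (intro CollectI conjI exI[of _ q] exI[of _ c] allI)

lemma pure_hullE:
  assumes "x \<in> pure_hull K V"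
  obtains q c where "x \<in> K" "q \<noteq> 0" "\<forall>i. q * x i = (\<Sum>v\<in>V. c v * v i)"
  using assms unfolding pure_hull_def by (elim CollectE conjE exE)

lemma pure_hull_lincomb:
  assumes K: "lincomb_closed K" and xy: "x \<in> pure_hull K V" "y \<in> pure_hull K V"
  shows "(\<lambda>i. p * x i + r * y i) \<in> pure_hull K V"
proof -
  obtain q c where q: "q \<noteq> 0" "\<forall>i. q * x i = (\<Sum>v\<in>V. c v * v i)" using xy by (auto simp: pure_hull_def)
  obtain q' c' where q': "q' \<noteq> 0" "\<forall>i. q' * y i = (\<Sum>v\<in>V. c' v * v i)" using xy by (auto simp: pure_hull_def)
  have "(q * q') * (p * x i + r * y i) = (\<Sum>v\<in>V. (p * q' * c v + r * q * c' v) * v i)" for i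
  proof -
    have "(q * q') * (p * x i + r * y i) = p * q' * (q * x i) + r * q * (q' * y i)" by (simp add: algebra_simps)
    also have "\<dots> = (\<Sum>v\<in>V. (p * q' * c v + r * q * c' v) * v i)"
      using q q' by (simp add: sum_distrib_left sum.distrib distrib_right mult.assoc)
    finally show ?thesis .
  qed
  moreover have "(\<lambda>i. p * x i + r * y i) \<in> K" using xy by (intro lincomb_closedD[OF K]) (auto simp: pure_hull_def)
  moreover have "q * q' \<noteq> 0" using q q' by simp
  ultimately show ?thesis by (intro pure_hullI)
qed

lemma pure_hull_self:
  assumes "finite V" "v \<in> V" "v \<in> K"
  shows "v \<in> pure_hull K V"
proof -
  have "1 * v i = (\<Sum>w\<in>V. (if w = v then 1 else 0) * w i)" for i
    using assms by (simp add: if_distrib[of "\<lambda>t. t * _"] sum.delta cong: if_cong)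
  then show ?thesis by (rule pure_hullI[OF assms(3) one_neq_zero])
qed

lemma pure_hull_dot:
  assumes "x \<in> pure_hull K V" "\<forall>v\<in>V. dot z v = 0"
  shows "dot z x = 0"
proof -
  obtain q c where q: "q \<noteq> 0" "\<forall>i. q * x i = (\<Sum>v\<in>V. c v * v i)" using assms by (auto simp: pure_hull_def)
  have "q * dot z x = dot z (\<lambda>i. q * x i)" by (simp add: dot_def sum_distrib_left mult.left_commute)
  also have "\<dots> = 0" using q(2) assms(2) by (simp add: dot_sum_right)
  finally show ?thesis using q by simp
qed

text \<open>A linear functional that separates \<open>k\<close> from the pure hull of \<open>V\<close> shows that the quotient of
  successive pure hulls embeds into the integers.\<close>
lemma pure_hull_step:
  assumes K: "lincomb_closed K" and V: "finite V" "V \<subseteq> K" and k: "k \<in> K" "k \<notin> pure_hull K V"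
  shows "\<exists>b z. b \<in> pure_hull K (insert k V) \<and> dot z b \<noteq> 0 \<and> (\<forall>x\<in>pure_hull K V. dot z x = 0) \<and>
    (\<forall>x\<in>pure_hull K (insert k V). \<exists>m. (\<lambda>i. x i - m * b i) \<in> pure_hull K V)"
proof -
  let ?K = "pure_hull K (insert k V)"
  have kV: "k \<notin> V" using pure_hull_self[OF V(1), of k K] k by blast
  have "\<not> (\<exists>q c. q \<noteq> 0 \<and> (\<forall>i\<ge>0. q * k i = (\<Sum>v\<in>V. c v * v i)))"
    using k by (simp add: pure_hull_def)
  then obtain z where z: "\<forall>v\<in>V. dot z v = 0" "dot z k \<noteq> 0"
    using in_span_if_kernel[OF V(1), of 0 k] by blast
  have kK: "k \<in> ?K" using V k by (intro pure_hull_self) auto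
  \<comment> \<open>Euclid: a vector \<open>b\<close> with least nonzero absolute value of
    \<open>dot z b\<close> allows division with remainder, which leaves a vector killed by
    \<open>z\<close>.\<close>
  have "\<exists>b. (b \<in> ?K \<and> dot z b \<noteq> 0) \<and> (\<forall>y. y \<in> ?K \<and> dot z y \<noteq> 0 \<longrightarrow> nat \<bar>dot z b\<bar> \<le> nat \<bar>dot z y\<bar>)"
    by (rule ex_has_least_nat) (use kK z in blast)
  then obtain b where b: "b \<in> ?K" "dot z b \<noteq> 0"
    and least: "\<And>y. y \<in> ?K \<Longrightarrow> dot z y \<noteq> 0 \<Longrightarrow> nat \<bar>dot z b\<bar> \<le> nat \<bar>dot z y\<bar>" by blast
  have "\<exists>m. (\<lambda>i. x i - m * b i) \<in> pure_hull K V" if x: "x \<in> ?K" for x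
  proof -
    define m where "m = dot z x div dot z b"
    define y where "y i = 1 * x i + (- m) * b i" for i
    have y: "y \<in> ?K" unfolding y_def by (rule pure_hull_lincomb[OF K x b(1)])
    have "dot z y = 1 * dot z x + (- m) * dot z b" unfolding y_def by (rule dot_lincomb_right)
    then have "dot z y = dot z x mod dot z b" by (simp add: m_def minus_div_mult_eq_mod)
    then have "\<bar>dot z y\<bar> < \<bar>dot z b\<bar>" using abs_mod_less[OF b(2)] by simp
    then have dzy: "dot z y = 0" using least[OF y] by fastforce
    obtain q c where q: "q \<noteq> 0" "\<forall>i. q * y i = (\<Sum>v\<in>insert k V. c v * v i)" and yK: "y \<in> K"
      using y by (auto simp: pure_hull_def)
    have "q * dot z y = dot z (\<lambda>i. q * y i)" by (simp add: dot_def sum_distrib_left mult.left_commute)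
    also have "\<dots> = c k * dot z k + (\<Sum>v\<in>V. c v * dot z v)"
      using q(2) kV V(1) dot_sum_right[of z c "insert k V"] by simp
    finally have "c k = 0" using dzy z by simp
    then have "\<forall>i. q * y i = (\<Sum>v\<in>V. c v * v i)" using q(2) kV V(1) by simp
    then have "y \<in> pure_hull K V" using q(1) yK by (auto simp: pure_hull_def)
    then show ?thesis by (intro exI[of _ m]) (simp add: y_def[abs_def])
  qed
  moreover have "\<forall>x\<in>pure_hull K V. dot z x = 0" using pure_hull_dot z(1) by blast
  ultimately show ?thesis using b by blast
qed

text \<open>The pure hulls of initial segments of an enumeration form a chain with union
  \<open>K\<close> whose successive quotients are 0 or infinite cyclic. \<open>N\<close> collects
  the indices at which the hull grows, and \<open>\<beta>\<close> picks a generator for each of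
  them.\<close>

lemma countable_basis:
  assumes K: "lincomb_closed K" and count: "countable K"
  shows "\<exists>(N :: nat set) \<beta>. (\<forall>j\<in>N. \<beta> j \<in> K) \<and>
    (\<forall>x\<in>K. \<exists>F c. finite F \<and> F \<subseteq> N \<and> x = (\<lambda>i. \<Sum>j\<in>F. c j * \<beta> j i)) \<and>
    (\<forall>F c. finite F \<longrightarrow> F \<subseteq> N \<longrightarrow> (\<forall>i. (\<Sum>j\<in>F. c j * \<beta> j i) = 0) \<longrightarrow> (\<forall>j\<in>F. c j = (0::int)))"
proof -
  define k where "k = from_nat_into K"
  have "K \<noteq> {}" using K by (simp add: lincomb_closed_def)
  then have rk: "range k = K" unfolding k_def by (rule range_from_nat_into[OF _ count])
  define V where "V n = k ` {..<n}" for n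
  have VS: "V (Suc n) = insert (k n) (V n)" for n by (simp add: V_def lessThan_Suc)
  have V: "finite (V n)" "V n \<subseteq> K" "k n \<in> K" for n using rk by (auto simp: V_def)
  define N where "N = {n. k n \<notin> pure_hull K (V n)}"
  have "\<forall>n\<in>N. \<exists>b. \<exists>z. b \<in> pure_hull K (V (Suc n)) \<and> dot z b \<noteq> 0 \<and> (\<forall>x\<in>pure_hull K (V n). dot z x = 0) \<and>
    (\<forall>x\<in>pure_hull K (V (Suc n)). \<exists>m. (\<lambda>i. x i - m * b i) \<in> pure_hull K (V n))"
    unfolding VS using pure_hull_step[OF K V] by (simp add: N_def)
  then obtain \<beta> where "\<forall>n\<in>N. \<exists>z. \<beta> n \<in> pure_hull K (V (Suc n)) \<and> dot z (\<beta> n) \<noteq> 0 \<and> (\<forall>x\<in>pure_hull K (V n). dot z x = 0) \<and>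
    (\<forall>x\<in>pure_hull K (V (Suc n)). \<exists>m. (\<lambda>i. x i - m * \<beta> n i) \<in> pure_hull K (V n))"
    by (rule bchoice[THEN exE])
  then obtain \<zeta> where \<beta>\<zeta>: "\<forall>n\<in>N. \<beta> n \<in> pure_hull K (V (Suc n)) \<and> dot (\<zeta> n) (\<beta> n) \<noteq> 0 \<and> (\<forall>x\<in>pure_hull K (V n). dot (\<zeta> n) x = 0) \<and>
    (\<forall>x\<in>pure_hull K (V (Suc n)). \<exists>m. (\<lambda>i. x i - m * \<beta> n i) \<in> pure_hull K (V n))"
    by (rule bchoice[THEN exE])
  have mono: "pure_hull K (V n) \<subseteq> pure_hull K (V m)" if "n \<le> m" for n m
    using that
  proof (rule lift_Suc_mono_le[rotated])
    fix n
    show "pure_hull K (V n) \<subseteq> pure_hull K (V (Suc n))"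
    proof (cases "k n \<in> V n")
      case True
      then show ?thesis by (simp add: VS insert_absorb)
    next
      case False
      have c: "(\<Sum>v\<in>V (Suc n). (c(k n := 0)) v * v i) = (\<Sum>v\<in>V n. c v * v i)" for c i
        unfolding VS using False V(1)[of n] by (auto intro!: sum.cong)
      show ?thesis
      proof
        fix x assume "x \<in> pure_hull K (V n)"
        then obtain q d where x: "x \<in> K" "q \<noteq> 0" "\<forall>i. q * x i = (\<Sum>v\<in>V n. d v * v i)" by (rule pure_hullE)
        then show "x \<in> pure_hull K (V (Suc n))" by (intro pure_hullI[OF x(1,2), where c = "d(k n := 0)"]) (simp only: c)
      qed
    qed
  qed
  have gen: "\<exists>F c. finite F \<and> F \<subseteq> N \<and> x = (\<lambda>i. \<Sum>j\<in>F. c j * \<beta> j i)" if "x \<in> pure_hull K (V n)" for x n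
    using that
  proof (induction n arbitrary: x)
    case 0
    then have "x = (\<lambda>i. 0)" by (auto simp: pure_hull_def V_def)
    then show ?case by (intro exI[of _ "{}"]) simp
  next
    case (Suc n)
    show ?case
    proof (cases "n \<in> N")
      case True
      then obtain m where "(\<lambda>i. x i - m * \<beta> n i) \<in> pure_hull K (V n)" using \<beta>\<zeta> Suc.prems by blast
      from Suc.IH[OF this] obtain F c where F: "finite F" "F \<subseteq> N"
        and eq: "(\<lambda>i. x i - m * \<beta> n i) = (\<lambda>i. \<Sum>j\<in>F. c j * \<beta> j i)" by blast
      define c' where "c' j = (if j \<in> F then c j else 0) + (if j = n then m else 0)" for j
      have "x i = (\<Sum>j\<in>insert n F. c' j * \<beta> j i)" for i
      proof -
        have "(\<Sum>j\<in>insert n F. c' j * \<beta> j i) =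
            (\<Sum>j\<in>insert n F. (if j \<in> F then c j else 0) * \<beta> j i) + (\<Sum>j\<in>insert n F. (if j = n then m else 0) * \<beta> j i)"
          by (simp only: c'_def distrib_right sum.distrib)
        also have "(\<Sum>j\<in>insert n F. (if j \<in> F then c j else 0) * \<beta> j i) = (\<Sum>j\<in>F. c j * \<beta> j i)"
          by (rule sum.mono_neutral_cong_right) (use F in auto)
        also have "(\<Sum>j\<in>insert n F. (if j = n then m else 0) * \<beta> j i) = (\<Sum>j\<in>{n}. m * \<beta> j i)"
          by (rule sum.mono_neutral_cong_right) (use F in auto)
        finally show ?thesis using fun_cong[OF eq, of i] by simp
      qed
      then show ?thesis using F True by (intro exI[of _ "insert n F"] exI[of _ c']) auto
    next
      case False
      then have kn: "k n \<in> pure_hull K (V n)" by (simp add: N_def)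
      obtain q c where q: "q \<noteq> 0" "\<forall>i. q * x i = (\<Sum>v\<in>V (Suc n). c v * v i)" and xK: "x \<in> K"
        using Suc.prems by (auto simp: pure_hull_def)
      have "x \<in> pure_hull K (V n)"
      proof (cases "k n \<in> V n")
        case True
        then show ?thesis using Suc.prems by (simp add: VS insert_absorb)
      next
        case False
        obtain r d where r: "r \<noteq> 0" "\<forall>i. r * k n i = (\<Sum>v\<in>V n. d v * v i)"
          using kn by (auto simp: pure_hull_def)
        have "(r * q) * x i = (\<Sum>v\<in>V n. (c (k n) * d v + r * c v) * v i)" for i
        proof -
          have "(r * q) * x i = r * (q * x i)" by simp
          also have "\<dots> = r * (\<Sum>v\<in>V (Suc n). c v * v i)" using q(2) by simp
          also have "\<dots> = c (k n) * (r * k n i) + r * (\<Sum>v\<in>V n. c v * v i)"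
            unfolding VS using False V(1) by (simp add: algebra_simps)
          also have "\<dots> = (\<Sum>v\<in>V n. (c (k n) * d v + r * c v) * v i)"
            using r(2) by (simp add: sum_distrib_left sum.distrib distrib_right mult.assoc)
          finally show ?thesis .
        qed
        moreover have "r * q \<noteq> 0" using q r by simp
        ultimately show ?thesis using xK by (intro pure_hullI)
      qed
      then show ?thesis by (rule Suc.IH)
    qed
  qed
  have indep: "\<forall>j\<in>F. c j = 0" if F: "finite F" "F \<subseteq> N" "\<forall>i. (\<Sum>j\<in>F. c j * \<beta> j i) = 0" for F and c :: "nat \<Rightarrow> int"
  proof (rule ccontr)
    assume "\<not> (\<forall>j\<in>F. c j = 0)"
    then have ne: "{j \<in> F. c j \<noteq> 0} \<noteq> {}" by blast
    \<comment> \<open>At the largest index with a nonzero coefficient, \<open>\<zeta> m\<close>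
      kills all earlier generators and isolates that coefficient.\<close>
    define m where "m = Max {j \<in> F. c j \<noteq> 0}"
    have m: "m \<in> F" "c m \<noteq> 0" using Max_in[of "{j \<in> F. c j \<noteq> 0}"] ne F by (auto simp: m_def)
    have le: "j \<le> m" if "j \<in> F" "c j \<noteq> 0" for j unfolding m_def using F that by (intro Max_ge) auto
    have z: "dot (\<zeta> m) (\<beta> j) = 0" if "j \<in> F" "j < m" for j
    proof -
      have "\<beta> j \<in> pure_hull K (V m)" using \<beta>\<zeta> F that mono[of "Suc j" m] by auto
      then show ?thesis using \<beta>\<zeta> F m by blast
    qed
    have "(\<Sum>j\<in>F. c j * dot (\<zeta> m) (\<beta> j)) = dot (\<zeta> m) (\<lambda>i. \<Sum>j\<in>F. c j * \<beta> j i)"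
    proof -
      have "dot (\<zeta> m) (\<lambda>i. \<Sum>j\<in>F. c j * \<beta> j i) = (\<Sum>i | \<zeta> m i \<noteq> 0. \<Sum>j\<in>F. c j * (\<zeta> m i * \<beta> j i))"
        by (simp add: dot_def sum_distrib_left mult.left_commute)
      also have "\<dots> = (\<Sum>j\<in>F. \<Sum>i | \<zeta> m i \<noteq> 0. c j * (\<zeta> m i * \<beta> j i))" by (rule sum.swap)
      finally show ?thesis by (simp add: dot_def sum_distrib_left)
    qed
    also have "\<dots> = 0" using F(3) by (simp add: dot_def)
    finally have "0 = (\<Sum>j\<in>F. c j * dot (\<zeta> m) (\<beta> j))" by simp
    also have "\<dots> = (\<Sum>j\<in>{m}. c j * dot (\<zeta> m) (\<beta> j))"
    proof (rule sum.mono_neutral_right)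
      show "\<forall>j\<in>F - {m}. c j * dot (\<zeta> m) (\<beta> j) = 0" using z le by (metis DiffE insertI1 le_neq_implies_less mult_eq_0_iff)
    qed (use F m in auto)
    finally show False using m \<beta>\<zeta> F by auto
  qed
  have "\<exists>F c. finite F \<and> F \<subseteq> N \<and> x = (\<lambda>i. \<Sum>j\<in>F. c j * \<beta> j i)" if x: "x \<in> K" for x
  proof -
    obtain n where n: "x = k n" using x rk by blast
    have "x \<in> pure_hull K (V (Suc n))" by (rule pure_hull_self[OF V(1) _ x]) (simp add: VS n)
    then show ?thesis by (rule gen)
  qed
  moreover have "\<forall>j\<in>N. \<beta> j \<in> K" using \<beta>\<zeta> by (auto simp: pure_hull_def)
  ultimately show ?thesis using indep by (intro exI[of _ N] exI[of _ \<beta>]) blast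
qed

text \<open>\<open>free_abelian\<close> wants basis elements of the carrier type, so the basis is
  reindexed from numbers to the vectors themselves; independence makes \<open>\<beta>\<close>
  injective.\<close>

theorem countable_subgroup_free:
  assumes K: "lincomb_closed K" and count: "countable K"
  shows "free_abelian (bs_subgroup K)"
proof -
  obtain N :: "nat set" and \<beta> where \<beta>K: "\<forall>j\<in>N. \<beta> j \<in> K"
    and gen: "\<forall>x\<in>K. \<exists>F c. finite F \<and> F \<subseteq> N \<and> x = (\<lambda>i. \<Sum>j\<in>F. c j * \<beta> j i)"
    and indep: "\<forall>F c. finite F \<longrightarrow> F \<subseteq> N \<longrightarrow> (\<forall>i. (\<Sum>j\<in>F. c j * \<beta> j i) = 0) \<longrightarrow> (\<forall>j\<in>F. c j = (0::int))"
    using countable_basis[OF assms] by blast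
  have inj: "inj_on \<beta> N"
  proof (rule inj_onI, rule ccontr)
    fix j m assume jm: "j \<in> N" "m \<in> N" "\<beta> j = \<beta> m" "j \<noteq> m"
    then have "\<forall>i. (\<Sum>l\<in>{j, m}. (if l = j then 1 else - 1 :: int) * \<beta> l i) = 0" by simp
    then show False
      using indep[THEN spec, THEN spec, THEN mp, THEN mp, THEN mp, of "{j, m}" "\<lambda>l. if l = j then 1 else - 1"] jm
      by auto
  qed
  define B where "B = \<beta> ` N"
  define h where "h c = (\<lambda>i. \<Sum>b\<in>Poly_Mapping.keys c. Poly_Mapping.lookup c b * b i)"
    for c :: "(nat \<Rightarrow> int) \<Rightarrow>\<^sub>0 int"
  have hA: "h c i = (\<Sum>b\<in>A. Poly_Mapping.lookup c b * b i)" if "finite A" "Poly_Mapping.keys c \<subseteq> A" for c A i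
    unfolding h_def by (rule sum.mono_neutral_left) (use that in \<open>auto simp: in_keys_iff\<close>)
  have "h \<in> hom (free_Abelian_group B) (bs_subgroup K)"
  proof (rule homI)
    fix c assume "c \<in> carrier (free_Abelian_group B)"
    then have "Poly_Mapping.keys c \<subseteq> K" using \<beta>K by (auto simp: B_def)
    then show "h c \<in> carrier (bs_subgroup K)"
      using lincomb_closed_sum[OF K finite_keys, of c "\<lambda>b. b" "Poly_Mapping.lookup c"] by (auto simp: h_def)
  next
    fix c d
    have "h (c + d) i = h c i + h d i" for i
    proof -
      let ?A = "Poly_Mapping.keys c \<union> Poly_Mapping.keys d"
      have "Poly_Mapping.keys (c + d) \<subseteq> ?A" by (rule keys_add)
      then show ?thesis
        using hA[of ?A c i] hA[of ?A d i] hA[of ?A "c + d" i]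
        by (simp add: lookup_add distrib_right sum.distrib)
    qed
    then show "h (c \<otimes>\<^bsub>free_Abelian_group B\<^esub> d) = h c \<otimes>\<^bsub>bs_subgroup K\<^esub> h d"
      by (simp only: mult_free_Abelian_group mult_bs) blast
  qed
  moreover have "inj_on h (carrier (free_Abelian_group B))"
  proof (rule inj_onI)
    fix c d assume cd: "c \<in> carrier (free_Abelian_group B)" "d \<in> carrier (free_Abelian_group B)" "h c = h d"
    let ?A = "Poly_Mapping.keys c \<union> Poly_Mapping.keys d"
    have "?A \<subseteq> \<beta> ` N" using cd by (auto simp: B_def)
    then obtain F where F: "F \<subseteq> N" "?A = \<beta> ` F" by (auto simp: subset_image_iff)
    have injF: "inj_on \<beta> F" using inj F inj_on_subset by blast
    have finF: "finite F" using F injF finite_imageD[of \<beta> F] by (metis finite_UnI finite_keys)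
    have "(\<Sum>j\<in>F. (Poly_Mapping.lookup c (\<beta> j) - Poly_Mapping.lookup d (\<beta> j)) * \<beta> j i) = 0" for i
    proof -
      have "(\<Sum>j\<in>F. (Poly_Mapping.lookup c (\<beta> j) - Poly_Mapping.lookup d (\<beta> j)) * \<beta> j i) =
          (\<Sum>b\<in>?A. (Poly_Mapping.lookup c b - Poly_Mapping.lookup d b) * b i)"
        unfolding F(2) using injF by (simp add: sum.reindex)
      also have "\<dots> = h c i - h d i"
        using hA[of ?A c i] hA[of ?A d i] by (simp add: left_diff_distrib sum_subtractf)
      finally show ?thesis using cd by simp
    qed
    then have "\<forall>j\<in>F. Poly_Mapping.lookup c (\<beta> j) - Poly_Mapping.lookup d (\<beta> j) = 0"
      using indep[THEN spec[of _ F], THEN spec[of _ "\<lambda>j. Poly_Mapping.lookup c (\<beta> j) - Poly_Mapping.lookup d (\<beta> j)"],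
        THEN mp, THEN mp, THEN mp] finF F(1) by blast
    then have on: "Poly_Mapping.lookup c b = Poly_Mapping.lookup d b" if "b \<in> ?A" for b
      using that unfolding F(2) by auto
    have "Poly_Mapping.lookup c b = Poly_Mapping.lookup d b" for b
      using on[of b] by (cases "b \<in> ?A") (auto simp: in_keys_iff)
    then show "c = d" by (intro poly_mapping_eqI)
  qed
  moreover have "h ` carrier (free_Abelian_group B) = K"
  proof
    show "h ` carrier (free_Abelian_group B) \<subseteq> K"
      using \<open>h \<in> hom _ _\<close> by (auto simp: hom_def)
    show "K \<subseteq> h ` carrier (free_Abelian_group B)"
    proof
      fix x assume "x \<in> K"
      then obtain F c where F: "finite F" "F \<subseteq> N" "x = (\<lambda>i. \<Sum>j\<in>F. c j * \<beta> j i)" using gen by blast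
      have injF: "inj_on \<beta> F" using inj F inj_on_subset by blast
      define f where "f b = (if b \<in> \<beta> ` F then c (the_inv_into F \<beta> b) else 0)" for b
      have fin: "finite {b. f b \<noteq> 0}" by (rule finite_subset[of _ "\<beta> ` F"]) (use F in \<open>auto simp: f_def\<close>)
      define u where "u = Abs_poly_mapping f"
      have lu: "Poly_Mapping.lookup u = f" unfolding u_def using fin by (intro lookup_Abs_poly_mapping)
      have ku: "Poly_Mapping.keys u \<subseteq> \<beta> ` F" by (auto simp: in_keys_iff lu f_def split: if_splits)
      have "h u i = x i" for i
      proof -
        have "h u i = (\<Sum>b\<in>\<beta> ` F. f b * b i)" using hA[OF _ ku] F(1) lu by simp
        also have "\<dots> = (\<Sum>j\<in>F. f (\<beta> j) * \<beta> j i)" using injF by (simp add: sum.reindex)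
        also have "\<dots> = x i" using F(3) injF by (auto simp: f_def the_inv_into_f_f intro!: sum.cong)
        finally show ?thesis .
      qed
      then have "h u = x" by blast
      moreover have "u \<in> carrier (free_Abelian_group B)" using ku F(2) by (auto simp: B_def)
      ultimately show "x \<in> h ` carrier (free_Abelian_group B)" by blast
    qed
  qed
  ultimately have "h \<in> iso (free_Abelian_group B) (bs_subgroup K)"
    by (simp add: iso_def bij_betw_def)
  then show ?thesis unfolding free_abelian_def is_iso_def by blast
qed

theorem aleph1_free_bs:
  assumes H: "lincomb_closed H"
  shows "aleph1_free (bs_subgroup H)"
  unfolding aleph1_free_def
proof (intro allI impI, elim conjE)
  fix K assume K: "subgroup K (bs_subgroup H)" "countable K"
  have "subgroup K baer_specker"
    using group.incl_subgroup[OF group_baer_specker, of H K] K(1) H subgroup_iff_lincomb_closed by blast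
  then have "free_abelian (bs_subgroup K)"
    using countable_subgroup_free K(2) subgroup_iff_lincomb_closed by blast
  then show "free_abelian (bs_subgroup H\<lparr>carrier := K\<rparr>)" by simp
qed

section \<open>Duality and endomorphisms\<close>

lemma hom_integer_iff: "\<phi> \<in> hom (bs_subgroup H) integer_group \<longleftrightarrow> additive_on H \<phi>"
  unfolding hom_def mult_bs additive_on_def by simp

lemma hom_bs_iff:
  "f \<in> hom (bs_subgroup H) (bs_subgroup K) \<longleftrightarrow> (\<forall>x\<in>H. f x \<in> K) \<and> (\<forall>i. additive_on H (\<lambda>x. f x i))"
  unfolding hom_def mult_bs additive_on_def by (auto simp: fun_eq_iff)

lemma mult_hom_group: "\<phi> \<otimes>\<^bsub>hom_group G A\<^esub> \<psi> = (\<lambda>x\<in>carrier G. \<phi> x \<otimes>\<^bsub>A\<^esub> \<psi> x)"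
  by (simp add: hom_group_def)

lemma mem_dual_group: "\<phi> \<in> carrier (dual_group (bs_subgroup H)) \<longleftrightarrow> additive_on H \<phi> \<and> \<phi> \<in> extensional H"
  by (simp add: hom_group_def hom_integer_iff)

lemma mem_End_bs:
  "f \<in> End (bs_subgroup H) \<longleftrightarrow> (\<forall>x\<in>H. f x \<in> H) \<and> (\<forall>i. additive_on H (\<lambda>x. f x i)) \<and> f \<in> extensional H"
  by (simp add: hom_group_def hom_bs_iff)

lemma pure_subgroup_bs:
  assumes A: "lincomb_closed A" and H: "lincomb_closed H" and sub: "A \<subseteq> H"
    and divide: "\<And>q x. (\<lambda>i. q * x i) \<in> A \<Longrightarrow> q \<noteq> 0 \<Longrightarrow> x \<in> A"
  shows "pure_subgroup A (bs_subgroup H)"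
  unfolding pure_subgroup_def
proof (intro conjI allI ballI impI)
  show "subgroup A (bs_subgroup H)"
    using group.subgroup_incl[OF group_baer_specker] subgroup_iff_lincomb_closed A H sub by blast
  fix n :: nat and x assume x: "x [^]\<^bsub>bs_subgroup H\<^esub> n \<in> A"
  show "\<exists>y\<in>A. y [^]\<^bsub>bs_subgroup H\<^esub> n = x [^]\<^bsub>bs_subgroup H\<^esub> n"
  proof (cases "n = 0")
    case True
    then show ?thesis by (intro bexI[OF _ lincomb_closed_zero[OF A]]) simp
  next
    case False
    then have "x \<in> A" using x divide[of "int n" x] by (simp only: nat_pow_bs)
    then show ?thesis by blast
  qed
qed

lemma lincomb_closed_DD: "lincomb_closed DD"
  unfolding lincomb_closed_def
proof (intro conjI ballI allI)
  show "DD \<noteq> {}" using finsupp_DD[OF unit_vector_finsupp[OF le0]] by (metis empty_iff)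
qed (rule DD_lincomb)

lemma lincomb_closed_finsupp: "lincomb_closed (finsupp n)"
  unfolding lincomb_closed_def
proof (intro conjI ballI allI)
  show "finsupp n \<noteq> {}" using unit_vector_finsupp[OF order_refl, of n] by (metis empty_iff)
qed (rule finsupp_lincomb)

lemma lincomb_closed_image:
  assumes H: "lincomb_closed H" and f: "\<And>i. additive_on H (\<lambda>x. f x i)"
  shows "lincomb_closed (f ` H)"
  unfolding lincomb_closed_def
proof (intro conjI ballI allI)
  show "f ` H \<noteq> {}" using H by (simp add: lincomb_closed_def)
  fix u v p q assume "u \<in> f ` H" "v \<in> f ` H"
  then obtain x y where xy: "x \<in> H" "y \<in> H" "u = f x" "v = f y" by blast
  have "f (\<lambda>i. p * x i + q * y i) = (\<lambda>i. p * u i + q * v i)"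
    using additive_lincomb[OF H f xy(1,2)] xy by blast
  then show "(\<lambda>i. p * u i + q * v i) \<in> f ` H"
    using imageI[OF lincomb_closedD[OF H xy(1,2), of p q], of f] by simp
qed

lemma \<Phi>int_commute: "\<Phi>int a b = \<Phi>int b a"
  by (simp add: \<Phi>int_def \<Phi>_def mult.commute)

lemma in_iso_iff: "h \<in> iso G H \<longleftrightarrow> h \<in> hom G H \<and> bij_betw h (carrier G) (carrier H)"
  by (simp add: iso_def)

section \<open>Duality and reflexivity from maximality alone\<close>

context dual_pair
begin

lemma \<Phi>int_pairing: "a \<in> H1 \<Longrightarrow> b \<in> H2 \<Longrightarrow> \<Phi>int a b = pairing a b"
  by (rule \<Phi>int_eq[OF subsetD[OF DD1] subsetD[OF DD2] pairs_H])

lemma \<Phi>_integral: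
  assumes "a \<in> H1" "b \<in> H2"
  shows "\<Phi> a b \<in> range zhat_of_int"
proof -
  have "\<Phi> a b = zhat_of_int (pairing a b)"
    using \<Phi>_eq_iff_pairs[OF subsetD[OF DD1] subsetD[OF DD2], OF assms] pairs_H[OF assms] by simp
  then show ?thesis by simp
qed

lemma additive_\<Phi>int:
  assumes b: "b \<in> H2"
  shows "additive_on H1 (\<lambda>a. \<Phi>int a b)"
  unfolding additive_on_def
proof (intro ballI)
  fix x y assume xy: "x \<in> H1" "y \<in> H1"
  have "(\<lambda>i. x i + y i) \<in> H1" using lincomb_closedD[OF lincomb_closed_H1 xy, of 1 1] by simp
  then show "\<Phi>int (\<lambda>i. x i + y i) b = \<Phi>int x b + \<Phi>int y b"
    using additive_pairing[OF b] xy b by (simp add: \<Phi>int_pairing additive_on_def)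
qed

lemma hom_\<Phi>int:
  assumes "additive_on H1 \<phi>" "a \<in> H1"
  shows "\<phi> a = \<Phi>int a (\<lambda>i. \<phi> (unit_vector i))"
  using \<Phi>int_pairing[OF assms(2) hom_representative[OF assms(1)]] pairing_eq[OF hom_pairs[OF assms]] by simp

lemma \<Phi>int_unit_vector: "b \<in> H2 \<Longrightarrow> \<Phi>int (unit_vector i) b = b i"
  by (simp add: \<Phi>int_pairing unit_vector_H1 pairing_unit_vector)

text \<open>The unit vectors recover \<open>h\<close> from its functional, and
  \<open>hom_representative\<close> supplies a preimage of every functional.\<close>

lemma iso_dual: "(\<lambda>h\<in>H2. \<lambda>a\<in>H1. \<Phi>int a h) \<in> iso (bs_subgroup H2) (dual_group (bs_subgroup H1))"
proof -
  interpret swap: dual_pair H2 H1 by (rule dual_pair_swap)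
  let ?f = "\<lambda>h\<in>H2. \<lambda>a\<in>H1. \<Phi>int a h"
  have mem: "?f h \<in> carrier (dual_group (bs_subgroup H1))" if "h \<in> H2" for h
    using additive_\<Phi>int[OF that] that lincomb_closedD[OF lincomb_closed_H1, of _ _ 1 1]
    unfolding mem_dual_group by (simp add: additive_on_def)
  have "?f \<in> hom (bs_subgroup H2) (dual_group (bs_subgroup H1))"
  proof (rule homI)
    show "?f h \<in> carrier (dual_group (bs_subgroup H1))" if "h \<in> carrier (bs_subgroup H2)" for h
      using mem that by simp
    fix h h' assume "h \<in> carrier (bs_subgroup H2)" "h' \<in> carrier (bs_subgroup H2)"
    then have h: "h \<in> H2" "h' \<in> H2" by simp_all
    then have "(\<lambda>i. h i + h' i) \<in> H2" using lincomb_closedD[OF swap.lincomb_closed_H1, of h h' 1 1] by simp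
    moreover have "\<Phi>int a (\<lambda>i. h i + h' i) = \<Phi>int a h + \<Phi>int a h'" if "a \<in> H1" for a
      using swap.additive_\<Phi>int[OF that] h unfolding additive_on_def by (simp add: \<Phi>int_commute[of a])
    ultimately show "?f (h \<otimes>\<^bsub>bs_subgroup H2\<^esub> h') = ?f h \<otimes>\<^bsub>dual_group (bs_subgroup H1)\<^esub> ?f h'"
      unfolding mult_bs mult_hom_group using h by (auto simp: fun_eq_iff restrict_def)
  qed
  moreover have "inj_on ?f H2"
  proof (rule inj_onI)
    fix h h' assume h: "h \<in> H2" "h' \<in> H2" "?f h = ?f h'"
    have "h i = h' i" for i
    proof -
      have "?f h (unit_vector i) = ?f h' (unit_vector i)" using h(3) by simp
      then show ?thesis using h unit_vector_H1[of i] \<Phi>int_unit_vector by simp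
    qed
    then show "h = h'" by blast
  qed
  moreover have "?f ` H2 = carrier (dual_group (bs_subgroup H1))"
  proof
    show "?f ` H2 \<subseteq> carrier (dual_group (bs_subgroup H1))" using mem by blast
    show "carrier (dual_group (bs_subgroup H1)) \<subseteq> ?f ` H2"
    proof
      fix \<phi> assume "\<phi> \<in> carrier (dual_group (bs_subgroup H1))"
      then have \<phi>: "additive_on H1 \<phi>" "\<phi> \<in> extensional H1" by (simp_all only: mem_dual_group)
      let ?h = "\<lambda>i. \<phi> (unit_vector i)"
      have h: "?h \<in> H2" by (rule hom_representative[OF \<phi>(1)])
      have "\<phi> = ?f ?h"
        using \<phi>(2) hom_\<Phi>int[OF \<phi>(1)] h by (intro extensionalityI[of _ H1]) auto
      then show "\<phi> \<in> ?f ` H2" using h by blast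
    qed
  qed
  ultimately show ?thesis unfolding in_iso_iff bij_betw_def by simp
qed

text \<open>Composed with the isomorphism of \<open>H2\<close> with the dual of \<open>H1\<close>, a
  functional on this dual becomes a functional on \<open>H2\<close>. In the swapped pair it is given
  by a vector of \<open>H1\<close>, and it is evaluation at that vector.\<close>

lemma reflexive: "reflexive_group (bs_subgroup H1)"
proof -
  interpret swap: dual_pair H2 H1 by (rule dual_pair_swap)
  let ?G = "bs_subgroup H1" and ?ev = "evaluation (bs_subgroup H1)"
  have plus: "(\<lambda>i. x i + y i) \<in> H1" if "x \<in> H1" "y \<in> H1" for x y
    using lincomb_closedD[OF lincomb_closed_H1 that, of 1 1] by simp
  have mult_dual: "\<phi> \<otimes>\<^bsub>dual_group ?G\<^esub> \<psi> = (\<lambda>x\<in>H1. \<phi> x + \<psi> x)" for \<phi> \<psi>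
    by (simp add: mult_hom_group)
  have closed: "(\<lambda>x\<in>H1. \<phi> x + \<psi> x) \<in> carrier (dual_group ?G)"
    if "\<phi> \<in> carrier (dual_group ?G)" "\<psi> \<in> carrier (dual_group ?G)" for \<phi> \<psi>
    using that unfolding mem_dual_group by (auto simp: additive_on_def plus)
  have mem: "?ev g \<in> carrier (dual_group (dual_group ?G))" if g: "g \<in> H1" for g
  proof -
    have "?ev g \<in> hom (dual_group ?G) integer_group"
      by (rule homI) (use closed g in \<open>auto simp: evaluation_def mult_dual\<close>)
    then show ?thesis by (simp add: hom_group_def[of "dual_group ?G"] evaluation_def)
  qed
  have "?ev \<in> hom ?G (dual_group (dual_group ?G))"
  proof (rule homI)
    show "?ev g \<in> carrier (dual_group (dual_group ?G))" if "g \<in> carrier ?G" for g using mem that by simp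
    fix g g' assume "g \<in> carrier ?G" "g' \<in> carrier ?G"
    then have "\<phi> (\<lambda>i. g i + g' i) = \<phi> g + \<phi> g'" if "\<phi> \<in> carrier (dual_group ?G)" for \<phi>
      using that unfolding mem_dual_group by (simp add: additive_on_def)
    then show "?ev (g \<otimes>\<^bsub>?G\<^esub> g') = ?ev g \<otimes>\<^bsub>dual_group (dual_group ?G)\<^esub> ?ev g'"
      unfolding mult_bs mult_hom_group evaluation_def by (auto simp: restrict_def fun_eq_iff)
  qed
  moreover have "inj_on ?ev H1"
  proof (rule inj_onI)
    fix g g' assume g: "g \<in> H1" "g' \<in> H1" "?ev g = ?ev g'"
    have "g i = g' i" for i
    proof -
      have "(\<lambda>x\<in>H1. x i) \<in> carrier (dual_group ?G)"
        unfolding mem_dual_group by (auto simp: additive_on_def plus)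
      moreover have "?ev g (\<lambda>x\<in>H1. x i) = ?ev g' (\<lambda>x\<in>H1. x i)" using g(3) by simp
      ultimately show ?thesis using g(1,2) by (simp add: evaluation_def)
    qed
    then show "g = g'" by blast
  qed
  moreover have "?ev ` H1 = carrier (dual_group (dual_group ?G))"
  proof
    show "?ev ` H1 \<subseteq> carrier (dual_group (dual_group ?G))" using mem by blast
    show "carrier (dual_group (dual_group ?G)) \<subseteq> ?ev ` H1"
    proof
      fix \<Psi> assume "\<Psi> \<in> carrier (dual_group (dual_group ?G))"
      then have \<Psi>: "\<Psi> \<in> hom (dual_group ?G) integer_group" "\<Psi> \<in> extensional (carrier (dual_group ?G))"
        by (simp_all add: hom_group_def[of "dual_group ?G"])
      define \<theta> where "\<theta> = (\<lambda>h\<in>H2. \<lambda>a\<in>H1. \<Phi>int a h)"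
      have \<theta>: "\<theta> \<in> hom (bs_subgroup H2) (dual_group ?G)" "\<theta> ` H2 = carrier (dual_group ?G)"
        using iso_dual unfolding \<theta>_def in_iso_iff bij_betw_def by simp_all
      have "\<Psi> \<circ> \<theta> \<in> hom (bs_subgroup H2) integer_group"
        by (rule Group.hom_compose[OF \<theta>(1) \<Psi>(1)])
      then have add: "additive_on H2 (\<Psi> \<circ> \<theta>)" by (simp only: hom_integer_iff)
      define g where "g i = (\<Psi> \<circ> \<theta>) (unit_vector i)" for i
      have g: "g \<in> H1" unfolding g_def by (rule swap.hom_representative[OF add])
      have "\<Psi> \<phi> = ?ev g \<phi>" if "\<phi> \<in> carrier (dual_group ?G)" for \<phi>
      proof -
        have "\<phi> \<in> \<theta> ` H2" using that by (simp only: \<theta>(2))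
        then obtain b where b: "\<phi> = \<theta> b" "b \<in> H2" by (rule imageE)
        have "\<Psi> \<phi> = \<Phi>int b g" using swap.hom_\<Phi>int[OF add b(2)] b by (simp add: g_def[abs_def])
        also have "\<dots> = \<phi> g" using b g by (simp add: \<theta>_def \<Phi>int_commute)
        finally show ?thesis using that by (simp add: evaluation_def)
      qed
      then have "\<Psi> = ?ev g"
        using \<Psi>(2) by (intro extensionalityI[of _ "carrier (dual_group ?G)"]) (auto simp: evaluation_def)
      then show "\<Psi> \<in> ?ev ` H1" using g by blast
    qed
  qed
  ultimately show ?thesis unfolding reflexive_group_def in_iso_iff bij_betw_def by simp
qed

end

section \<open>Endomorphisms, slenderness and the failure to absorb a summand Z\<close>

context rigid_pair
begin

text \<open>Existence comes from \<open>rigid_endomorphism\<close>, with finite rank read off from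
  the coordinates in \<open>E\<close>. For uniqueness, two finite-rank parts have a common nonzero
  kernel vector, and there \<open>f\<close> is multiplication by either scalar.\<close>

lemma End_decomposition:
  assumes f: "f \<in> End (bs_subgroup H1)"
  shows "\<exists>!p. case p of (s :: int, \<phi>) \<Rightarrow> \<phi> \<in> Fin (bs_subgroup H1) \<and>
    f = (\<lambda>x\<in>H1. x [^]\<^bsub>bs_subgroup H1\<^esub> s \<otimes>\<^bsub>bs_subgroup H1\<^esub> \<phi> x)"
proof -
  note lc = lincomb_closed_H1
  have fH: "\<And>x. x \<in> H1 \<Longrightarrow> f x \<in> H1" and fadd: "\<And>i. additive_on H1 (\<lambda>x. f x i)" and fext: "f \<in> extensional H1"
    using f unfolding mem_End_bs by blast+
  have Fin_iff: "\<phi> \<in> Fin (bs_subgroup H1) \<longleftrightarrow> \<phi> \<in> End (bs_subgroup H1) \<and>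
      (\<exists>E. finite E \<and> (\<forall>x\<in>H1. (\<forall>i\<in>E. \<phi> x i = 0) \<longrightarrow> (\<forall>i. \<phi> x i = 0)))" for \<phi>
  proof (cases "\<phi> \<in> End (bs_subgroup H1)")
    case True
    then have "lincomb_closed (\<phi> ` H1)" using lincomb_closed_image[OF lc] unfolding mem_End_bs by blast
    from finite_rank_iff_coordinates[OF this] show ?thesis using True by (simp add: Fin_def)
  qed (simp add: Fin_def)
  have pow: "x [^]\<^bsub>bs_subgroup H1\<^esub> s \<otimes>\<^bsub>bs_subgroup H1\<^esub> y = (\<lambda>i. s * x i + y i)" if "x \<in> H1" for x y and s :: int
    unfolding mult_bs int_pow_bs[OF lc that] ..
  obtain s E where E: "finite E" "\<forall>x\<in>H1. (\<forall>i\<in>E. f x i = s * x i) \<longrightarrow> (\<forall>i. f x i = s * x i)"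
    using rigid_endomorphism[OF fH fadd] by blast
  define \<phi> where "\<phi> = (\<lambda>x\<in>H1. \<lambda>i. 1 * f x i + (- s) * x i)"
  have "\<phi> \<in> End (bs_subgroup H1)"
    unfolding mem_End_bs
  proof (intro conjI ballI allI)
    show "\<phi> x \<in> H1" if "x \<in> H1" for x
      unfolding \<phi>_def using lincomb_closedD[OF lc fH[OF that] that, of 1 "- s"] that by simp
    show "additive_on H1 (\<lambda>x. \<phi> x i)" for i
      using fadd[of i] lincomb_closedD[OF lc, of _ _ 1 1] by (simp add: additive_on_def \<phi>_def algebra_simps)
  qed (simp add: \<phi>_def)
  then have \<phi>: "\<phi> \<in> Fin (bs_subgroup H1)"
    unfolding Fin_iff using E by (intro conjI exI[of _ E]) (auto simp: \<phi>_def)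
  have f_eq: "f = (\<lambda>x\<in>H1. x [^]\<^bsub>bs_subgroup H1\<^esub> s \<otimes>\<^bsub>bs_subgroup H1\<^esub> \<phi> x)"
  proof (rule extensionalityI[OF fext restrict_extensional])
    fix x assume x: "x \<in> H1"
    have "f x = (\<lambda>i. s * x i + \<phi> x i)" using x by (simp add: \<phi>_def)
    then show "f x = (\<lambda>x\<in>H1. x [^]\<^bsub>bs_subgroup H1\<^esub> s \<otimes>\<^bsub>bs_subgroup H1\<^esub> \<phi> x) x"
      using x by (simp only: restrict_apply if_True pow)
  qed
  have uniq: "s' = s \<and> \<psi> = \<phi>"
    if \<psi>: "\<psi> \<in> Fin (bs_subgroup H1)" and eq: "f = (\<lambda>x\<in>H1. x [^]\<^bsub>bs_subgroup H1\<^esub> s' \<otimes>\<^bsub>bs_subgroup H1\<^esub> \<psi> x)"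
    for s' and \<psi>
  proof -
    have f1: "f x i = s' * x i + \<psi> x i" if "x \<in> H1" for x i
    proof -
      have "f x = x [^]\<^bsub>bs_subgroup H1\<^esub> s' \<otimes>\<^bsub>bs_subgroup H1\<^esub> \<psi> x"
        by (subst eq) (simp only: restrict_apply that if_True)
      then show ?thesis by (simp only: pow[OF that])
    qed
    have f2: "f x i = s * x i + \<phi> x i" if "x \<in> H1" for x i
      using that by (simp add: \<phi>_def)
    obtain E1 where E1: "finite E1" "\<forall>x\<in>H1. (\<forall>i\<in>E1. \<phi> x i = 0) \<longrightarrow> (\<forall>i. \<phi> x i = 0)"
      using \<phi> unfolding Fin_iff by blast
    obtain E2 where E2: "finite E2" "\<forall>x\<in>H1. (\<forall>i\<in>E2. \<psi> x i = 0) \<longrightarrow> (\<forall>i. \<psi> x i = 0)"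
      using \<psi> unfolding Fin_iff by blast
    have add: "additive_on H1 (\<lambda>x. \<phi> x i)" "additive_on H1 (\<lambda>x. \<psi> x i)" for i
      using \<phi> \<psi> unfolding Fin_iff mem_End_bs by blast+
    have "\<exists>z\<in>H1. (\<exists>i. z i \<noteq> 0) \<and> (\<forall>g\<in>(\<lambda>i x. \<phi> x i) ` E1 \<union> (\<lambda>i x. \<psi> x i) ` E2. g z = 0)"
      by (rule kernel_vector) (use E1 E2 add in auto)
    then obtain z j where z: "z \<in> H1" "z j \<noteq> 0"
      and g: "\<forall>g\<in>(\<lambda>i x. \<phi> x i) ` E1 \<union> (\<lambda>i x. \<psi> x i) ` E2. g z = 0" by blast
    have "\<forall>i\<in>E1. \<phi> z i = 0" "\<forall>i\<in>E2. \<psi> z i = 0" using g unfolding ball_Un ball_simps by simp_all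
    then have "\<phi> z j = 0" "\<psi> z j = 0" using E1(2) E2(2) z(1) by simp_all
    then have s: "s' = s" using f1[OF z(1), of j] f2[OF z(1), of j] z(2) by simp
    have "\<psi> x = \<phi> x" if "x \<in> H1" for x
      using f1[OF that] f2[OF that] s by (intro ext) simp
    moreover have "\<psi> \<in> extensional H1" "\<phi> \<in> extensional H1"
      using \<phi> \<psi> unfolding Fin_iff mem_End_bs by blast+
    ultimately have "\<psi> = \<phi>" using extensionalityI[of \<psi> H1 \<phi>] by simp
    with s show ?thesis ..
  qed
  show ?thesis
  proof (rule ex1I[of _ "(s, \<phi>)"])
    show "case (s, \<phi>) of (s, \<phi>) \<Rightarrow> \<phi> \<in> Fin (bs_subgroup H1) \<and>
        f = (\<lambda>x\<in>H1. x [^]\<^bsub>bs_subgroup H1\<^esub> s \<otimes>\<^bsub>bs_subgroup H1\<^esub> \<phi> x)"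
      unfolding prod.case by (rule conjI[OF \<phi> f_eq])
    show "p = (s, \<phi>)" if "case p of (s, \<phi>) \<Rightarrow> \<phi> \<in> Fin (bs_subgroup H1) \<and>
        f = (\<lambda>x\<in>H1. x [^]\<^bsub>bs_subgroup H1\<^esub> s \<otimes>\<^bsub>bs_subgroup H1\<^esub> \<phi> x)" for p
    proof (cases p)
      case (Pair s' \<psi>)
      show ?thesis using uniq[of \<psi> s'] that unfolding Pair prod.case by blast
    qed
  qed
qed

lemma slender_H1: "slender (bs_subgroup H1)"
  unfolding slender_def
proof (intro conjI ballI)
  show "torsion_free (bs_subgroup H1)"
    unfolding torsion_free_def nat_pow_bs one_bs by (auto simp: fun_eq_iff)
  fix h assume h: "h \<in> hom baer_specker (bs_subgroup H1)"
  then have hH: "h x \<in> H1" for x by (auto simp: hom_def)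
  have "h (x \<otimes>\<^bsub>baer_specker\<^esub> y) = h x \<otimes>\<^bsub>bs_subgroup H1\<^esub> h y" for x y
    using h unfolding hom_def by simp
  then have h_plus: "h (\<lambda>i. x i + y i) = (\<lambda>i. h x i + h y i)" for x y
    unfolding mult_baer_specker mult_bs .
  \<comment> \<open>The infinite complement of \<open>A\<close> forces the scalar part to vanish.
    Then the values are decided by the finitely many coordinates in \<open>E\<close>, each of which
    is a homomorphism to the integers.\<close>
  have part: "finite {n \<in> A. h (unit_vector n) \<noteq> (\<lambda>i. 0)}" if A: "infinite (- A)" for A
  proof -
    define g where "g x = h (\<lambda>i. if i \<in> A then x i else 0)" for x
    have add: "additive_on H1 (\<lambda>x. g x i)" for i
    proof -
      have "g (\<lambda>i. x i + y i) = (\<lambda>i. g x i + g y i)" for x y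
        unfolding g_def h_plus[symmetric] by (rule arg_cong[of _ _ h]) auto
      then show ?thesis by (simp add: additive_on_def)
    qed
    have "g x \<in> H1" for x by (simp add: g_def hH)
    then obtain s E where E: "finite E" "\<forall>x\<in>H1. (\<forall>i\<in>E. g x i = s * x i) \<longrightarrow> (\<forall>i. g x i = s * x i)"
      using rigid_endomorphism[of g] add by blast
    have "infinite (- A - E)" using A E(1) by simp
    \<comment> \<open>\<open>m\<close> avoids \<open>E\<close>, so that on \<open>E\<close> both
      \<open>g (unit_vector m)\<close> and \<open>s\<close> times \<open>unit_vector m\<close> are
      0. Hence they agree at \<open>m\<close> too, where the values are 0 and
      \<open>s\<close>.\<close>
    then obtain m where m: "m \<notin> A" "m \<notin> E" using infinite_imp_nonempty by blast
    have h0: "h (\<lambda>i. 0) = (\<lambda>i. 0)" using h_plus[of "\<lambda>i. 0" "\<lambda>i. 0"] by (simp add: fun_eq_iff)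
    have "(\<lambda>i. if i \<in> A then unit_vector m i else 0) = (\<lambda>i. 0)" using m by (auto simp: unit_vector_def)
    then have gm: "g (unit_vector m) = (\<lambda>i. 0)" by (simp only: g_def h0)
    then have "\<forall>i\<in>E. g (unit_vector m) i = s * unit_vector m i" using m by (auto simp: unit_vector_def)
    then have "g (unit_vector m) m = s * unit_vector m m" using E(2) unit_vector_H1 by blast
    then have s: "s = 0" using gm by (simp add: unit_vector_def)
    have ge: "g (unit_vector n) = h (unit_vector n)" if "n \<in> A" for n
      unfolding g_def using that by (intro arg_cong[of _ _ h]) (auto simp: unit_vector_def)
    have "{n \<in> A. h (unit_vector n) \<noteq> (\<lambda>i. 0)} \<subseteq> (\<Union>i\<in>E. {n. h (unit_vector n) i \<noteq> 0})"
    proof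
      fix n assume n: "n \<in> {n \<in> A. h (unit_vector n) \<noteq> (\<lambda>i. 0)}"
      then have "\<not> (\<forall>i. g (unit_vector n) i = s * unit_vector n i)" using ge s by auto
      then obtain i where "i \<in> E" "g (unit_vector n) i \<noteq> s * unit_vector n i" using E(2) unit_vector_H1 by blast
      then show "n \<in> (\<Union>i\<in>E. {n. h (unit_vector n) i \<noteq> 0})" using n ge s by auto
    qed
    moreover have "finite {n. h (unit_vector n) i \<noteq> 0}" for i
      by (rule finite_nonzero_unit_vectors) (simp add: additive_on_def h_plus)
    ultimately show ?thesis using E(1) by (meson finite_UN finite_subset)
  qed
  have "infinite (- {n :: nat. even n})" "infinite (- {n :: nat. odd n})"
  proof -
    show "infinite (- {n :: nat. even n})"
      unfolding infinite_nat_iff_unbounded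
    proof
      fix m :: nat
      have "2 * m + 1 > m" "2 * m + 1 \<in> - {n :: nat. even n}" by simp_all
      then show "\<exists>n>m. n \<in> - {n :: nat. even n}" by blast
    qed
    show "infinite (- {n :: nat. odd n})"
      unfolding infinite_nat_iff_unbounded
    proof
      fix m :: nat
      have "2 * m + 2 > m" "2 * m + 2 \<in> - {n :: nat. odd n}" by simp_all
      then show "\<exists>n>m. n \<in> - {n :: nat. odd n}" by blast
    qed
  qed
  then have "finite ({n \<in> {n. even n}. h (unit_vector n) \<noteq> (\<lambda>i. 0)} \<union> {n \<in> {n. odd n}. h (unit_vector n) \<noteq> (\<lambda>i. 0)})"
    using part by blast
  then show "finite {n. h (unit_vector n) \<noteq> \<one>\<^bsub>bs_subgroup H1\<^esub>}"
    unfolding one_bs by (rule finite_subset[rotated]) auto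
qed

text \<open>Write an injective endomorphism as \<open>\<theta> = s + \<phi>\<close>. Its iterates on \<open>\<phi> y\<close> stay in the image of \<open>\<phi>\<close>; a
  dependence among them puts a multiple of \<open>\<phi> y\<close>, hence one of \<open>y\<close>, into the image of \<open>\<theta>\<close>.\<close>
lemma not_iso_DirProd_integer: "\<not> (bs_subgroup H1 \<times>\<times> integer_group \<cong> bs_subgroup H1)"
proof
  note lc = lincomb_closed_H1
  assume "bs_subgroup H1 \<times>\<times> integer_group \<cong> bs_subgroup H1"
  then obtain \<theta>0 where iso: "\<theta>0 \<in> iso (bs_subgroup H1 \<times>\<times> integer_group) (bs_subgroup H1)"
    unfolding is_iso_def by blast
  have \<theta>0: "\<theta>0 (x, k) \<in> H1" if "x \<in> H1" for x k
    using iso that unfolding in_iso_iff hom_def by (auto simp: DirProd_def)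
  have plus: "\<theta>0 ((\<lambda>i. x i + x' i), k + k') = (\<lambda>i. \<theta>0 (x, k) i + \<theta>0 (x', k') i)"
    if x: "x \<in> H1" "x' \<in> H1" for x x' k k'
  proof -
    have "\<theta>0 ((x, k) \<otimes>\<^bsub>bs_subgroup H1 \<times>\<times> integer_group\<^esub> (x', k')) = \<theta>0 (x, k) \<otimes>\<^bsub>bs_subgroup H1\<^esub> \<theta>0 (x', k')"
      using iso x unfolding in_iso_iff hom_def by (auto simp: DirProd_def)
    then show ?thesis by (simp only: mult_DirProd mult_bs mult_integer_group)
  qed
  have inj: "x = x' \<and> k = k'" if "x \<in> H1" "x' \<in> H1" "\<theta>0 (x, k) = \<theta>0 (x', k')" for x x' k k'
    using iso that unfolding in_iso_iff bij_betw_def inj_on_def by (auto simp: DirProd_def)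
  have zero_mem: "(\<lambda>i. 0) \<in> H1" by (rule lincomb_closed_zero[OF lc])
  have zero: "\<theta>0 ((\<lambda>i. 0), 0) = (\<lambda>i. 0)"
    using plus[OF zero_mem zero_mem, of 0 0] by (simp add: fun_eq_iff)
  define \<theta> where "\<theta> x = \<theta>0 (x, 0)" for x
  define y where "y = \<theta>0 ((\<lambda>i. 0), 1)"
  have y: "y \<in> H1" unfolding y_def by (rule \<theta>0[OF zero_mem])
  have \<theta>H: "\<theta> x \<in> H1" if "x \<in> H1" for x unfolding \<theta>_def by (rule \<theta>0[OF that])
  have \<theta>add: "additive_on H1 (\<lambda>x. \<theta> x i)" for i
    unfolding additive_on_def \<theta>_def using plus[of _ _ 0 0] by simp
  have \<theta>inj: "x = (\<lambda>i. 0)" if "x \<in> H1" "\<theta> x = (\<lambda>i. 0)" for x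
    using inj[OF that(1) zero_mem, of 0 0] that(2) zero by (simp add: \<theta>_def)
  have ky: "\<theta>0 ((\<lambda>i. 0), k) = (\<lambda>i. k * y i)" for k
  proof -
    have nat: "\<theta>0 ((\<lambda>i. 0), int n) = (\<lambda>i. int n * y i)" for n
    proof (induction n)
      case (Suc n)
      then show ?case using plus[OF zero_mem zero_mem, of "int n" 1]
        by (simp add: y_def algebra_simps)
    qed (simp add: zero)
    show ?thesis
    proof (cases "k \<ge> 0")
      case True
      then show ?thesis using nat[of "nat k"] by simp
    next
      case False
      then have "(\<lambda>i. \<theta>0 ((\<lambda>i. 0), k) i + int (nat (- k)) * y i) = (\<lambda>i. 0)"
        using plus[OF zero_mem zero_mem, of k "int (nat (- k))"] nat[of "nat (- k)"] zero by simp
      then have "\<theta>0 ((\<lambda>i. 0), k) i = - (int (nat (- k)) * y i)" for i by (simp add: fun_eq_iff eq_neg_iff_add_eq_0)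
      then show ?thesis using False by (simp add: fun_eq_iff)
    qed
  qed
  \<comment> \<open>\<open>y\<close> is the image of the generator of the summand, so injectivity
    leaves no nonzero multiple of it in the image of \<open>\<theta>\<close>.\<close>
  have indep: "k = 0" if "w \<in> H1" "(\<lambda>i. k * y i) = \<theta> w" for k w
  proof -
    have "\<theta>0 ((\<lambda>i. 0), k) = \<theta>0 (w, 0)" using that(2) ky[of k] by (simp add: \<theta>_def)
    from inj[OF zero_mem that(1) this] show ?thesis by simp
  qed
  obtain s E where E: "finite E" "\<forall>x\<in>H1. (\<forall>i\<in>E. \<theta> x i = s * x i) \<longrightarrow> (\<forall>i. \<theta> x i = s * x i)"
    using rigid_endomorphism[OF \<theta>H \<theta>add] by blast
  \<comment> \<open>Otherwise \<open>\<theta>\<close> would have finite rank and kill a nonzero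
    vector.\<close>
  have s: "s \<noteq> 0"
  proof
    assume s0: "s = 0"
    have "\<exists>z\<in>H1. (\<exists>i. z i \<noteq> 0) \<and> (\<forall>g\<in>(\<lambda>i x. \<theta> x i) ` E. g z = 0)"
      by (rule kernel_vector) (use E \<theta>add in auto)
    then obtain z j where z: "z \<in> H1" "z j \<noteq> 0" "\<forall>i\<in>E. \<theta> z i = 0" by auto
    then have "\<theta> z = (\<lambda>i. 0)" using E(2) s0 by auto
    then show False using \<theta>inj[OF z(1)] z(2) by simp
  qed
  define \<phi> where "\<phi> x = (\<lambda>i. 1 * \<theta> x i + (- s) * x i)" for x
  have \<phi>add: "additive_on H1 (\<lambda>x. \<phi> x i)" for i
    using \<theta>add[of i] by (simp add: additive_on_def \<phi>_def algebra_simps)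
  have \<phi>H: "\<phi> x \<in> H1" if "x \<in> H1" for x
    unfolding \<phi>_def by (rule lincomb_closedD[OF lc \<theta>H[OF that] that])
  have lcA: "lincomb_closed (\<phi> ` H1)" by (rule lincomb_closed_image[OF lc \<phi>add])
  have "\<exists>E. finite E \<and> (\<forall>y\<in>\<phi> ` H1. (\<forall>i\<in>E. y i = 0) \<longrightarrow> (\<forall>i. y i = 0))"
    using E by (intro exI[of _ E]) (auto simp: \<phi>_def)
  then obtain r where r: "dependent_families r (\<phi> ` H1)"
    using finite_rank_iff_coordinates[OF lcA] finite_rank_iff_dependent[OF lcA] by blast
  \<comment> \<open>All iterates lie in the image of \<open>\<phi>\<close>, since
    \<open>\<theta> u = \<phi> u + s u\<close> for \<open>u\<close> in it. As this image has finite
    rank, they are dependent.\<close>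
  define t where "t n = (\<theta> ^^ n) (\<phi> y)" for n
  have tS: "t (Suc n) = \<theta> (t n)" for n by (simp add: t_def)
  have t: "t n \<in> \<phi> ` H1" for n
  proof (induction n)
    case 0
    then show ?case using y by (simp add: t_def)
  next
    case (Suc n)
    obtain x where "t n = \<phi> x" "x \<in> H1" using Suc by (rule imageE)
    then have "t n \<in> H1" using \<phi>H by simp
    then have "\<phi> (t n) \<in> \<phi> ` H1" by (rule imageI)
    from lincomb_closedD[OF lcA this Suc, of 1 s] show ?case unfolding tS by (simp add: \<phi>_def)
  qed
  have tH: "t n \<in> H1" for n using t[of n] \<phi>H by (elim imageE) simp
  \<comment> \<open>While the coefficient of \<open>t 0\<close> is 0, injectivity of
    \<open>\<theta>\<close> lets all exponents be lowered by one. A nonzero coefficient puts a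
    multiple of \<open>t 0\<close> into the image of \<open>\<theta>\<close>.\<close>
  have multiple: "\<exists>d w. d \<noteq> 0 \<and> w \<in> H1 \<and> (\<lambda>i. d * t 0 i) = \<theta> w"
    if "\<exists>j<n. c j \<noteq> 0" "\<forall>i. (\<Sum>j<n. c j * t j i) = 0" for n and c :: "nat \<Rightarrow> int"
    using that
  proof (induction n arbitrary: c)
    case (Suc n)
    define w where "w i = (\<Sum>j<n. c (Suc j) * t j i)" for i
    have w: "w \<in> H1" unfolding w_def by (rule lincomb_closed_sum[OF lc]) (use tH in auto)
    have "\<theta> w i = (\<Sum>j<n. c (Suc j) * t (Suc j) i)" for i
      unfolding w_def tS by (rule additive_sum[OF lc \<theta>add]) (use tH in auto)
    then have sum: "c 0 * t 0 i + \<theta> w i = 0" for i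
      using spec[OF Suc.prems(2), of i] unfolding sum.lessThan_Suc_shift by simp
    show ?case
    proof (cases "c 0 = 0")
      case True
      then have "\<theta> w = (\<lambda>i. 0)" using sum by auto
      then have "w = (\<lambda>i. 0)" by (rule \<theta>inj[OF w])
      then have "\<forall>i. (\<Sum>j<n. c (Suc j) * t j i) = 0" by (simp add: w_def fun_eq_iff)
      moreover have "\<exists>j<n. c (Suc j) \<noteq> 0"
        using Suc.prems(1) True by (metis less_Suc_eq_0_disj)
      ultimately show ?thesis using Suc.IH[of "\<lambda>j. c (Suc j)"] by blast
    next
      case False
      have "(\<lambda>i. - c 0 * t 0 i) = \<theta> w"
      proof
        show "- c 0 * t 0 i = \<theta> w i" for i using sum[of i] by simp
      qed
      then show ?thesis using False w by (intro exI[of _ "- c 0"] exI[of _ w]) simp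
    qed
  qed simp
  from r[unfolded dependent_families_def, THEN spec[of _ t], THEN mp] t
  obtain c where "(\<exists>j<r. c j \<noteq> 0) \<and> (\<forall>i. (\<Sum>j<r. c j * t j i) = 0)" by blast
  with multiple[of r c] obtain d w where d: "d \<noteq> 0" "w \<in> H1" "(\<lambda>i. d * t 0 i) = \<theta> w" by blast
  \<comment> \<open>As \<open>t 0 = \<theta> y - s y\<close>, the relation
    \<open>d * t 0 = \<theta> w\<close> becomes
    \<open>d * s * y = \<theta> (d * y - w)\<close>.\<close>
  let ?w = "\<lambda>i. d * y i + (- 1) * w i"
  have "\<theta> ?w i = d * \<theta> y i + (- 1) * \<theta> w i" for i by (rule additive_lincomb[OF lc \<theta>add y d(2)])
  moreover have "\<theta> w i = d * (\<theta> y i - s * y i)" for i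
    using fun_cong[OF d(3), of i] by (simp add: t_def \<phi>_def)
  ultimately have "(\<lambda>i. (d * s) * y i) = \<theta> ?w" by (auto simp: fun_eq_iff algebra_simps)
  moreover have "?w \<in> H1" by (rule lincomb_closedD[OF lc y d(2)])
  ultimately have "d * s = 0" using indep by blast
  then show False using d(1) s by simp
qed

end

section \<open>Purity and bilinearity\<close>

context dual_pair
begin

lemma pure_inclusions:
  "subgroup H1 baer_specker \<and> SS \<subseteq> H1 \<and> H1 \<subseteq> DD \<and>
    pure_subgroup SS (bs_subgroup H1) \<and> pure_subgroup H1 (bs_subgroup DD)"
proof (intro conjI)
  show "subgroup H1 baer_specker" unfolding subgroup_iff_lincomb_closed by (rule lincomb_closed_H1)
  show SS: "SS \<subseteq> H1" unfolding SS_eq_finsupp using finsupp_H1 by blast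
  show "H1 \<subseteq> DD" by (rule DD1)
  show "pure_subgroup SS (bs_subgroup H1)"
  proof (rule pure_subgroup_bs[OF _ lincomb_closed_H1 SS])
    show "lincomb_closed SS" unfolding SS_eq_finsupp by (rule lincomb_closed_finsupp)
    show "x \<in> SS" if "(\<lambda>i. q * x i) \<in> SS" "q \<noteq> 0" for q x
      using that unfolding SS_eq_finsupp by (simp add: finsupp_def)
  qed
  show "pure_subgroup H1 (bs_subgroup DD)"
    by (rule pure_subgroup_bs[OF lincomb_closed_H1 lincomb_closed_DD DD1 divide_H1])
qed

lemma bilinear_form_\<Phi>int: "bilinear_form (bs_subgroup H1) (bs_subgroup H2) \<Phi>int"
proof -
  interpret swap: dual_pair H2 H1 by (rule dual_pair_swap)
  have "\<Phi>int (\<lambda>i. a i + a' i) b = \<Phi>int a b + \<Phi>int a' b" if "a \<in> H1" "a' \<in> H1" "b \<in> H2" for a a' b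
    using additive_\<Phi>int[OF that(3)] that by (simp add: additive_on_def)
  moreover have "\<Phi>int a (\<lambda>i. b i + b' i) = \<Phi>int a b + \<Phi>int a b'" if "a \<in> H1" "b \<in> H2" "b' \<in> H2" for a b b'
    using swap.additive_\<Phi>int[OF that(1)] that by (simp add: additive_on_def \<Phi>int_commute[of a])
  ultimately show ?thesis unfolding bilinear_form_def mult_bs by simp
qed

end

theorem theorem1p2:
  assumes "martins_axiom TYPE(nat set)"
  shows "\<exists>H1 H2 :: (nat \<Rightarrow> int) set.
    (\<forall>H\<in>{H1, H2}.
       subgroup H baer_specker \<and> SS \<subseteq> H \<and> H \<subseteq> DD \<and>
       pure_subgroup SS (baer_specker\<lparr>carrier := H\<rparr>) \<and>
       pure_subgroup H (baer_specker\<lparr>carrier := DD\<rparr>)) \<and>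
    (\<forall>H\<in>{H1, H2}.
       aleph1_free (baer_specker\<lparr>carrier := H\<rparr>) \<and> slender (baer_specker\<lparr>carrier := H\<rparr>)) \<and>
    (\<forall>a\<in>H1. \<forall>b\<in>H2. \<Phi> a b \<in> range zhat_of_int) \<and>
    bilinear_form (baer_specker\<lparr>carrier := H1\<rparr>) (baer_specker\<lparr>carrier := H2\<rparr>) \<Phi>int \<and>
    (\<lambda>h\<in>H2. \<lambda>a\<in>H1. \<Phi>int a h)
      \<in> iso (baer_specker\<lparr>carrier := H2\<rparr>) (dual_group (baer_specker\<lparr>carrier := H1\<rparr>)) \<and>
    (\<lambda>h\<in>H1. \<lambda>b\<in>H2. \<Phi>int h b)
      \<in> iso (baer_specker\<lparr>carrier := H1\<rparr>) (dual_group (baer_specker\<lparr>carrier := H2\<rparr>)) \<and>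
    (\<forall>H\<in>{H1, H2}. reflexive_group (baer_specker\<lparr>carrier := H\<rparr>)) \<and>
    (\<forall>H\<in>{H1, H2}.
       \<not> (baer_specker\<lparr>carrier := H\<rparr> \<times>\<times> integer_group \<cong> baer_specker\<lparr>carrier := H\<rparr>)) \<and>
    (\<forall>H\<in>{H1, H2}.
       \<forall>f\<in>End (baer_specker\<lparr>carrier := H\<rparr>).
         \<exists>!p. case p of (s :: int, \<phi>) \<Rightarrow>
           \<phi> \<in> Fin (baer_specker\<lparr>carrier := H\<rparr>) \<and>
           f = (\<lambda>x\<in>H. x [^]\<^bsub>baer_specker\<lparr>carrier := H\<rparr>\<^esub> s
                        \<otimes>\<^bsub>baer_specker\<lparr>carrier := H\<rparr>\<^esub> \<phi> x))"
proof -
  obtain H1 H2 where H: "H1 \<subseteq> DD" "H2 \<subseteq> DD" "\<forall>a\<in>H1. \<forall>b\<in>H2. compatible a b"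
    "\<forall>a. (\<forall>b\<in>H2. compatible a b) \<longrightarrow> a \<in> H1" "\<forall>b. (\<forall>a\<in>H1. compatible a b) \<longrightarrow> b \<in> H2"
    and rigid: "\<forall>M. range M \<subseteq> H1 \<longrightarrow> range (column M) \<subseteq> H2 \<longrightarrow> (\<forall>x\<in>H1. transform M x \<in> H1) \<longrightarrow>
      scalar_mod_finite M H1 H2"
    using exists_rigid_pair[OF assms] by (elim exE conjE)
  interpret rigid_pair H1 H2
  proof
    show "H1 \<subseteq> DD" "H2 \<subseteq> DD" by (rule H)+
    show "compatible a b" if "a \<in> H1" "b \<in> H2" for a b using H(3) that by blast
    show "a \<in> H1" if "\<And>b. b \<in> H2 \<Longrightarrow> compatible a b" for a using H(4) that by blast
    show "b \<in> H2" if "\<And>a. a \<in> H1 \<Longrightarrow> compatible a b" for b using H(5) that by blast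
    show "scalar_mod_finite M H1 H2"
      if "range M \<subseteq> H1" "range (column M) \<subseteq> H2" "\<And>x. x \<in> H1 \<Longrightarrow> transform M x \<in> H1" for M
      using rigid that by blast
  qed
  interpret swap: rigid_pair H2 H1 by (rule rigid_pair_swap)
  have both: "P H1 \<Longrightarrow> P H2 \<Longrightarrow> \<forall>H\<in>{H1, H2}. P H" for P by simp
  show ?thesis
  proof (rule exI[of _ H1], rule exI[of _ H2], intro conjI)
    show "\<forall>H\<in>{H1, H2}. subgroup H baer_specker \<and> SS \<subseteq> H \<and> H \<subseteq> DD \<and>
        pure_subgroup SS (bs_subgroup H) \<and> pure_subgroup H (bs_subgroup DD)"
      by (rule both[OF pure_inclusions swap.pure_inclusions])
    show "\<forall>H\<in>{H1, H2}. aleph1_free (bs_subgroup H) \<and> slender (bs_subgroup H)"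
      by (rule both) (intro conjI aleph1_free_bs lincomb_closed_H1 swap.lincomb_closed_H1 slender_H1 swap.slender_H1)+
    show "\<forall>a\<in>H1. \<forall>b\<in>H2. \<Phi> a b \<in> range zhat_of_int" using \<Phi>_integral by blast
    show "bilinear_form (bs_subgroup H1) (bs_subgroup H2) \<Phi>int" by (rule bilinear_form_\<Phi>int)
    show "(\<lambda>h\<in>H2. \<lambda>a\<in>H1. \<Phi>int a h) \<in> iso (bs_subgroup H2) (dual_group (bs_subgroup H1))"
      by (rule iso_dual)
    show "(\<lambda>h\<in>H1. \<lambda>b\<in>H2. \<Phi>int h b) \<in> iso (bs_subgroup H1) (dual_group (bs_subgroup H2))"
    proof -
      have "(\<lambda>h\<in>H1. \<lambda>b\<in>H2. \<Phi>int h b) = (\<lambda>h\<in>H1. \<lambda>b\<in>H2. \<Phi>int b h)"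
        by (intro restrict_ext \<Phi>int_commute)
      then show ?thesis using swap.iso_dual by (simp only:)
    qed
    show "\<forall>H\<in>{H1, H2}. reflexive_group (bs_subgroup H)"
      by (rule both[OF reflexive swap.reflexive])
    show "\<forall>H\<in>{H1, H2}. \<not> (bs_subgroup H \<times>\<times> integer_group \<cong> bs_subgroup H)"
      by (rule both[OF not_iso_DirProd_integer swap.not_iso_DirProd_integer])
    show "\<forall>H\<in>{H1, H2}. \<forall>f\<in>End (bs_subgroup H). \<exists>!p. case p of (s :: int, \<phi>) \<Rightarrow>
        \<phi> \<in> Fin (bs_subgroup H) \<and>
        f = (\<lambda>x\<in>H. x [^]\<^bsub>bs_subgroup H\<^esub> s \<otimes>\<^bsub>bs_subgroup H\<^esub> \<phi> x)"
      by (rule both) (intro ballI End_decomposition swap.End_decomposition, assumption)+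
  qed
qed

end
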